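(* Let $\Omega\subset\mathbb{R}^d$ be a bounded Lipschitz domain, $0<T<\infty$ and $Q=[0,T]\times\Omega$. Let $A\in C^1(\mathbb{R}^d)$ be such that, for constants $C_A,\overline{C}_A>0$, $(A'(p)-A'(q),p-q)\ge C_A|p-q|^2$ and $|A'(p)|\le\overline{C}_A|p|$ for all $p,q\in\mathbb{R}^d$. Let $\psi\in C^1(\mathbb{R})$ be bounded from below, and suppose there are constants $c,C_\psi\ge0$, $C_n\ge0$ $(n\in\mathbb{N})$ and functions $f_n\in C^2(\mathbb{R})$ with $f_n\to\psi$ in $C^1_{\mathrm{loc}}(\mathbb{R})$, $-c\le f_n\le c(\psi+1)$, $f_n''\ge-C_\psi$ and $|f_n''|\le C_n$ on $\mathbb{R}$. Then the weak solution $y\in L^\infty(0,T;H^1(\Omega))\cap H^1(0,T;L^2(\Omega))$ of $$\int_Q\partial_ty\,\eta+A'(\nabla y)^T\nabla\eta+\psi'(y)\eta=\int_Qu\,\eta\quad\forall\eta\in L^2(0,T;H^1(\Omega)),\qquad y(0)=y_0\ \text{ in }\Omega,$$ depends Lipschitz-continuously on $(y_0,u)$ in the sense that there is a constant $C_{\psi,A,T}$ such that $$\|y_1-y_2\|_{C([0,T];L^2(\Omega))\cap L^2(0,T;H^1(\Omega))}\le C_{\psi,A,T}\Big(\|y_{1,0}-y_{2,0}\|_{L^2(\Omega)}+\|u_1-u_2\|_{L^2(0,T;H^1(\Omega)')}\Big),$$ where $y_1,y_2$ are the solutions to the data $(y_{1,0},u_1)$ and $(y_{2,0},u_2)$ respectively,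 with $u_i\in L^2(0,T;L^2(\Omega))$, $y_{i,0}\in H^1(\Omega)$ and $\psi(y_{i,0})\in L^1(\Omega)$ for $i=1,2$.
   Context: $A'$ denotes the gradient of $A$. $H^1(\Omega)'$ is the dual space of $H^1(\Omega)$, with $L^2(\Omega)\hookrightarrow H^1(\Omega)'$ via the $L^2$ scalar product. The norm on $C([0,T];L^2(\Omega))\cap L^2(0,T;H^1(\Omega))$ is the sum of the two norms. Under the stated assumptions, for each such $(y_0,u)$ the equation has a unique weak solution in $L^\infty(0,T;H^1(\Omega))\cap H^1(0,T;L^2(\Omega))$. *)

theory Defs
  imports "HOL-Analysis.Analysis"
begin

text \<open>
  Near every boundary point, after a choice of the vertical unit direction \<open>e\<close>, the
  domain is the strict epigraph of a Lipschitz function of the horizontal coordinates.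
\<close>

definition bounded_lipschitz_domain :: "'a::euclidean_space set \<Rightarrow> bool" where
  "bounded_lipschitz_domain \<Omega> \<longleftrightarrow>
     open \<Omega> \<and> connected \<Omega> \<and> \<Omega> \<noteq> {} \<and> bounded \<Omega> \<and>
     (\<forall>p\<in>frontier \<Omega>. \<exists>r>0. \<exists>e g L. norm e = 1 \<and> L-lipschitz_on {z. z \<bullet> e = 0} (g :: 'a \<Rightarrow> real) \<and>
        \<Omega> \<inter> ball p r = {x \<in> ball p r. x \<bullet> e > g (x - (x \<bullet> e) *\<^sub>R e)})"

primrec C_k :: "nat \<Rightarrow> ('a::euclidean_space \<Rightarrow> real) \<Rightarrow> bool" where
  "C_k 0 f \<longleftrightarrow> continuous_on UNIV f"
| "C_k (Suc k) f \<longleftrightarrow> (\<exists>G. (\<forall>x. GDERIV f x :> G x) \<and> (\<forall>b\<in>Basis. C_k k (\<lambda>x. G x \<bullet> b)))"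

definition test_functions :: "'a::euclidean_space set \<Rightarrow> ('a \<Rightarrow> real) set" where
  "test_functions \<Omega> = {\<phi>. (\<forall>k. C_k k \<phi>) \<and>
     compact (closure {x. \<phi> x \<noteq> 0}) \<and> closure {x. \<phi> x \<noteq> 0} \<subseteq> \<Omega>}"

text \<open>
  Elements of these spaces are represented by functions on the whole type, of which only the
  values on \<open>\<Omega>\<close> matter; the norms are seminorms that vanish on a.e. zero functions.
\<close>

definition L2_space :: "'a::euclidean_space set \<Rightarrow> ('a \<Rightarrow> 'b::euclidean_space) set" where
  "L2_space \<Omega> = {v \<in> borel_measurable (lebesgue_on \<Omega>). integrable (lebesgue_on \<Omega>) (\<lambda>x. (norm (v x))\<^sup>2)}"

definition L2_norm :: "'a::euclidean_space set \<Rightarrow> ('a \<Rightarrow> 'b::euclidean_space) \<Rightarrow> real" where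
  "L2_norm \<Omega> v = sqrt (\<integral>x. (norm (v x))\<^sup>2 \<partial>lebesgue_on \<Omega>)"

definition has_weak_gradient ::
    "'a::euclidean_space set \<Rightarrow> ('a \<Rightarrow> real) \<Rightarrow> ('a \<Rightarrow> 'a) \<Rightarrow> bool" where
  "has_weak_gradient \<Omega> v g \<longleftrightarrow> v \<in> L2_space \<Omega> \<and> g \<in> L2_space \<Omega> \<and>
     (\<forall>\<phi>\<in>test_functions \<Omega>. \<forall>\<phi>'. (\<forall>x. GDERIV \<phi> x :> \<phi>' x) \<longrightarrow>
        (\<integral>x. v x *\<^sub>R \<phi>' x \<partial>lebesgue_on \<Omega>) = - (\<integral>x. \<phi> x *\<^sub>R g x \<partial>lebesgue_on \<Omega>))"

definition H1_space :: "'a::euclidean_space set \<Rightarrow> ('a \<Rightarrow> real) set" where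
  "H1_space \<Omega> = {v. \<exists>g. has_weak_gradient \<Omega> v g}"

definition H1_norm :: "'a::euclidean_space set \<Rightarrow> ('a \<Rightarrow> real) \<Rightarrow> real" where
  "H1_norm \<Omega> v = sqrt ((L2_norm \<Omega> v)\<^sup>2 + (L2_norm \<Omega> (SOME g. has_weak_gradient \<Omega> v g))\<^sup>2)"

text \<open>The norm in \<open>H\<^sup>1(\<Omega>)'\<close> of the functional \<open>v \<mapsto> (w, v)\<close> given by \<open>w \<in> L\<^sup>2(\<Omega>)\<close>.\<close>

definition H1_dual_norm :: "'a::euclidean_space set \<Rightarrow> ('a \<Rightarrow> real) \<Rightarrow> real" where
  "H1_dual_norm \<Omega> w =
     (SUP v\<in>{v \<in> H1_space \<Omega>. H1_norm \<Omega> v \<le> 1}. \<bar>\<integral>x. w x * v x \<partial>lebesgue_on \<Omega>\<bar>)"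

text \<open>
  The target is a set \<open>X\<close> of functions with a seminorm \<open>N\<close>; measurability and the integral
  are Bochner's, by approximation with \<open>X\<close>-valued simple functions.
\<close>

definition simple_approx ::
    "real \<Rightarrow> 'v set \<Rightarrow> ('v::minus \<Rightarrow> real) \<Rightarrow> (real \<Rightarrow> 'v) \<Rightarrow> (nat \<Rightarrow> real \<Rightarrow> 'v) \<Rightarrow> bool" where
  "simple_approx T X N f s \<longleftrightarrow>
     (\<forall>n. simple_function (lebesgue_on {0..T}) (s n) \<and> s n ` {0..T} \<subseteq> X) \<and>
     (AE t in lebesgue_on {0..T}. f t \<in> X \<and> (\<lambda>n. N (f t - s n t)) \<longlonglongrightarrow> 0)"

definition strongly_measurable ::
    "real \<Rightarrow> 'v set \<Rightarrow> ('v::minus \<Rightarrow> real) \<Rightarrow> (real \<Rightarrow> 'v) \<Rightarrow> bool" where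
  "strongly_measurable T X N f \<longleftrightarrow> (\<exists>s. simple_approx T X N f s)"

definition has_time_integral ::
    "real \<Rightarrow> ('a \<Rightarrow> real) set \<Rightarrow> (('a \<Rightarrow> real) \<Rightarrow> real) \<Rightarrow> (real \<Rightarrow> 'a \<Rightarrow> real) \<Rightarrow> ('a \<Rightarrow> real) \<Rightarrow> bool" where
  "has_time_integral T X N f I \<longleftrightarrow> I \<in> X \<and> (\<exists>s. simple_approx T X N f s \<and>
     (\<lambda>n. \<integral>\<^sup>+t. ennreal (N (f t - s n t)) \<partial>lebesgue_on {0..T}) \<longlonglongrightarrow> 0 \<and>
     (\<lambda>n. N (I - (\<lambda>x. \<Sum>v\<in>s n ` {0..T}. measure lebesgue {t \<in> {0..T}. s n t = v} * v x))) \<longlonglongrightarrow> 0)"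

definition Q_measure :: "real \<Rightarrow> 'a::euclidean_space set \<Rightarrow> (real \<times> 'a) measure" where
  "Q_measure T \<Omega> = lebesgue_on {0..T} \<Otimes>\<^sub>M lebesgue_on \<Omega>"

text \<open>
  An element of a Bochner space is given by a representative \<open>y\<close> for which \<open>(t,x) \<mapsto> y t x\<close> is
  measurable on \<open>Q\<close>, so that integrals over \<open>Q\<close> make sense. Every class with values in
  \<open>L\<^sup>2(\<Omega>)\<close> has such a representative, so this is no restriction.
\<close>

definition Q_measurable :: "real \<Rightarrow> 'a::euclidean_space set \<Rightarrow> (real \<Rightarrow> 'a \<Rightarrow> 'b::euclidean_space) \<Rightarrow> bool" where
  "Q_measurable T \<Omega> y \<longleftrightarrow> (\<lambda>(t, x). y t x) \<in> borel_measurable (Q_measure T \<Omega>)"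

definition L2_time_norm :: "real \<Rightarrow> ('v \<Rightarrow> real) \<Rightarrow> (real \<Rightarrow> 'v) \<Rightarrow> real" where
  "L2_time_norm T N y = sqrt (\<integral>t. (N (y t))\<^sup>2 \<partial>lebesgue_on {0..T})"

definition L2_L2 :: "real \<Rightarrow> 'a::euclidean_space set \<Rightarrow> (real \<Rightarrow> 'a \<Rightarrow> real) set" where
  "L2_L2 T \<Omega> = {y. Q_measurable T \<Omega> y \<and> strongly_measurable T (L2_space \<Omega>) (L2_norm \<Omega>) y \<and>
     integrable (lebesgue_on {0..T}) (\<lambda>t. (L2_norm \<Omega> (y t))\<^sup>2)}"

definition L2_H1 :: "real \<Rightarrow> 'a::euclidean_space set \<Rightarrow> (real \<Rightarrow> 'a \<Rightarrow> real) set" where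
  "L2_H1 T \<Omega> = {y. Q_measurable T \<Omega> y \<and> strongly_measurable T (H1_space \<Omega>) (H1_norm \<Omega>) y \<and>
     integrable (lebesgue_on {0..T}) (\<lambda>t. (H1_norm \<Omega> (y t))\<^sup>2)}"

definition Linf_H1 :: "real \<Rightarrow> 'a::euclidean_space set \<Rightarrow> (real \<Rightarrow> 'a \<Rightarrow> real) set" where
  "Linf_H1 T \<Omega> = {y. Q_measurable T \<Omega> y \<and> strongly_measurable T (H1_space \<Omega>) (H1_norm \<Omega>) y \<and>
     (\<exists>K. AE t in lebesgue_on {0..T}. H1_norm \<Omega> (y t) \<le> K)}"

definition C_L2 :: "real \<Rightarrow> 'a::euclidean_space set \<Rightarrow> (real \<Rightarrow> 'a \<Rightarrow> real) set" where
  "C_L2 T \<Omega> = {y. \<forall>t\<in>{0..T}. y t \<in> L2_space \<Omega> \<and>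
     ((\<lambda>s. L2_norm \<Omega> (y s - y t)) \<longlongrightarrow> 0) (at t within {0..T})}"

definition C_L2_norm :: "real \<Rightarrow> 'a::euclidean_space set \<Rightarrow> (real \<Rightarrow> 'a \<Rightarrow> real) \<Rightarrow> real" where
  "C_L2_norm T \<Omega> y = (SUP t\<in>{0..T}. L2_norm \<Omega> (y t))"

text \<open>
  Weak time derivative in \<open>L\<^sup>2(0,T;L\<^sup>2(\<Omega>))\<close>: the \<open>L\<^sup>2(\<Omega>)\<close>-valued integrals of \<open>\<phi>' y\<close> and
  \<open>- \<phi> y\<^sub>t\<close> coincide for every test function \<open>\<phi>\<close> on \<open>(0,T)\<close>.
\<close>

definition has_time_derivative ::
    "real \<Rightarrow> 'a::euclidean_space set \<Rightarrow> (real \<Rightarrow> 'a \<Rightarrow> real) \<Rightarrow> (real \<Rightarrow> 'a \<Rightarrow> real) \<Rightarrow> bool" where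
  "has_time_derivative T \<Omega> y y\<^sub>t \<longleftrightarrow> y \<in> L2_L2 T \<Omega> \<and> y\<^sub>t \<in> L2_L2 T \<Omega> \<and>
     (\<forall>\<phi>\<in>test_functions {0<..<T}. \<forall>\<phi>'. (\<forall>t. (\<phi> has_real_derivative \<phi>' t) (at t)) \<longrightarrow>
        (\<exists>I. has_time_integral T (L2_space \<Omega>) (L2_norm \<Omega>) (\<lambda>t x. \<phi>' t * y t x) I \<and>
             has_time_integral T (L2_space \<Omega>) (L2_norm \<Omega>) (\<lambda>t x. - \<phi> t * y\<^sub>t t x) I))"

definition H1_L2 :: "real \<Rightarrow> 'a::euclidean_space set \<Rightarrow> (real \<Rightarrow> 'a \<Rightarrow> real) set" where
  "H1_L2 T \<Omega> = {y. \<exists>y\<^sub>t. has_time_derivative T \<Omega> y y\<^sub>t}"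

text \<open>\<open>G\<close> is a representative, measurable on \<open>Q\<close>, of the spatial gradient \<open>\<nabla>y\<close>.\<close>

definition has_space_gradient ::
    "real \<Rightarrow> 'a::euclidean_space set \<Rightarrow> (real \<Rightarrow> 'a \<Rightarrow> real) \<Rightarrow> (real \<Rightarrow> 'a \<Rightarrow> 'a) \<Rightarrow> bool" where
  "has_space_gradient T \<Omega> y G \<longleftrightarrow>
     Q_measurable T \<Omega> G \<and> (AE t in lebesgue_on {0..T}. has_weak_gradient \<Omega> (y t) (G t))"

text \<open>
  Here \<open>A'\<close> is the gradient of \<open>A\<close> and \<open>\<psi>'\<close> the derivative of \<open>\<psi>\<close>. Since
  \<open>H\<^sup>1(0,T;L\<^sup>2(\<Omega>))\<close> embeds into \<open>C([0,T];L\<^sup>2(\<Omega>))\<close>, the solution is represented by its continuous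
  representative, which gives \<open>y 0\<close> its meaning. The integrability of \<open>\<psi>'(y) \<eta>\<close> on \<open>Q\<close> is
  stated because the integral of a non-integrable function is \<open>0\<close> by convention; the remaining
  terms are products of square-integrable functions.
\<close>

definition weak_solution ::
    "real \<Rightarrow> 'a::euclidean_space set \<Rightarrow> ('a \<Rightarrow> 'a) \<Rightarrow> (real \<Rightarrow> real) \<Rightarrow>
     ('a \<Rightarrow> real) \<Rightarrow> (real \<Rightarrow> 'a \<Rightarrow> real) \<Rightarrow> (real \<Rightarrow> 'a \<Rightarrow> real) \<Rightarrow> bool" where
  "weak_solution T \<Omega> A' \<psi>' y\<^sub>0 u y \<longleftrightarrow>
     y \<in> Linf_H1 T \<Omega> \<and> y \<in> H1_L2 T \<Omega> \<and> y \<in> C_L2 T \<Omega> \<and>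
     (AE x in lebesgue_on \<Omega>. y 0 x = y\<^sub>0 x) \<and>
     (\<exists>y\<^sub>t G. has_time_derivative T \<Omega> y y\<^sub>t \<and> has_space_gradient T \<Omega> y G \<and>
        (\<forall>\<eta>\<in>L2_H1 T \<Omega>. \<forall>H. has_space_gradient T \<Omega> \<eta> H \<longrightarrow>
           integrable (Q_measure T \<Omega>) (\<lambda>(t, x). \<psi>' (y t x) * \<eta> t x) \<and>
           (\<integral>(t, x). y\<^sub>t t x * \<eta> t x + A' (G t x) \<bullet> H t x + \<psi>' (y t x) * \<eta> t x \<partial>Q_measure T \<Omega>)
             = (\<integral>(t, x). u t x * \<eta> t x \<partial>Q_measure T \<Omega>)))"

end

(*
  Testing the two equations with the difference w = y1 - y2, cut off to (0,s], gives
    |w(s)|^2/2 - |w(0)|^2/2 + C_A int |grad w|^2 - C_psi int |w|^2 <= int <u1 - u2, w>,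
  because A' is strongly monotone and psi' + C_psi id is nondecreasing, as the pointwise limit of
  the functions f_n' + C_psi id. Young's inequality absorbs the H1 norm of w on the right, and
  Gronwall's lemma bounds the supremum of |w|^2.

  Two facts make this rigorous for the given definitions. The H1 norm is defined through a chosen
  weak gradient, so weak gradients must be unique a.e. (du Bois-Reymond, with test functions that
  approximate the indicator of an open set). And the distributional time derivative has to be
  turned into increments: testing with smoothed indicators of (r,s] gives
  (w(s) - w(r), v) = int_r^s (w_t, v) for each fixed v, from which the derivative of |w|^2 follows
  by comparing increments on short intervals.
*)

theory Submission
  imports Defs "HOL-Real_Asymp.Real_Asymp"
begin

section \<open>Square-integrable functions\<close>

text \<open>Since \<psi> is only C^1, the bound on \<open>f''\<close> has to be turned into an
  inequality for differences, \<open>- C\<^sub>\<psi> * (a - b)\<^sup>2 \<le> (\<psi>' a - \<psi>'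
  b) * (a - b)\<close>, before n tends to infinity. The term \<psi>'(y) is known to be integrable
  only as a product with a test function, so the two equations are compared through a pointwise
  inequality between whole integrands. The forcing is measured in the dual of H^1. Young's
  inequality then costs \<open>C\<^sub>A / 2\<close> times the full squared H^1 norm: its gradient
  part is absorbed, its L^2 part raises the Gronwall rate to
  \<open>2 * C\<^sub>\<psi> + C\<^sub>A\<close>. Elements of the spaces are functions and the norms
  are seminorms, so Hilbert space facts such as Cauchy-Schwarz are derived from the integrals. Norms
  that involve a chosen gradient or a supremum over test elements need measurability arguments of
  their own.\<close>

lemma L2_spaceI:
  assumes "v \<in> borel_measurable (lebesgue_on \<Omega>)" "integrable (lebesgue_on \<Omega>) (\<lambda>x. (norm (v x))\<^sup>2)"
  shows "v \<in> L2_space \<Omega>"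
  using assms by (simp add: L2_space_def)

lemma L2_space_measurable: "v \<in> L2_space \<Omega> \<Longrightarrow> v \<in> borel_measurable (lebesgue_on \<Omega>)"
  and L2_space_integrable: "v \<in> L2_space \<Omega> \<Longrightarrow> integrable (lebesgue_on \<Omega>) (\<lambda>x. (norm (v x))\<^sup>2)"
  by (simp_all add: L2_space_def)

lemma L2_norm_nonneg [simp]: "0 \<le> L2_norm \<Omega> v"
  by (simp add: L2_norm_def integral_nonneg_AE)

lemma L2_norm_power2: "(L2_norm \<Omega> v)\<^sup>2 = (\<integral>x. (norm (v x))\<^sup>2 \<partial>lebesgue_on \<Omega>)"
  by (simp add: L2_norm_def integral_nonneg_AE)

lemma L2_norm_cong_AE:
  assumes "u \<in> L2_space \<Omega>" "v \<in> L2_space \<Omega>" "AE x in lebesgue_on \<Omega>. u x = v x"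
  shows "L2_norm \<Omega> u = L2_norm \<Omega> v"
  unfolding L2_norm_def using assms L2_space_integrable
  by (intro arg_cong[where f = sqrt] integral_cong_AE borel_measurable_integrable) auto

lemma L2_norm_minus_commute: "L2_norm \<Omega> (u - v) = L2_norm \<Omega> (v - u)"
  by (simp add: L2_norm_def norm_minus_commute)

lemma L2_space_zero [simp]: "(\<lambda>x. 0) \<in> L2_space \<Omega>"
  by (simp add: L2_space_def)

lemma L2_norm_zero [simp]: "L2_norm \<Omega> (\<lambda>x. 0) = 0"
  by (simp add: L2_norm_def)

lemma L2_space_scaleR: "v \<in> L2_space \<Omega> \<Longrightarrow> (\<lambda>x. k *\<^sub>R v x) \<in> L2_space \<Omega>"
  by (auto simp: L2_space_def power_mult_distrib)

lemma L2_norm_scaleR: "L2_norm \<Omega> (\<lambda>x. k *\<^sub>R v x) = \<bar>k\<bar> * L2_norm \<Omega> v"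
  by (simp add: L2_norm_def power_mult_distrib real_sqrt_mult)

text \<open>The parallelogram law with the term \<open>(norm (a - b))\<^sup>2\<close> dropped. It
  gives integrability of the square of a sum before products are known to be integrable.\<close>

lemma norm_add_power2_le: "(norm (a + b :: 'b::real_inner))\<^sup>2 \<le> 2 * (norm a)\<^sup>2 + 2 * (norm b)\<^sup>2"
  using zero_le_power2[of "norm (a - b)"]
  by (simp add: power2_norm_eq_inner inner_add inner_diff inner_commute)

lemma L2_space_add:
  assumes "u \<in> L2_space \<Omega>" "v \<in> L2_space \<Omega>"
  shows "(\<lambda>x. u x + v x) \<in> L2_space \<Omega>"
proof (rule L2_spaceI)
  note [measurable] = assms[THEN L2_space_measurable]
  show "(\<lambda>x. u x + v x) \<in> borel_measurable (lebesgue_on \<Omega>)" by measurable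
  have "integrable (lebesgue_on \<Omega>) (\<lambda>x. 2 * (norm (u x))\<^sup>2 + 2 * (norm (v x))\<^sup>2)"
    using assms by (intro Bochner_Integration.integrable_add integrable_mult_right L2_space_integrable)
  then show "integrable (lebesgue_on \<Omega>) (\<lambda>x. (norm (u x + v x))\<^sup>2)"
    by (rule Bochner_Integration.integrable_bound) (auto intro!: AE_I2 norm_add_power2_le)
qed

lemma L2_space_diff:
  assumes "u \<in> L2_space \<Omega>" "v \<in> L2_space \<Omega>"
  shows "u - v \<in> L2_space \<Omega>"
  using L2_space_add[OF assms(1) L2_space_scaleR[OF assms(2), of "-1"]] by (simp add: fun_diff_def)

lemma L2_integrable_inner:
  assumes "u \<in> L2_space \<Omega>" "v \<in> L2_space \<Omega>"
  shows "integrable (lebesgue_on \<Omega>) (\<lambda>x. u x \<bullet> v x)"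
proof -
  note [measurable] = assms[THEN L2_space_measurable]
  have "integrable (lebesgue_on \<Omega>) (\<lambda>x. (norm (u x))\<^sup>2 + (norm (v x))\<^sup>2)"
    using assms by (intro Bochner_Integration.integrable_add L2_space_integrable)
  moreover have "\<bar>u x \<bullet> v x\<bar> \<le> (norm (u x))\<^sup>2 + (norm (v x))\<^sup>2" for x
  proof -
    have "\<bar>u x \<bullet> v x\<bar> \<le> norm (u x) * norm (v x)" by (rule Cauchy_Schwarz_ineq2)
    also have "\<dots> \<le> (norm (u x))\<^sup>2 + (norm (v x))\<^sup>2"
      using sum_squares_bound[of "norm (u x)" "norm (v x)"] mult_nonneg_nonneg[OF norm_ge_zero[of "u x"] norm_ge_zero[of "v x"]]
      by linarith
    finally show ?thesis .
  qed
  ultimately show ?thesis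
    by (elim Bochner_Integration.integrable_bound) (auto intro!: AE_I2)
qed

lemma L2_integrable_mult:
  fixes u v :: "'a::euclidean_space \<Rightarrow> real"
  assumes "u \<in> L2_space \<Omega>" "v \<in> L2_space \<Omega>"
  shows "integrable (lebesgue_on \<Omega>) (\<lambda>x. u x * v x)"
  using L2_integrable_inner[OF assms] by simp

text \<open>Expanding the integral of |a u - s b v|^2, which is nonnegative, with free weights
  \<open>a\<close> and \<open>b\<close> gives a quadratic inequality. The weights a = |v|, b = |u|
  settle the case of positive norms; a vanishing norm, possible for a nonzero function, calls for
  other weights.\<close>

lemma L2_Cauchy_Schwarz_inner:
  assumes u: "u \<in> L2_space \<Omega>" and v: "v \<in> L2_space \<Omega>"
  shows "\<bar>\<integral>x. u x \<bullet> v x \<partial>lebesgue_on \<Omega>\<bar> \<le> L2_norm \<Omega> u * L2_norm \<Omega> v"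
proof -
  define B where "B = (\<integral>x. u x \<bullet> v x \<partial>lebesgue_on \<Omega>)"
  have "2 * (a * b * \<bar>B\<bar>) \<le> a\<^sup>2 * (L2_norm \<Omega> u)\<^sup>2 + b\<^sup>2 * (L2_norm \<Omega> v)\<^sup>2" for a b
  proof -
    \<comment> \<open>The sign makes the cross term equal to the absolute value of
      \<open>B\<close>.\<close>
    define s where "s = sgn B"
    have "0 \<le> (\<integral>x. (norm (a *\<^sub>R u x - (s * b) *\<^sub>R v x))\<^sup>2 \<partial>lebesgue_on \<Omega>)"
      by (intro integral_nonneg_AE) auto
    also have "\<dots> = (\<integral>x. a\<^sup>2 * (norm (u x))\<^sup>2 + (s * b)\<^sup>2 * (norm (v x))\<^sup>2 - 2 * a * s * b * (u x \<bullet> v x) \<partial>lebesgue_on \<Omega>)"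
      by (intro Bochner_Integration.integral_cong refl, unfold power2_norm_eq_inner)
         (simp add: inner_diff inner_commute power2_eq_square algebra_simps)
    also have "\<dots> = a\<^sup>2 * (L2_norm \<Omega> u)\<^sup>2 + (s * b)\<^sup>2 * (L2_norm \<Omega> v)\<^sup>2 - 2 * a * s * b * B"
      using L2_space_integrable[OF u] L2_space_integrable[OF v] L2_integrable_inner[OF u v]
      by (simp add: L2_norm_power2 B_def)
    finally have *: "2 * a * b * (s * B) \<le> a\<^sup>2 * (L2_norm \<Omega> u)\<^sup>2 + s\<^sup>2 * (b\<^sup>2 * (L2_norm \<Omega> v)\<^sup>2)"
      by (simp add: power_mult_distrib algebra_simps)
    have "s * B = \<bar>B\<bar>" by (simp add: s_def abs_sgn mult.commute)
    moreover have "s\<^sup>2 \<le> 1" by (simp add: s_def sgn_if)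
    then have "s\<^sup>2 * (b\<^sup>2 * (L2_norm \<Omega> v)\<^sup>2) \<le> b\<^sup>2 * (L2_norm \<Omega> v)\<^sup>2"
      by (intro mult_left_le_one_le) auto
    ultimately show ?thesis using * by (simp add: mult.assoc)
  qed
  note key = this
  let ?U = "L2_norm \<Omega> u" and ?V = "L2_norm \<Omega> v"
  show ?thesis
  proof (cases "?U = 0 \<or> ?V = 0")
    case True
    have "\<bar>B\<bar> \<le> 0"
    proof (rule ccontr)
      assume "\<not> \<bar>B\<bar> \<le> 0"
      then have pos: "\<bar>B\<bar> > 0" by simp
      from True show False
      proof
        \<comment> \<open>The weight \<open>a\<close> now multiplies a vanishing square on the
          right-hand side, so it may be chosen as large as a contradiction requires.\<close>
        assume "?U = 0"
        then have "2 * (?V\<^sup>2 + 1) \<le> ?V\<^sup>2"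
          using key[of "(?V\<^sup>2 + 1) / \<bar>B\<bar>" 1] pos by simp
        then show False using zero_le_power2[of ?V] by simp
      next
        assume "?V = 0"
        then have "2 * (?U\<^sup>2 + 1) \<le> ?U\<^sup>2"
          using key[of 1 "(?U\<^sup>2 + 1) / \<bar>B\<bar>"] pos by simp
        then show False using zero_le_power2[of ?U] by simp
      qed
    qed
    then show ?thesis by (simp add: B_def)
  next
    case False
    then have "?U > 0" "?V > 0" by (auto simp: less_le)
    moreover have "2 * (?V * ?U * \<bar>B\<bar>) \<le> 2 * (?V * ?U * (?U * ?V))"
      using key[of ?V ?U] by (simp add: power2_eq_square algebra_simps)
    ultimately show ?thesis by (simp add: B_def mult_le_cancel_left)
  qed
qed

lemma L2_Cauchy_Schwarz:
  fixes u v :: "'a::euclidean_space \<Rightarrow> real"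
  assumes "u \<in> L2_space \<Omega>" "v \<in> L2_space \<Omega>"
  shows "\<bar>\<integral>x. u x * v x \<partial>lebesgue_on \<Omega>\<bar> \<le> L2_norm \<Omega> u * L2_norm \<Omega> v"
  using L2_Cauchy_Schwarz_inner[OF assms] by simp

lemma L2_norm_triangle:
  assumes u: "u \<in> L2_space \<Omega>" and v: "v \<in> L2_space \<Omega>"
  shows "L2_norm \<Omega> (\<lambda>x. u x + v x) \<le> L2_norm \<Omega> u + L2_norm \<Omega> v"
proof (rule power2_le_imp_le)
  have "(L2_norm \<Omega> (\<lambda>x. u x + v x))\<^sup>2
      = (\<integral>x. (norm (u x))\<^sup>2 + (norm (v x))\<^sup>2 + 2 * (u x \<bullet> v x) \<partial>lebesgue_on \<Omega>)"
    unfolding L2_norm_power2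
    by (intro Bochner_Integration.integral_cong refl, unfold power2_norm_eq_inner) (simp add: inner_add inner_commute)
  also have "\<dots> = (L2_norm \<Omega> u)\<^sup>2 + (L2_norm \<Omega> v)\<^sup>2 + 2 * (\<integral>x. u x \<bullet> v x \<partial>lebesgue_on \<Omega>)"
    using L2_space_integrable[OF u] L2_space_integrable[OF v] L2_integrable_inner[OF u v]
    by (simp add: L2_norm_power2)
  also have "\<dots> \<le> (L2_norm \<Omega> u + L2_norm \<Omega> v)\<^sup>2"
    using L2_Cauchy_Schwarz_inner[OF u v] by (simp add: power2_sum)
  finally show "(L2_norm \<Omega> (\<lambda>x. u x + v x))\<^sup>2 \<le> (L2_norm \<Omega> u + L2_norm \<Omega> v)\<^sup>2" .
qed simp

lemma L2_norm_triangle_diff: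
  assumes "u \<in> L2_space \<Omega>" "v \<in> L2_space \<Omega>"
  shows "L2_norm \<Omega> (u - v) \<le> L2_norm \<Omega> u + L2_norm \<Omega> v"
  using L2_norm_triangle[OF assms(1) L2_space_scaleR[OF assms(2), of "-1"]]
    L2_norm_scaleR[of \<Omega> "-1" v]
  by (simp add: fun_diff_def)

lemma L2_norm_abs_diff_le:
  assumes u: "u \<in> L2_space \<Omega>" and v: "v \<in> L2_space \<Omega>"
  shows "\<bar>L2_norm \<Omega> u - L2_norm \<Omega> v\<bar> \<le> L2_norm \<Omega> (u - v)"
  using L2_norm_triangle[OF L2_space_diff[OF u v] v] L2_norm_triangle[OF L2_space_diff[OF v u] u]
    L2_norm_minus_commute[of \<Omega> u v]
  by (simp add: fun_diff_def)

section \<open>Smooth test functions\<close>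

lemma GDERIV_continuous: "GDERIV f x :> D \<Longrightarrow> isCont f x"
  unfolding gderiv_def by (rule has_derivative_continuous)

section \<open>Closure properties of the smoothness classes\<close>

lemma C_k_SucI:
  "\<forall>x. GDERIV f x :> G x \<Longrightarrow> \<forall>b\<in>Basis. C_k k (\<lambda>x. G x \<bullet> b) \<Longrightarrow> C_k (Suc k) f"
  by auto

text \<open>Inductions over products and compositions need this: their derivatives contain the
  original functions again, which are known one order higher than the induction hypothesis
  asks.\<close>

lemma C_k_Suc_D: "C_k (Suc k) f \<Longrightarrow> C_k k f"
proof (induction k arbitrary: f)
  case 0
  then obtain G where "\<And>x. GDERIV f x :> G x" by auto
  then show ?case by (auto intro!: continuous_at_imp_continuous_on GDERIV_continuous)
next
  case (Suc k)
  obtain G where "\<forall>x. GDERIV f x :> G x" "\<forall>b\<in>Basis. C_k (Suc k) (\<lambda>x. G x \<bullet> b)"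
    using Suc.prems by (auto simp only: C_k.simps(2))
  then show ?case using Suc.IH by (intro C_k_SucI) auto
qed

lemma C_k_const [simp]: "C_k k (\<lambda>x. a)"
proof (induction k arbitrary: a)
  case (Suc k)
  have "\<forall>x::'a. GDERIV (\<lambda>x. a) x :> 0" by (simp add: GDERIV_const)
  then show ?case using Suc by (auto intro!: exI[of _ "\<lambda>_. 0"])
qed auto

lemma C_k_add: "C_k k f \<Longrightarrow> C_k k g \<Longrightarrow> C_k k (\<lambda>x. f x + g x)"
proof (induction k arbitrary: f g)
  case 0
  then show ?case by (auto intro: continuous_on_add)
next
  case (Suc k)
  obtain F where F: "\<forall>x. GDERIV f x :> F x" "\<forall>b\<in>Basis. C_k k (\<lambda>x. F x \<bullet> b)"
    using Suc.prems(1) by (auto simp only: C_k.simps(2))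
  obtain G where G: "\<forall>x. GDERIV g x :> G x" "\<forall>b\<in>Basis. C_k k (\<lambda>x. G x \<bullet> b)"
    using Suc.prems(2) by (auto simp only: C_k.simps(2))
  have "\<forall>x. GDERIV (\<lambda>x. f x + g x) x :> F x + G x" using F G by (blast intro: GDERIV_add)
  moreover have "\<forall>b\<in>Basis. C_k k (\<lambda>x. (F x + G x) \<bullet> b)"
    using Suc.IH F(2) G(2) by (simp add: inner_add_left)
  ultimately show ?case by (rule C_k_SucI)
qed

lemma C_k_mult: "C_k k f \<Longrightarrow> C_k k g \<Longrightarrow> C_k k (\<lambda>x. f x * g x)"
proof (induction k arbitrary: f g)
  case 0
  then show ?case by (auto intro: continuous_on_mult)
next
  case (Suc k)
  obtain F where F: "\<forall>x. GDERIV f x :> F x" "\<forall>b\<in>Basis. C_k k (\<lambda>x. F x \<bullet> b)"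
    using Suc.prems(1) by (auto simp only: C_k.simps(2))
  obtain G where G: "\<forall>x. GDERIV g x :> G x" "\<forall>b\<in>Basis. C_k k (\<lambda>x. G x \<bullet> b)"
    using Suc.prems(2) by (auto simp only: C_k.simps(2))
  have "\<forall>x. GDERIV (\<lambda>x. f x * g x) x :> f x *\<^sub>R G x + g x *\<^sub>R F x"
    using F G by (blast intro: GDERIV_mult)
  moreover have "\<forall>b\<in>Basis. C_k k (\<lambda>x. (f x *\<^sub>R G x + g x *\<^sub>R F x) \<bullet> b)"
    using Suc.IH F(2) G(2) Suc.prems[THEN C_k_Suc_D] by (simp add: inner_add_left C_k_add)
  ultimately show ?case by (rule C_k_SucI)
qed

lemma C_k_diff: "C_k k f \<Longrightarrow> C_k k g \<Longrightarrow> C_k k (\<lambda>x. f x - g x)"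
  using C_k_add[of k f "\<lambda>x. -1 * g x"] C_k_mult[of k "\<lambda>x. -1" g] by simp

lemma C_k_sum: "(\<And>i. i \<in> I \<Longrightarrow> C_k k (f i)) \<Longrightarrow> C_k k (\<lambda>x. \<Sum>i\<in>I. f i x)"
  by (induction I rule: infinite_finite_induct) (auto intro: C_k_add)

lemma C_k_prod: "(\<And>i. i \<in> I \<Longrightarrow> C_k k (f i)) \<Longrightarrow> C_k k (\<lambda>x. \<Prod>i\<in>I. f i x)"
  by (induction I rule: infinite_finite_induct) (auto intro: C_k_mult)

lemma C_k_exp: "C_k k f \<Longrightarrow> C_k k (\<lambda>x. exp (f x))"
proof (induction k arbitrary: f)
  case 0
  then show ?case by (auto intro: continuous_on_exp)
next
  case (Suc k)
  obtain F where F: "\<forall>x. GDERIV f x :> F x" "\<forall>b\<in>Basis. C_k k (\<lambda>x. F x \<bullet> b)"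
    using Suc.prems by (auto simp only: C_k.simps(2))
  have "\<forall>x. GDERIV (\<lambda>x. exp (f x)) x :> exp (f x) *\<^sub>R F x"
    using F by (blast intro: GDERIV_DERIV_compose DERIV_exp)
  moreover have "\<forall>b\<in>Basis. C_k k (\<lambda>x. (exp (f x) *\<^sub>R F x) \<bullet> b)"
    using Suc.IH[OF C_k_Suc_D[OF Suc.prems]] F(2) by (simp add: C_k_mult)
  ultimately show ?case by (rule C_k_SucI)
qed

text \<open>The functions \<open>P (1/x) e\<^sup>-\<^sup>1\<^sup>/\<^sup>x\<close> on \<open>x > 0\<close>, extended by \<open>0\<close>, are closed under differentiation.\<close>

definition flat :: "real poly \<Rightarrow> real \<Rightarrow> real" where
  "flat P x = (if x \<le> 0 then 0 else poly P (1 / x) * exp (- (1 / x)))"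

lemma poly_exp_tendsto_0: "((\<lambda>z::real. poly P z * exp (- z)) \<longlongrightarrow> 0) at_top"
proof -
  have "((\<lambda>z. \<Sum>i\<le>degree P. coeff P i * (z ^ i / exp z)) \<longlongrightarrow> (\<Sum>i\<le>degree P. coeff P i * 0)) at_top"
    by (intro tendsto_sum tendsto_mult tendsto_const tendsto_power_div_exp_0)
  moreover have "poly P z * exp (- z) = (\<Sum>i\<le>degree P. coeff P i * (z ^ i / exp z))" for z :: real
    by (simp add: poly_altdef exp_minus sum_distrib_right divide_inverse mult.assoc)
  ultimately show ?thesis by simp
qed

text \<open>With z = 1/x the chain rule reads d/dx = - z^2 d/dz, and the z-derivative of P(z)
  exp(-z) is (P' - P)(z) exp(-z). This is where the polynomial z^2 (P - P') comes from.\<close>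

lemma flat_has_real_derivative:
  "(flat P has_real_derivative flat ([:0, 0, 1:] * (P - pderiv P)) x) (at x)"
proof -
  consider "x < 0" | "x > 0" | "x = 0" by linarith
  then show ?thesis
  proof cases
    case 1
    have "((\<lambda>_. 0) has_real_derivative 0) (at x)" by simp
    moreover have "\<forall>\<^sub>F y in nhds x. 0 = flat P y"
      using 1 eventually_nhds_in_open[of "{..<0}" x] by (auto elim!: eventually_mono simp: flat_def)
    ultimately have "(flat P has_real_derivative 0) (at x)"
      by (simp add: DERIV_cong_ev)
    then show ?thesis using 1 by (simp add: flat_def[of _ x])
  next
    case 2
    have "((\<lambda>y. poly P (1 / y) * exp (- (1 / y))) has_real_derivative
       flat ([:0, 0, 1:] * (P - pderiv P)) x) (at x)"
      using 2 by (auto intro!: derivative_eq_intros DERIV_chain'[OF _ poly_DERIV] simp: flat_def power2_eq_square field_simps)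
    moreover have "\<forall>\<^sub>F y in nhds x. poly P (1 / y) * exp (- (1 / y)) = flat P y"
      using 2 eventually_nhds_in_open[of "{0<..}" x] by (auto elim!: eventually_mono simp: flat_def)
    ultimately show ?thesis
      by (simp add: DERIV_cong_ev)
  next
    \<comment> \<open>The right difference quotient at 0 is z P(z) exp(-z) with z = 1/h, and
      \<open>pCons 0 P\<close> is the polynomial z P(z). The left one is 0.\<close>
    case 3
    have "((\<lambda>h. flat P h / h) \<longlongrightarrow> 0) (at_left 0)"
      by (rule tendsto_eventually) (auto simp: flat_def eventually_at_filter)
    moreover have "((\<lambda>h. flat P h / h) \<longlongrightarrow> 0) (at_right 0)"
    proof -
      have "((\<lambda>h. poly (pCons 0 P) (inverse h) * exp (- inverse h)) \<longlongrightarrow> 0) (at_right (0::real))"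
        by (rule filterlim_compose[OF poly_exp_tendsto_0 filterlim_inverse_at_top_right])
      moreover have "\<forall>\<^sub>F h in at_right 0. poly (pCons 0 P) (inverse h) * exp (- inverse h) = flat P h / h"
        by (auto simp: flat_def eventually_at_filter divide_inverse mult_ac)
      ultimately show ?thesis by (rule Lim_transform_eventually)
    qed
    ultimately have "((\<lambda>h. flat P h / h) \<longlongrightarrow> 0) (at 0)"
      by (rule filterlim_split_at_real)
    then show ?thesis using 3 by (simp add: DERIV_def flat_def)
  qed
qed

text \<open>Generality in \<open>P\<close> lets the induction close: the gradient is again a
  \<open>flat\<close> function of the same affine form, times the constant vector
  \<open>v\<close>.\<close>

lemma C_k_flat_affine: "C_k k (\<lambda>x::'a::euclidean_space. flat P (x \<bullet> v + a))"
proof (induction k arbitrary: P)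
  case 0
  have "continuous_on UNIV (flat P)"
    using flat_has_real_derivative by (intro continuous_at_imp_continuous_on ballI DERIV_isCont)
  then show ?case
    by (auto intro!: continuous_on_compose2[of UNIV "flat P"] continuous_intros)
next
  case (Suc k)
  let ?Q = "[:0, 0, 1:] * (P - pderiv P)"
  have "GDERIV (\<lambda>x. x \<bullet> v + a) x :> v" for x :: 'a
    unfolding gderiv_def by (auto intro!: derivative_eq_intros)
  then have "\<forall>x::'a. GDERIV (\<lambda>x. flat P (x \<bullet> v + a)) x :> flat ?Q (x \<bullet> v + a) *\<^sub>R v"
    using GDERIV_DERIV_compose[OF _ flat_has_real_derivative] by blast
  moreover have "\<forall>b\<in>Basis. C_k k (\<lambda>x::'a. (flat ?Q (x \<bullet> v + a) *\<^sub>R v) \<bullet> b)"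
    using Suc by (simp add: C_k_mult del: mult_pCons_left)
  ultimately show ?case by (rule C_k_SucI)
qed

text \<open>The two factors per coordinate detect the lower and the upper face of the box. Both are
  written as \<open>flat 1\<close> of an affine function, with direction \<open>- i\<close> for the
  upper face, so that one smoothness lemma covers them.\<close>

definition bump :: "'a::euclidean_space \<Rightarrow> 'a \<Rightarrow> 'a \<Rightarrow> real" where
  "bump a b x = (\<Prod>i\<in>Basis. flat 1 (x \<bullet> i + - (a \<bullet> i)) * flat 1 (x \<bullet> - i + b \<bullet> i))"

lemma C_k_bump: "C_k k (bump a b)"
  unfolding bump_def by (intro C_k_prod C_k_mult C_k_flat_affine)

lemma bump_nonneg: "0 \<le> bump a b x"
  by (auto simp: bump_def flat_def intro!: prod_nonneg)

lemma bump_pos_iff: "0 < bump a b x \<longleftrightarrow> x \<in> box a b"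
proof
  assume "x \<in> box a b"
  then show "0 < bump a b x"
    by (auto simp: bump_def flat_def mem_box intro!: prod_pos)
next
  assume "0 < bump a b x"
  then have "flat 1 (x \<bullet> i + - (a \<bullet> i)) * flat 1 (x \<bullet> - i + b \<bullet> i) \<noteq> 0" if "i \<in> Basis" for i
    using that by (auto simp: bump_def prod_zero_iff less_le)
  then show "x \<in> box a b"
    unfolding mem_box by (fastforce simp: flat_def split: if_splits)
qed

lemma continuous_on_bump: "continuous_on S (bump a b)"
  using C_k_bump[of 0] by (auto intro: continuous_on_subset)

text \<open>
  Every open subset of \<open>\<Omega>\<close> is a countable union of boxes, so the functions
  \<open>1 - exp (- n \<Sum>\<^sub>i\<^sub>\<le>\<^sub>n bump\<^sub>i)\<close> over the first \<open>n\<close> boxes increase to its indicator.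
\<close>

lemma test_functions_approx_indicator:
  fixes U :: "'a::euclidean_space set"
  assumes "open U" "U \<subseteq> \<Omega>"
  obtains \<phi> :: "nat \<Rightarrow> 'a \<Rightarrow> real" where "\<And>n. \<phi> n \<in> test_functions \<Omega>"
    "\<And>n x. 0 \<le> \<phi> n x" "\<And>n x. \<phi> n x \<le> 1" "\<And>x. (\<lambda>n. \<phi> n x) \<longlonglongrightarrow> indicator U x"
proof -
  \<comment> \<open>Asking for the closed box inside \<open>U\<close> puts the supports of the bumps
    inside \<open>U\<close>.\<close>
  define F where "F = {box a b | a b. cbox a b \<subseteq> U}"
  have "\<Union>F = U"
  proof (rule subset_antisym)
    show "\<Union>F \<subseteq> U" using box_subset_cbox by (force simp: F_def)
    show "U \<subseteq> \<Union>F"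
    proof
      fix x assume "x \<in> U"
      then obtain e where e: "e > 0" "cball x e \<subseteq> U" using \<open>open U\<close> open_contains_cball by blast
      obtain a b where ab: "x \<in> box a b" "box a b \<subseteq> ball x e" using rational_boxes[OF e(1), of x] by blast
      then have "cbox a b \<subseteq> cball x e"
        using closure_mono[OF ab(2)] e(1) by (metis closure_box closure_ball empty_iff)
      then show "x \<in> \<Union>F" using ab(1) e(2) by (fastforce simp: F_def)
    qed
  qed
  moreover obtain F' where F': "F' \<subseteq> F" "countable F'" "\<Union>F' = \<Union>F"
    using Lindelof[of F] by (auto simp: F_def)
  ultimately have U: "\<Union>F' = U" by simp
  show thesis
  proof (cases "F' = {}")
    case True
    then show thesis
      using U by (intro that[of "\<lambda>_ _. 0"]) (auto simp: test_functions_def)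
  next
    case False
    have "\<forall>X\<in>F'. \<exists>a b. X = box a b \<and> cbox a b \<subseteq> U" using F'(1) by (auto simp: F_def)
    then have "\<forall>i. \<exists>a b. from_nat_into F' i = box a b \<and> cbox a b \<subseteq> U"
      using from_nat_into[OF False] by blast
    then obtain a b where ab: "\<And>i. from_nat_into F' i = box (a i) (b i)" "\<And>i. cbox (a i) (b i) \<subseteq> U"
      by metis
    have Un: "x \<in> U \<longleftrightarrow> (\<exists>i. x \<in> box (a i) (b i))" for x
      using range_from_nat_into[OF False F'(2)] U ab(1) by (metis UN_iff UNIV_I)
    define s where "s n x = (\<Sum>i<n. bump (a i) (b i) x)" for n x
    \<comment> \<open>Only finitely many boxes enter \<open>\<phi> n\<close>, which keeps its
      support compact. The factor \<open>n\<close> in the exponent pushes the value to 1 wherever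
      some bump is positive.\<close>
    define \<phi> where "\<phi> n x = 1 - exp (- real n * s n x)" for n x
    have s_nonneg: "0 \<le> s n x" for n x by (auto simp: s_def intro: sum_nonneg bump_nonneg)
    have supp: "closure {x. \<phi> n x \<noteq> 0} \<subseteq> (\<Union>i<n. cbox (a i) (b i))" for n
    proof (rule closure_minimal)
      show "{x. \<phi> n x \<noteq> 0} \<subseteq> (\<Union>i<n. cbox (a i) (b i))"
      proof
        fix x assume "x \<in> {x. \<phi> n x \<noteq> 0}"
        then have "s n x \<noteq> 0" by (auto simp: \<phi>_def)
        then obtain i where "i < n" "bump (a i) (b i) x \<noteq> 0" unfolding s_def by (meson lessThan_iff sum.neutral)
        then show "x \<in> (\<Union>i<n. cbox (a i) (b i))"
          using bump_pos_iff[of "a i" "b i" x] bump_nonneg[of "a i" "b i" x] box_subset_cbox by (force simp: less_le)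
      qed
    qed auto
    show thesis
    proof (rule that[of \<phi>])
      fix n
      have "compact (\<Union>i<n. cbox (a i) (b i))" by auto
      then have "compact (closure {x. \<phi> n x \<noteq> 0})"
        using supp[of n] closed_Int_compact[OF closed_closure] by (metis inf.absorb1)
      moreover have "C_k k (\<phi> n)" for k
        unfolding \<phi>_def s_def by (intro C_k_diff C_k_const C_k_exp C_k_mult C_k_sum C_k_bump)
      ultimately show "\<phi> n \<in> test_functions \<Omega>"
        using supp[of n] ab(2) \<open>U \<subseteq> \<Omega>\<close> unfolding test_functions_def by blast
      show "0 \<le> \<phi> n x" for x using s_nonneg[of n x] by (simp add: \<phi>_def)
      show "\<phi> n x \<le> 1" for x by (simp add: \<phi>_def)
    next
      fix x
      show "(\<lambda>n. \<phi> n x) \<longlonglongrightarrow> indicator U x"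
      proof (cases "x \<in> U")
        case False
        then have "s n x = 0" for n
          using bump_pos_iff[of "a _" "b _" x] bump_nonneg[of "a _" "b _" x] unfolding s_def Un
          by (intro sum.neutral) (metis less_le)
        then show ?thesis using False by (simp add: \<phi>_def)
      next
        case True
        then obtain i where "x \<in> box (a i) (b i)" using Un by blast
        then have pos: "0 < bump (a i) (b i) x" by (simp add: bump_pos_iff)
        define \<beta> where "\<beta> = bump (a i) (b i) x"
        have "s n x \<ge> \<beta>" if "n > i" for n
          unfolding s_def \<beta>_def using that bump_nonneg by (intro member_le_sum) auto
        then have le: "\<forall>\<^sub>F n in sequentially. exp (- real n * s n x) \<le> exp (- real n * \<beta>)"
          by (intro eventually_sequentiallyI[of "Suc i"]) (auto intro!: mult_left_mono)
        have "(\<lambda>n. exp (- real n * \<beta>)) \<longlonglongrightarrow> 0"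
          using pos unfolding \<beta>_def[symmetric] by real_asymp
        then have "(\<lambda>n. exp (- real n * s n x)) \<longlonglongrightarrow> 0"
          by (rule tendsto_sandwich[OF _ le tendsto_const, rotated]) auto
        then have "(\<lambda>n. 1 - exp (- real n * s n x)) \<longlonglongrightarrow> 1 - 0" by (intro tendsto_intros)
        then show ?thesis using True by (simp add: \<phi>_def)
      qed
    qed
  qed
qed

section \<open>Weak gradients and the norms of \<open>H\<^sup>1\<close> and its dual\<close>

lemma test_function_GDERIV:
  assumes "\<phi> \<in> test_functions \<Omega>"
  obtains \<phi>' where "\<And>x. GDERIV \<phi> x :> \<phi>' x"
proof -
  have "C_k (Suc 0) \<phi>" using assms by (simp only: test_functions_def mem_Collect_eq)
  then show ?thesis using that by auto
qed

lemma GDERIV_unique: "GDERIV f x :> a \<Longrightarrow> GDERIV f x :> b \<Longrightarrow> a = b"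
proof -
  assume "GDERIV f x :> a" "GDERIV f x :> b"
  then have "(\<lambda>h. h \<bullet> a) = (\<lambda>h. h \<bullet> b)" unfolding gderiv_def by (rule has_derivative_unique)
  then show "a = b" by (metis inner_commute vector_eq_ldot)
qed

lemma bounded_of_compact_support:
  fixes h :: "'a::euclidean_space \<Rightarrow> 'b::real_normed_vector"
  assumes "continuous_on UNIV h" "compact K" "\<And>x. x \<notin> K \<Longrightarrow> h x = 0"
  obtains B where "0 \<le> B" "\<And>x. norm (h x) \<le> B"
proof -
  have "bounded (h ` K)"
    using assms by (intro compact_imp_bounded compact_continuous_image) (auto intro: continuous_on_subset)
  then obtain B where "\<And>x. x \<in> K \<Longrightarrow> norm (h x) \<le> B" unfolding bounded_iff by auto
  \<comment> \<open>The bound \<open>B\<close> may be negative when \<open>K\<close> is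
    empty.\<close>
  then have "norm (h x) \<le> max B 0" for x
    by (cases "x \<in> K") (auto simp: assms(3) intro: order_trans[OF _ max.cobounded1])
  then show thesis using that[of "max B 0"] by auto
qed

lemma test_function_continuous_bounded:
  assumes "\<phi> \<in> test_functions \<Omega>"
  obtains B where "0 \<le> B" "continuous_on UNIV \<phi>" "\<And>x. \<bar>\<phi> x\<bar> \<le> B"
proof -
  have 1: "continuous_on UNIV \<phi>"
    using assms unfolding test_functions_def by (simp only: mem_Collect_eq) (metis C_k.simps(1))
  have 2: "compact (closure {x. \<phi> x \<noteq> 0})" using assms by (simp add: test_functions_def)
  have 3: "\<phi> x = 0" if "x \<notin> closure {x. \<phi> x \<noteq> 0}" for x
    using that closure_subset[of "{x. \<phi> x \<noteq> 0}"] by auto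
  show thesis
    by (rule bounded_of_compact_support[OF 1 2 3]) (use 1 that in auto)
qed

lemma test_function_gradient_continuous_bounded:
  assumes \<phi>: "\<phi> \<in> test_functions \<Omega>" and D: "\<And>x. GDERIV \<phi> x :> \<phi>' x"
  obtains B where "0 \<le> B" "continuous_on UNIV \<phi>'" "\<And>x. norm (\<phi>' x) \<le> B"
proof -
  have "C_k (Suc 0) \<phi>" using \<phi> by (simp only: test_functions_def mem_Collect_eq)
  then obtain G where G: "\<forall>x. GDERIV \<phi> x :> G x" "\<forall>b\<in>Basis. C_k 0 (\<lambda>x. G x \<bullet> b)"
    by (auto simp only: C_k.simps(2))
  have "\<phi>' = G" using GDERIV_unique D G(1) by blast
  then have 1: "continuous_on UNIV \<phi>'"
    using G(2) by (subst continuous_on_componentwise) simp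
  have 2: "compact (closure {x. \<phi> x \<noteq> 0})" using \<phi> by (simp add: test_functions_def)
  have 3: "\<phi>' x = 0" if x: "x \<notin> closure {x. \<phi> x \<noteq> 0}" for x
  proof -
    \<comment> \<open>The complement of the support is open, so \<phi> vanishes near x and 0 is a
      gradient there.\<close>
    have "\<forall>\<^sub>F y in nhds x. y \<in> - closure {x. \<phi> x \<noteq> 0}"
      using x by (intro eventually_nhds_in_open) auto
    then have "\<forall>\<^sub>F y in nhds x. \<phi> y = 0"
      by eventually_elim (use closure_subset[of "{x. \<phi> x \<noteq> 0}"] in auto)
    then have "\<forall>\<^sub>F y in at x. 0 = \<phi> y" "0 = \<phi> x"
      by (auto simp: eventually_at_filter elim: eventually_mono dest: eventually_nhds_x_imp_x)
    then have "GDERIV \<phi> x :> 0"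
      using GDERIV_const[of 0 x] unfolding gderiv_def by (blast intro: has_derivative_transform_eventually)
    then show ?thesis using GDERIV_unique D by blast
  qed
  show thesis by (rule bounded_of_compact_support[OF 1 2 3]) (use 1 that in auto)
qed

text \<open>The Borel sets over which the integral of \<open>g\<close> vanishes form a Dynkin
  system, and the open sets are an intersection-stable generator. The case \<open>U = UNIV\<close>
  of the assumption provides the step to complements.\<close>

lemma set_integral_borel_eq_0_of_open:
  fixes g :: "'a::euclidean_space \<Rightarrow> 'b::euclidean_space"
  assumes int: "integrable (lebesgue_on \<Omega>) g"
    and open0: "\<And>U. open U \<Longrightarrow> set_lebesgue_integral (lebesgue_on \<Omega>) (U \<inter> \<Omega>) g = 0"
    and "\<Omega> \<in> sets lebesgue" "A \<in> sets borel"
  shows "set_lebesgue_integral (lebesgue_on \<Omega>) (A \<inter> \<Omega>) g = 0"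
proof -
  have sets: "A \<inter> \<Omega> \<in> sets (lebesgue_on \<Omega>)" if "A \<in> sets borel" for A
    using that assms(3) by (auto simp: sets_restrict_space)
  have si: "set_integrable (lebesgue_on \<Omega>) B g" if "B \<in> sets (lebesgue_on \<Omega>)" for B
    using that int unfolding set_integrable_def by (rule integrable_mult_indicator)
  have "Int_stable {S::'a set. open S}" by (auto simp: Int_stable_def)
  moreover have "{S::'a set. open S} \<subseteq> Pow UNIV" by simp
  moreover have "A \<in> sigma_sets UNIV {S. open S}" using assms(4) by (simp add: borel_def)
  ultimately show ?thesis
  proof (induction rule: sigma_sets_induct_disjoint)
    case (basic A)
    then show ?case by (simp add: open0)
  next
    case empty
    then show ?case by (simp add: set_lebesgue_integral_def)
  next
    case (compl A)
    then have "A \<in> sets borel" by (simp add: borel_def)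
    have "set_lebesgue_integral (lebesgue_on \<Omega>) ((UNIV - A) \<inter> \<Omega> \<union> A \<inter> \<Omega>) g
        = set_lebesgue_integral (lebesgue_on \<Omega>) ((UNIV - A) \<inter> \<Omega>) g
          + set_lebesgue_integral (lebesgue_on \<Omega>) (A \<inter> \<Omega>) g"
      using \<open>A \<in> sets borel\<close> by (intro set_integral_Un si sets) auto
    moreover have "(UNIV - A) \<inter> \<Omega> \<union> A \<inter> \<Omega> = UNIV \<inter> \<Omega>" by blast
    ultimately show ?case using compl open0[of UNIV] by simp
  next
    case (union A)
    then have b: "A i \<in> sets borel" for i by (auto simp: borel_def)
    have "set_lebesgue_integral (lebesgue_on \<Omega>) (\<Union>i. A i \<inter> \<Omega>) g
        = (\<Sum>i. set_lebesgue_integral (lebesgue_on \<Omega>) (A i \<inter> \<Omega>) g)"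
      using b union(1) by (intro lebesgue_integral_countable_add si sets sets.countable_UN)
        (auto simp: disjoint_family_on_def intro: sets)
    also have "(\<Union>i. A i \<inter> \<Omega>) = \<Union> (range A) \<inter> \<Omega>" by blast
    finally show ?case using union by simp
  qed
qed

lemma AE_eq_0_of_test_functions:
  fixes g :: "'a::euclidean_space \<Rightarrow> 'b::euclidean_space"
  assumes "open \<Omega>" "\<Omega> \<in> lmeasurable" and int: "integrable (lebesgue_on \<Omega>) g"
    and test: "\<And>\<phi>. \<phi> \<in> test_functions \<Omega> \<Longrightarrow> (\<integral>x. \<phi> x *\<^sub>R g x \<partial>lebesgue_on \<Omega>) = 0"
  shows "AE x in lebesgue_on \<Omega>. g x = 0"
proof -
  have \<Omega>: "\<Omega> \<in> sets lebesgue" using \<open>open \<Omega>\<close> by auto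
  note [measurable] = borel_measurable_integrable[OF int]
  have open0: "set_lebesgue_integral (lebesgue_on \<Omega>) (U \<inter> \<Omega>) g = 0" if "open U" for U
  proof -
    obtain \<phi> :: "nat \<Rightarrow> 'a \<Rightarrow> real" where \<phi>: "\<And>n. \<phi> n \<in> test_functions \<Omega>"
      "\<And>n x. 0 \<le> \<phi> n x" "\<And>n x. \<phi> n x \<le> 1" "\<And>x. (\<lambda>n. \<phi> n x) \<longlonglongrightarrow> indicator (U \<inter> \<Omega>) x"
      by (rule test_functions_approx_indicator[of "U \<inter> \<Omega>" \<Omega>]) (use \<open>open \<Omega>\<close> \<open>open U\<close> in auto)
    have [measurable]: "\<phi> n \<in> borel_measurable (lebesgue_on \<Omega>)" for n
    proof -
      have "continuous_on \<Omega> (\<phi> n)"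
        using test_function_continuous_bounded[OF \<phi>(1)[of n]] continuous_on_subset by blast
      then show ?thesis using \<Omega> by (rule continuous_imp_measurable_on_sets_lebesgue)
    qed
    have [measurable]: "U \<inter> \<Omega> \<in> sets (lebesgue_on \<Omega>)"
      using that \<Omega> by (auto simp: sets_restrict_space)
    have "(\<lambda>n. \<integral>x. \<phi> n x *\<^sub>R g x \<partial>lebesgue_on \<Omega>) \<longlonglongrightarrow> (\<integral>x. indicator (U \<inter> \<Omega>) x *\<^sub>R g x \<partial>lebesgue_on \<Omega>)"
    proof (rule integral_dominated_convergence[where w = "\<lambda>x. norm (g x)"])
      show "AE x in lebesgue_on \<Omega>. norm (\<phi> n x *\<^sub>R g x) \<le> norm (g x)" for n
        using \<phi>(2,3) by (auto intro!: AE_I2 mult_left_le_one_le)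
      show "AE x in lebesgue_on \<Omega>. (\<lambda>n. \<phi> n x *\<^sub>R g x) \<longlonglongrightarrow> indicator (U \<inter> \<Omega>) x *\<^sub>R g x"
        using \<phi>(4) by (auto intro!: AE_I2 tendsto_scaleR tendsto_const)
    qed (use int in auto)
    then show ?thesis
      using test[OF \<phi>(1)] by (simp add: set_lebesgue_integral_def LIMSEQ_const_iff)
  qed
  show ?thesis
  proof (rule sigma_finite_measure.density_zero[OF _ int])
    show "sigma_finite_measure (lebesgue_on \<Omega>)"
      using finite_measure_lebesgue_on[OF assms(2)] by (rule finite_measure.axioms(1))
  next
    fix A assume A: "A \<in> sets (lebesgue_on \<Omega>)"
    then have "A \<in> sets lebesgue" "A \<subseteq> \<Omega>" using \<Omega> by (auto simp: sets_restrict_space_iff)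
    \<comment> \<open>Measurability on \<Omega> is meant in the Lebesgue sense. Each such set is an
      F-sigma set up to a null set, which brings back the Borel case.\<close>
    obtain C T where CT: "fsigma C" "T \<in> null_sets lebesgue" "C \<union> T = A" "disjnt C T"
      by (rule lebesgue_set_almost_fsigma[OF \<open>A \<in> sets lebesgue\<close>]) (use that in blast)
    have C: "C \<in> sets borel" using CT(1) by cases (auto intro!: sets.countable_UN')
    have "T \<subseteq> \<Omega>" using CT(3) \<open>A \<subseteq> \<Omega>\<close> by blast
    then have "T \<in> null_sets (lebesgue_on \<Omega>)"
      using CT(2) \<Omega> by (subst null_sets_restrict_space) simp_all
    then have "AE x in lebesgue_on \<Omega>. x \<notin> T" by (rule AE_not_in)
    moreover have "C \<inter> \<Omega> \<in> sets (lebesgue_on \<Omega>)" using C \<Omega> by (auto simp: sets_restrict_space)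
    ultimately have "set_lebesgue_integral (lebesgue_on \<Omega>) A g = set_lebesgue_integral (lebesgue_on \<Omega>) (C \<inter> \<Omega>) g"
      unfolding set_lebesgue_integral_def using A
    proof (intro integral_cong_AE)
      assume "AE x in lebesgue_on \<Omega>. x \<notin> T"
      then show "AE x in lebesgue_on \<Omega>. indicat_real A x *\<^sub>R g x = indicat_real (C \<inter> \<Omega>) x *\<^sub>R g x"
        by (rule eventually_mono) (use CT(3) \<open>A \<subseteq> \<Omega>\<close> in \<open>auto simp: indicator_def\<close>)
    qed auto
    then show "set_lebesgue_integral (lebesgue_on \<Omega>) A g = 0"
      using set_integral_borel_eq_0_of_open[OF int open0 \<Omega> C] by simp
  qed
qed

text \<open>A bounded open set has finite measure, so square-integrable functions are integrable and
  the pairings with test functions in \<open>has_weak_gradient\<close> are genuine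
  integrals.\<close>

locale bounded_open =
  fixes \<Omega> :: "'a::euclidean_space set"
  assumes open_dom: "open \<Omega>" and bounded_dom: "bounded \<Omega>"
begin

lemma lmeasurable_dom: "\<Omega> \<in> lmeasurable"
  using bounded_dom open_dom by (rule lmeasurable_open)

sublocale finite_measure "lebesgue_on \<Omega>"
  using lmeasurable_dom by (rule finite_measure_lebesgue_on)

lemma continuous_measurable_dom:
  "continuous_on UNIV h \<Longrightarrow> h \<in> borel_measurable (lebesgue_on \<Omega>)"
  for h :: "'a \<Rightarrow> 'b::euclidean_space"
  using lmeasurable_dom
  by (intro continuous_imp_measurable_on_sets_lebesgue) (auto intro: continuous_on_subset)

lemma L2_space_integrable_norm:
  fixes v :: "'a \<Rightarrow> 'b::euclidean_space"
  assumes "v \<in> L2_space \<Omega>"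
  shows "integrable (lebesgue_on \<Omega>) v"
proof (rule Bochner_Integration.integrable_bound)
  show "integrable (lebesgue_on \<Omega>) (\<lambda>x. 1 + (norm (v x))\<^sup>2)"
    using L2_space_integrable[OF assms] by (intro Bochner_Integration.integrable_add) simp_all
  have "norm (v x) \<le> 1 + (norm (v x))\<^sup>2" for x
    using sum_squares_bound[of 1 "norm (v x)"] zero_le_power2[of "norm (v x)"] norm_ge_zero[of "v x"]
    by (simp del: norm_ge_zero)
  then show "AE x in lebesgue_on \<Omega>. norm (v x) \<le> norm (1 + (norm (v x))\<^sup>2)"
    by (auto intro!: AE_I2)
qed (use assms L2_space_measurable in auto)

lemma integrable_scaleR_bounded:
  fixes h :: "'a \<Rightarrow> 'b::euclidean_space"
  assumes "integrable (lebesgue_on \<Omega>) h" "\<phi> \<in> borel_measurable (lebesgue_on \<Omega>)" "\<And>x. \<bar>\<phi> x\<bar> \<le> B"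
  shows "integrable (lebesgue_on \<Omega>) (\<lambda>x. \<phi> x *\<^sub>R h x)"
proof (rule Bochner_Integration.integrable_bound)
  note [measurable] = assms(2) borel_measurable_integrable[OF assms(1)]
  show "(\<lambda>x. \<phi> x *\<^sub>R h x) \<in> borel_measurable (lebesgue_on \<Omega>)" by measurable
  show "integrable (lebesgue_on \<Omega>) (\<lambda>x. B * norm (h x))" using assms(1) by auto
  have "\<bar>\<phi> x\<bar> * norm (h x) \<le> \<bar>B\<bar> * norm (h x)" for x
    using assms(3)[of x] by (intro mult_right_mono) auto
  then show "AE x in lebesgue_on \<Omega>. norm (\<phi> x *\<^sub>R h x) \<le> norm (B * norm (h x))"
    by (auto intro!: AE_I2 simp: abs_mult)
qed

lemma integrable_test_scaleR:
  fixes g :: "'a \<Rightarrow> 'b::euclidean_space"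
  assumes "\<phi> \<in> test_functions \<Omega>" "g \<in> L2_space \<Omega>"
  shows "integrable (lebesgue_on \<Omega>) (\<lambda>x. \<phi> x *\<^sub>R g x)"
proof -
  obtain B where "continuous_on UNIV \<phi>" "\<And>x. \<bar>\<phi> x\<bar> \<le> B"
    by (rule test_function_continuous_bounded[OF assms(1)]) (use that in blast)
  then show ?thesis
    using assms(2) by (intro integrable_scaleR_bounded[where B = B] L2_space_integrable_norm continuous_measurable_dom)
qed

lemma integrable_scaleR_test_gradient:
  assumes "\<phi> \<in> test_functions \<Omega>" "\<And>x. GDERIV \<phi> x :> \<phi>' x" "v \<in> L2_space \<Omega>"
  shows "integrable (lebesgue_on \<Omega>) (\<lambda>x. v x *\<^sub>R \<phi>' x)"
proof -
  obtain B where B: "0 \<le> B" "continuous_on UNIV \<phi>'" "\<And>x. norm (\<phi>' x) \<le> B"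
    by (rule test_function_gradient_continuous_bounded[OF assms(1,2)]) (use that in blast)
  note [measurable] = continuous_measurable_dom[OF B(2)] L2_space_measurable[OF assms(3)]
  have "integrable (lebesgue_on \<Omega>) (\<lambda>x. \<bar>v x\<bar> * B)"
    using L2_space_integrable_norm[OF assms(3)] by auto
  moreover have "AE x in lebesgue_on \<Omega>. norm (v x *\<^sub>R \<phi>' x) \<le> norm (\<bar>v x\<bar> * B)"
    using B by (auto intro!: AE_I2 mult_left_mono simp: abs_mult)
  moreover have "(\<lambda>x. v x *\<^sub>R \<phi>' x) \<in> borel_measurable (lebesgue_on \<Omega>)" by measurable
  ultimately show ?thesis by (blast intro: Bochner_Integration.integrable_bound)
qed

section \<open>Uniqueness and linearity of weak gradients\<close>

lemma has_weak_gradient_unique: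
  assumes g: "has_weak_gradient \<Omega> v g" and h: "has_weak_gradient \<Omega> v h"
  shows "AE x in lebesgue_on \<Omega>. g x = h x"
proof -
  have L2: "g \<in> L2_space \<Omega>" "h \<in> L2_space \<Omega>" using g h by (auto simp: has_weak_gradient_def)
  have "AE x in lebesgue_on \<Omega>. g x - h x = 0"
  proof (rule AE_eq_0_of_test_functions[OF open_dom lmeasurable_dom])
    show "integrable (lebesgue_on \<Omega>) (\<lambda>x. g x - h x)"
      using L2 L2_space_integrable_norm by auto
    fix \<phi> assume \<phi>: "\<phi> \<in> test_functions \<Omega>"
    then obtain \<phi>' where D: "\<And>x. GDERIV \<phi> x :> \<phi>' x" by (rule test_function_GDERIV) blast
    have "(\<integral>x. \<phi> x *\<^sub>R g x \<partial>lebesgue_on \<Omega>) = (\<integral>x. \<phi> x *\<^sub>R h x \<partial>lebesgue_on \<Omega>)"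
    proof -
      have "(\<integral>x. v x *\<^sub>R \<phi>' x \<partial>lebesgue_on \<Omega>) = - (\<integral>x. \<phi> x *\<^sub>R g x \<partial>lebesgue_on \<Omega>)"
        "(\<integral>x. v x *\<^sub>R \<phi>' x \<partial>lebesgue_on \<Omega>) = - (\<integral>x. \<phi> x *\<^sub>R h x \<partial>lebesgue_on \<Omega>)"
        using g h \<phi> D unfolding has_weak_gradient_def by blast+
      then show ?thesis by simp
    qed
    then show "(\<integral>x. \<phi> x *\<^sub>R (g x - h x) \<partial>lebesgue_on \<Omega>) = 0"
      using integrable_test_scaleR[OF \<phi> L2(1)] integrable_test_scaleR[OF \<phi> L2(2)]
      by (simp add: scaleR_diff_right)
  qed
  then show ?thesis by eventually_elim simp
qed

lemma has_weak_gradient_diff: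
  assumes u: "has_weak_gradient \<Omega> u g" and v: "has_weak_gradient \<Omega> v h"
  shows "has_weak_gradient \<Omega> (u - v) (g - h)"
proof -
  have L2: "g \<in> L2_space \<Omega>" "h \<in> L2_space \<Omega>" "u \<in> L2_space \<Omega>" "v \<in> L2_space \<Omega>"
    using u v by (auto simp: has_weak_gradient_def)
  have "(\<integral>x. (u x - v x) *\<^sub>R \<phi>' x \<partial>lebesgue_on \<Omega>) = - (\<integral>x. \<phi> x *\<^sub>R (g x - h x) \<partial>lebesgue_on \<Omega>)"
    if "\<phi> \<in> test_functions \<Omega>" "\<forall>x. GDERIV \<phi> x :> \<phi>' x" for \<phi> \<phi>'
  proof -
    have "(\<integral>x. u x *\<^sub>R \<phi>' x \<partial>lebesgue_on \<Omega>) = - (\<integral>x. \<phi> x *\<^sub>R g x \<partial>lebesgue_on \<Omega>)"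
      "(\<integral>x. v x *\<^sub>R \<phi>' x \<partial>lebesgue_on \<Omega>) = - (\<integral>x. \<phi> x *\<^sub>R h x \<partial>lebesgue_on \<Omega>)"
      using u v that unfolding has_weak_gradient_def by blast+
    moreover have "\<And>x. GDERIV \<phi> x :> \<phi>' x" using that(2) by blast
    note int = integrable_scaleR_test_gradient[OF that(1) this]
    ultimately show ?thesis
      using integrable_test_scaleR[OF that(1) L2(1)] integrable_test_scaleR[OF that(1) L2(2)]
        int[OF L2(3)] int[OF L2(4)]
      by (simp add: scaleR_diff_right scaleR_diff_left)
  qed
  then show ?thesis
    using L2_space_diff[OF L2(1,2)] L2_space_diff[OF L2(3,4)] by (simp add: has_weak_gradient_def)
qed

lemma has_weak_gradient_scale:
  assumes "has_weak_gradient \<Omega> u g"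
  shows "has_weak_gradient \<Omega> (\<lambda>x. k * u x) (\<lambda>x. k *\<^sub>R g x)"
proof -
  have "(\<integral>x. (k * u x) *\<^sub>R \<phi>' x \<partial>lebesgue_on \<Omega>) = - (\<integral>x. \<phi> x *\<^sub>R k *\<^sub>R g x \<partial>lebesgue_on \<Omega>)"
    if "\<phi> \<in> test_functions \<Omega>" "\<forall>x. GDERIV \<phi> x :> \<phi>' x" for \<phi> \<phi>'
  proof -
    have "(\<integral>x. (k * u x) *\<^sub>R \<phi>' x \<partial>lebesgue_on \<Omega>) = k *\<^sub>R (\<integral>x. u x *\<^sub>R \<phi>' x \<partial>lebesgue_on \<Omega>)"
      by (simp flip: scaleR_scaleR)
    also have "\<dots> = - (k *\<^sub>R (\<integral>x. \<phi> x *\<^sub>R g x \<partial>lebesgue_on \<Omega>))"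
      using assms that unfolding has_weak_gradient_def by simp
    also have "\<dots> = - (\<integral>x. \<phi> x *\<^sub>R k *\<^sub>R g x \<partial>lebesgue_on \<Omega>)"
      by (simp add: mult.commute flip: integral_scaleR_right)
    finally show ?thesis .
  qed
  then show ?thesis
    using assms L2_space_scaleR[of u \<Omega> k] L2_space_scaleR[of g \<Omega> k] by (simp add: has_weak_gradient_def)
qed

text \<open>Allows the gradient chosen inside \<open>H1_norm\<close> to be replaced by whichever
  weak gradient is at hand.\<close>

lemma H1_norm_power2:
  assumes "has_weak_gradient \<Omega> v g"
  shows "(H1_norm \<Omega> v)\<^sup>2 = (L2_norm \<Omega> v)\<^sup>2 + (L2_norm \<Omega> g)\<^sup>2"
proof -
  have *: "has_weak_gradient \<Omega> v (SOME g. has_weak_gradient \<Omega> v g)" using assms by (rule someI[of "has_weak_gradient \<Omega> v"])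
  then have "L2_norm \<Omega> (SOME g. has_weak_gradient \<Omega> v g) = L2_norm \<Omega> g"
    using has_weak_gradient_unique[OF * assms] assms
    by (intro L2_norm_cong_AE) (auto simp: has_weak_gradient_def)
  then show ?thesis by (simp add: H1_norm_def)
qed

lemma H1_norm_nonneg [simp]: "0 \<le> H1_norm \<Omega> v"
  by (simp add: H1_norm_def)

lemma H1_norm_eq:
  assumes "has_weak_gradient \<Omega> v g"
  shows "H1_norm \<Omega> v = sqrt ((L2_norm \<Omega> v)\<^sup>2 + (L2_norm \<Omega> g)\<^sup>2)"
  by (rule real_sqrt_unique[symmetric]) (simp_all add: H1_norm_power2[OF assms])

lemma H1_space_L2: "v \<in> H1_space \<Omega> \<Longrightarrow> v \<in> L2_space \<Omega>"
  by (auto simp: H1_space_def has_weak_gradient_def)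

text \<open>Whatever gradient is chosen in \<open>H1_norm\<close>, it contributes a nonnegative
  square.\<close>

lemma L2_norm_le_H1_norm: "L2_norm \<Omega> v \<le> H1_norm \<Omega> v"
  by (simp add: H1_norm_def real_le_rsqrt)

lemma zero_H1_space: "(\<lambda>x. 0) \<in> H1_space \<Omega>"
  by (auto simp: H1_space_def has_weak_gradient_def intro!: exI[of _ "\<lambda>x. 0"])

lemma H1_norm_zero: "H1_norm \<Omega> (\<lambda>x. 0) = 0"
proof -
  have "has_weak_gradient \<Omega> (\<lambda>x. 0) (\<lambda>x. 0)" by (simp add: has_weak_gradient_def)
  then show ?thesis by (simp add: H1_norm_eq)
qed

lemma H1_space_diff: "u \<in> H1_space \<Omega> \<Longrightarrow> v \<in> H1_space \<Omega> \<Longrightarrow> u - v \<in> H1_space \<Omega>"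
  unfolding H1_space_def using has_weak_gradient_diff by blast

lemma H1_space_scale: "u \<in> H1_space \<Omega> \<Longrightarrow> (\<lambda>x. k * u x) \<in> H1_space \<Omega>"
  unfolding H1_space_def using has_weak_gradient_scale by blast

lemma H1_norm_scale:
  assumes "u \<in> H1_space \<Omega>"
  shows "H1_norm \<Omega> (\<lambda>x. k * u x) = \<bar>k\<bar> * H1_norm \<Omega> u"
proof -
  obtain g where g: "has_weak_gradient \<Omega> u g" using assms by (auto simp: H1_space_def)
  have "(H1_norm \<Omega> (\<lambda>x. k * u x))\<^sup>2 = (\<bar>k\<bar> * H1_norm \<Omega> u)\<^sup>2"
    using H1_norm_power2[OF has_weak_gradient_scale[OF g, of k]] H1_norm_power2[OF g]
      L2_norm_scaleR[of \<Omega> k u] L2_norm_scaleR[of \<Omega> k g]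
    by (simp add: power_mult_distrib algebra_simps)
  then show ?thesis by (rule power2_eq_imp_eq) auto
qed

text \<open>The L^2 triangle inequality bounds functions and gradients separately; the triangle
  inequality in the plane, for the pairs (norm of function, norm of gradient), combines
  them.\<close>

lemma H1_norm_diff_le:
  assumes "u \<in> H1_space \<Omega>" "v \<in> H1_space \<Omega>"
  shows "H1_norm \<Omega> (u - v) \<le> H1_norm \<Omega> u + H1_norm \<Omega> v"
proof -
  obtain g h where g: "has_weak_gradient \<Omega> u g" and h: "has_weak_gradient \<Omega> v h"
    using assms by (auto simp: H1_space_def)
  have "H1_norm \<Omega> (u - v) = sqrt ((L2_norm \<Omega> (u - v))\<^sup>2 + (L2_norm \<Omega> (g - h))\<^sup>2)"
    by (rule H1_norm_eq[OF has_weak_gradient_diff[OF g h]])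
  also have "\<dots> \<le> sqrt ((L2_norm \<Omega> u + L2_norm \<Omega> v)\<^sup>2 + (L2_norm \<Omega> g + L2_norm \<Omega> h)\<^sup>2)"
    using g h by (intro real_sqrt_le_mono add_mono power_mono L2_norm_triangle_diff)
      (auto simp: has_weak_gradient_def)
  also have "\<dots> \<le> H1_norm \<Omega> u + H1_norm \<Omega> v"
    unfolding H1_norm_eq[OF g] H1_norm_eq[OF h] by (rule real_sqrt_sum_squares_triangle_ineq)
  finally show ?thesis .
qed

text \<open>Bounds the set whose supremum is \<open>H1_dual_norm\<close>. A real supremum has its
  usual meaning only for nonempty sets that are bounded above.\<close>

lemma H1_dual_norm_aux:
  assumes "w \<in> L2_space \<Omega>" "v \<in> {v \<in> H1_space \<Omega>. H1_norm \<Omega> v \<le> 1}"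
  shows "\<bar>\<integral>x. w x * v x \<partial>lebesgue_on \<Omega>\<bar> \<le> L2_norm \<Omega> w"
proof -
  have "\<bar>\<integral>x. w x * v x \<partial>lebesgue_on \<Omega>\<bar> \<le> L2_norm \<Omega> w * L2_norm \<Omega> v"
    using assms H1_space_L2 by (intro L2_Cauchy_Schwarz) auto
  also have "\<dots> \<le> L2_norm \<Omega> w * 1"
    using assms L2_norm_le_H1_norm[of v] by (intro mult_left_mono) auto
  finally show ?thesis by simp
qed

lemma H1_ball_nonempty: "{v \<in> H1_space \<Omega>. H1_norm \<Omega> v \<le> 1} \<noteq> {}"
  using zero_H1_space H1_norm_zero by fastforce

lemma H1_dual_norm_le: "w \<in> L2_space \<Omega> \<Longrightarrow> H1_dual_norm \<Omega> w \<le> L2_norm \<Omega> w"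
  unfolding H1_dual_norm_def by (rule cSUP_least[OF H1_ball_nonempty]) (rule H1_dual_norm_aux)

lemma H1_dual_norm_upper:
  assumes "w \<in> L2_space \<Omega>" "v \<in> H1_space \<Omega>" "H1_norm \<Omega> v \<le> 1"
  shows "\<bar>\<integral>x. w x * v x \<partial>lebesgue_on \<Omega>\<bar> \<le> H1_dual_norm \<Omega> w"
  unfolding H1_dual_norm_def
  by (rule cSUP_upper) (use assms H1_dual_norm_aux in \<open>auto intro!: bdd_aboveI2[of _ _ "L2_norm \<Omega> w"]\<close>)

lemma H1_dual_norm_nonneg: "w \<in> L2_space \<Omega> \<Longrightarrow> 0 \<le> H1_dual_norm \<Omega> w"
  using H1_dual_norm_upper[OF _ zero_H1_space] by (simp add: H1_norm_zero)

lemma H1_dual_norm_bound: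
  assumes w: "w \<in> L2_space \<Omega>" and v: "v \<in> H1_space \<Omega>"
  shows "\<bar>\<integral>x. w x * v x \<partial>lebesgue_on \<Omega>\<bar> \<le> H1_dual_norm \<Omega> w * H1_norm \<Omega> v"
proof (cases "H1_norm \<Omega> v = 0")
  case True
  \<comment> \<open>A vanishing norm excludes normalising \<open>v\<close>, but then its L^2 norm
    vanishes too and Cauchy-Schwarz makes the pairing zero.\<close>
  then have "L2_norm \<Omega> v = 0" using L2_norm_le_H1_norm[of v] by (simp add: order_antisym)
  then show ?thesis using L2_Cauchy_Schwarz[OF w H1_space_L2[OF v]] True by simp
next
  case False
  define k where "k = H1_norm \<Omega> v"
  have k: "k > 0" using False by (simp add: k_def less_le)
  have "\<bar>\<integral>x. w x * (inverse k * v x) \<partial>lebesgue_on \<Omega>\<bar> \<le> H1_dual_norm \<Omega> w"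
    using k v by (intro H1_dual_norm_upper w H1_space_scale) (auto simp: H1_norm_scale simp flip: k_def)
  moreover have "(\<integral>x. w x * (inverse k * v x) \<partial>lebesgue_on \<Omega>) = inverse k * (\<integral>x. w x * v x \<partial>lebesgue_on \<Omega>)"
    by (simp add: mult.left_commute flip: integral_mult_right_zero)
  ultimately show ?thesis using k by (simp add: abs_mult field_simps flip: k_def)
qed

text \<open>With the roles of \<open>u\<close> and \<open>v\<close> exchanged as well, this makes
  \<open>H1_dual_norm\<close> Lipschitz for the L^2 norm. That continuity later carries
  measurability in time through approximations.\<close>

lemma H1_dual_norm_le_add:
  assumes u: "u \<in> L2_space \<Omega>" and v: "v \<in> L2_space \<Omega>"
  shows "H1_dual_norm \<Omega> u \<le> H1_dual_norm \<Omega> v + L2_norm \<Omega> (u - v)"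
  unfolding H1_dual_norm_def[of _ u]
proof (rule cSUP_least[OF H1_ball_nonempty])
  fix z assume z: "z \<in> {v \<in> H1_space \<Omega>. H1_norm \<Omega> v \<le> 1}"
  then have "z \<in> L2_space \<Omega>" using H1_space_L2 by auto
  then have "(\<integral>x. u x * z x \<partial>lebesgue_on \<Omega>)
      = (\<integral>x. v x * z x \<partial>lebesgue_on \<Omega>) + (\<integral>x. (u - v) x * z x \<partial>lebesgue_on \<Omega>)"
    using L2_integrable_mult[OF u, of z] L2_integrable_mult[OF v, of z] by (simp add: left_diff_distrib)
  then show "\<bar>\<integral>x. u x * z x \<partial>lebesgue_on \<Omega>\<bar> \<le> H1_dual_norm \<Omega> v + L2_norm \<Omega> (u - v)"
    using H1_dual_norm_aux[OF L2_space_diff[OF u v] z] H1_dual_norm_upper[OF v, of z] z by auto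
qed

lemma H1_dual_norm_abs_diff:
  assumes "u \<in> L2_space \<Omega>" "v \<in> L2_space \<Omega>"
  shows "\<bar>H1_dual_norm \<Omega> u - H1_dual_norm \<Omega> v\<bar> \<le> L2_norm \<Omega> (u - v)"
  using H1_dual_norm_le_add[OF assms] H1_dual_norm_le_add[OF assms(2,1)] L2_norm_minus_commute[of \<Omega> u v]
  by linarith

end

section \<open>Weak derivatives of real functions on an interval\<close>

text \<open>A smooth Heaviside function with \<beta> as an approximate Dirac mass at
  \<open>r\<close>. The transition lies to the right of \<open>r\<close>, so that for shrinking
  \<epsilon> the functions tend to 0 at \<open>r\<close> itself; differences of two of them then
  tend to indicators of half-open intervals \<open>{r<..s}\<close>.\<close>

definition smooth_step :: "real \<Rightarrow> real \<Rightarrow> (real \<Rightarrow> real) \<Rightarrow> (real \<Rightarrow> real) \<Rightarrow> bool" where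
  "smooth_step r \<epsilon> S \<beta> \<longleftrightarrow> (\<forall>k. C_k k S) \<and> (\<forall>t. (S has_real_derivative \<beta> t) (at t)) \<and>
     continuous_on UNIV \<beta> \<and> (\<forall>t. 0 \<le> \<beta> t) \<and> (\<forall>t. t \<notin> {r..r + \<epsilon>} \<longrightarrow> \<beta> t = 0) \<and>
     (\<forall>t\<le>r. S t = 0) \<and> (\<forall>t\<ge>r + \<epsilon>. S t = 1)"

text \<open>The primitive of a bump on (r, r + \<epsilon>), shifted to vanish at \<open>r\<close>
  and divided by the total mass of the bump.\<close>

lemma smooth_step_exists:
  fixes r \<epsilon> :: real
  assumes "0 < \<epsilon>"
  shows "\<exists>S \<beta>. smooth_step r \<epsilon> S \<beta>"
proof -
  let ?B = "bump r (r + \<epsilon>)"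
  have contB: "continuous_on UNIV ?B" by (rule continuous_on_bump)
  then have "isCont ?B x" for x by (simp add: continuous_on_eq_continuous_at)
  then obtain F where "\<forall>x. (F has_vector_derivative ?B x) (at x)"
    using einterval_antiderivative[of "-\<infinity>" \<infinity> ?B] by auto
  then have F: "(F has_real_derivative ?B x) (at x)" for x
    by (simp add: has_real_derivative_iff_has_vector_derivative)
  have B0: "?B x = 0" if "x \<notin> {r..r + \<epsilon>}" for x
    using bump_pos_iff[of r "r + \<epsilon>" x] bump_nonneg[of r "r + \<epsilon>" x] that by (auto simp: less_le)
  have const: "F b = F a" if "a \<le> b" "\<And>x. a < x \<Longrightarrow> x < b \<Longrightarrow> ?B x = 0" for a b
  proof (cases "a = b")
    case False
    then have "a < b" using that(1) by simp
    then obtain z where "a < z" "z < b" "F b - F a = (b - a) * ?B z"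
      using MVT2[of a b F ?B] F by blast
    then show ?thesis using that(2) by simp
  qed simp
  have lt: "F r < F (r + \<epsilon>)"
  proof (rule DERIV_pos_imp_increasing_open[of r "r + \<epsilon>" F])
    show "\<exists>y. (F has_real_derivative y) (at x) \<and> 0 < y" if "r < x" "x < r + \<epsilon>" for x
      using that F[of x] bump_pos_iff[of r "r + \<epsilon>" x] by auto
    show "continuous_on {r..r + \<epsilon>} F"
      using F by (meson DERIV_isCont continuous_at_imp_continuous_on)
  qed (use assms in simp)
  \<comment> \<open>The total mass of the bump, positive by \<open>lt\<close>.\<close>
  define c where "c = F (r + \<epsilon>) - F r"
  define S where "S t = (F t - F r) / c" for t
  define \<beta> where "\<beta> t = ?B t / c" for t
  have c: "c > 0" using lt by (simp add: c_def)
  have S: "(S has_real_derivative \<beta> t) (at t)" for t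
    unfolding S_def \<beta>_def by (rule derivative_eq_intros F | use c in simp)+
  have "C_k k S" for k
  proof (cases k)
    case 0
    then show ?thesis
      using DERIV_isCont[OF S] by (simp add: continuous_at_imp_continuous_on)
  next
    case (Suc k)
    have "C_k k (\<lambda>t. inverse c * ?B t)" by (intro C_k_mult C_k_const C_k_bump)
    then have "\<forall>b\<in>Basis. C_k k (\<lambda>t. \<beta> t \<bullet> b)"
      by (simp add: \<beta>_def divide_inverse mult.commute)
    then show ?thesis using S by (auto intro!: exI[of _ \<beta>] simp: Suc)
  qed
  moreover have "continuous_on UNIV \<beta>"
    unfolding \<beta>_def using contB c by (intro continuous_intros) auto
  moreover have "S t = 0" if "t \<le> r" for t
    using const[OF that] B0 by (auto simp: S_def)
  moreover have "S t = 1" if "r + \<epsilon> \<le> t" for t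
    using const[OF that] B0 c by (auto simp: S_def c_def)
  ultimately have "smooth_step r \<epsilon> S \<beta>"
    using S B0 c by (simp add: smooth_step_def \<beta>_def bump_nonneg)
  then show ?thesis by blast
qed

lemma smooth_step_bounds:
  assumes "smooth_step r \<epsilon> S \<beta>"
  shows "0 \<le> S t" "S t \<le> 1"
proof -
  have mono: "S a \<le> S b" if "a \<le> b" for a b
    using that
  proof (rule DERIV_nonneg_imp_nondecreasing)
    show "\<exists>y. (S has_real_derivative y) (at x) \<and> 0 \<le> y" for x
      using assms unfolding smooth_step_def by blast
  qed
  have "S (min t r) = 0" "S (max t (r + \<epsilon>)) = 1" using assms by (auto simp: smooth_step_def)
  then show "0 \<le> S t" "S t \<le> 1"
    using mono[of "min t r" t] mono[of t "max t (r + \<epsilon>)"] by auto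
qed

text \<open>The weight \<beta> is nonnegative, has mass S(T) - S(0) = 1 and lives on
  \<open>{r..r + \<epsilon>}\<close>, so the integral is an average of values of \<open>a\<close>
  near \<open>r\<close>.\<close>

lemma smooth_step_integral_close:
  assumes step: "smooth_step r \<epsilon> S \<beta>" and r: "0 \<le> r" "0 < \<epsilon>" "r + \<epsilon> \<le> T"
    and a: "continuous_on {0..T} a" and close: "\<And>t. t \<in> {r..r + \<epsilon>} \<Longrightarrow> \<bar>a t - a r\<bar> \<le> e"
  shows "\<bar>(\<integral>t. \<beta> t * a t \<partial>lebesgue_on {0..T}) - a r\<bar> \<le> e"
proof -
  have \<beta>: "continuous_on {0..T} \<beta>" "\<And>t. 0 \<le> \<beta> t" "\<And>t. t \<notin> {r..r + \<epsilon>} \<Longrightarrow> \<beta> t = 0"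
    using step by (auto simp: smooth_step_def intro: continuous_on_subset)
  note [simp] = continuous_imp_integrable_real
  have int\<beta>: "integrable (lebesgue_on {0..T}) \<beta>" using \<beta>(1) by simp
  have int: "integrable (lebesgue_on {0..T}) (\<lambda>t. \<beta> t * (a t - a r))"
    using \<beta>(1) a by (intro continuous_imp_integrable_real continuous_intros)
  have "(\<beta> has_integral (S T - S 0)) {0..T}"
    using step r by (intro fundamental_theorem_of_calculus)
      (auto simp: smooth_step_def has_real_derivative_iff_has_vector_derivative[symmetric]
        intro: has_field_derivative_at_within)
  then have "(\<integral>t. \<beta> t \<partial>lebesgue_on {0..T}) = S T - S 0"
    using lebesgue_integral_eq_integral[OF int\<beta>] by (simp add: integral_unique)
  also have "\<dots> = 1" using step r by (simp add: smooth_step_def)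
  finally have one: "(\<integral>t. \<beta> t \<partial>lebesgue_on {0..T}) = 1" .
  have "(\<integral>t. \<beta> t * a t \<partial>lebesgue_on {0..T})
      = (\<integral>t. \<beta> t * (a t - a r) + a r * \<beta> t \<partial>lebesgue_on {0..T})"
    by (simp add: algebra_simps)
  also have "\<dots> = (\<integral>t. \<beta> t * (a t - a r) \<partial>lebesgue_on {0..T}) + a r"
    using int int\<beta> one by (subst Bochner_Integration.integral_add) auto
  finally have "\<bar>(\<integral>t. \<beta> t * a t \<partial>lebesgue_on {0..T}) - a r\<bar>
      = \<bar>\<integral>t. \<beta> t * (a t - a r) \<partial>lebesgue_on {0..T}\<bar>" by simp
  also have "\<dots> \<le> (\<integral>t. \<bar>\<beta> t * (a t - a r)\<bar> \<partial>lebesgue_on {0..T})" by (rule integral_abs_bound)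
  also have "\<dots> \<le> (\<integral>t. e * \<beta> t \<partial>lebesgue_on {0..T})"
  proof (rule integral_mono)
    show "\<bar>\<beta> t * (a t - a r)\<bar> \<le> e * \<beta> t" for t
      using close[of t] \<beta>(2,3)[of t]
      by (cases "t \<in> {r..r + \<epsilon>}") (auto simp: abs_mult mult.commute[of e] intro!: mult_left_mono)
  qed (use int int\<beta> in auto)
  also have "\<dots> = e" using one by simp
  finally show ?thesis .
qed

text \<open>To the left of \<open>r\<close> both steps are 0, to the right of
  \<open>s + \<epsilon>\<close> both are 1, so their difference has compact support. The strict
  bounds \<open>0 < r\<close> and \<open>s + \<epsilon> < T\<close> place it inside the open
  interval.\<close>

lemma smooth_step_diff_test_function:
  assumes "smooth_step r \<epsilon> S \<beta>" "smooth_step s \<epsilon> S' \<beta>'" "0 < r" "r < s" "0 < \<epsilon>" "s + \<epsilon> < T"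
  shows "(\<lambda>t. S t - S' t) \<in> test_functions {0<..<T}"
proof -
  have "{t. S t - S' t \<noteq> 0} \<subseteq> {r..s + \<epsilon>}"
  proof
    fix t assume "t \<in> {t. S t - S' t \<noteq> 0}"
    then have "\<not> (S t = 0 \<and> S' t = 0)" "\<not> (S t = 1 \<and> S' t = 1)" by auto
    then show "t \<in> {r..s + \<epsilon>}"
      using assms unfolding smooth_step_def by (smt (verit) atLeastAtMost_iff)
  qed
  then have cl: "closure {t. S t - S' t \<noteq> 0} \<subseteq> {r..s + \<epsilon>}" by (rule closure_minimal) simp
  then have "compact (closure {t. S t - S' t \<noteq> 0})"
    using compact_closure bounded_subset[OF bounded_closed_interval[of r "s + \<epsilon>"]]
      closure_subset by (meson subset_trans)
  moreover have "closure {t. S t - S' t \<noteq> 0} \<subseteq> {0<..<T}" using cl assms by force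
  ultimately show ?thesis
    using assms(1,2) by (auto simp: test_functions_def smooth_step_def intro: C_k_diff)
qed

lemma AE_lebesgue_on_neq: "S \<in> sets lebesgue \<Longrightarrow> AE t in lebesgue_on S. t \<noteq> (c::'a::euclidean_space)"
  using AE_completion[OF AE_lborel_singleton[of c]]
  by (subst AE_restrict_space_iff) (auto elim: eventually_mono)

lemma indicator_measurable_lebesgue_on [measurable]:
  "A \<in> sets borel \<Longrightarrow> indicat_real A \<in> borel_measurable (lebesgue_on B)"
  by (intro measurable_restrict_space1 borel_measurable_indicator) (simp add: sets_completionI_sets)

lemma integrable_indicator_mult:
  fixes b :: "'a::euclidean_space \<Rightarrow> real"
  assumes "integrable (lebesgue_on B) b" "A \<in> sets borel"
  shows "integrable (lebesgue_on B) (\<lambda>t. indicator A t * b t)"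
proof (rule Bochner_Integration.integrable_bound[OF assms(1)])
  note [measurable] = borel_measurable_integrable[OF assms(1)] assms(2)
  show "(\<lambda>t. indicator A t * b t) \<in> borel_measurable (lebesgue_on B)" by measurable
qed (auto simp: indicator_def)

text \<open>Dominated convergence with majorant |b|. The indicators converge for every t different
  from s; at t = s they may keep switching when \<open>u n\<close> oscillates about s.\<close>

lemma continuous_on_indefinite_integral:
  fixes b :: "real \<Rightarrow> real"
  assumes b: "integrable (lebesgue_on {0..T}) b"
  shows "continuous_on {0..T} (\<lambda>s. \<integral>t. indicator {0<..s} t * b t \<partial>lebesgue_on {0..T})"
  unfolding continuous_on_sequentially comp_def
proof (intro ballI allI impI, elim conjE)
  fix s and u :: "nat \<Rightarrow> real"
  assume "s \<in> {0..T}" and u: "u \<longlonglongrightarrow> s"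
  note [measurable] = borel_measurable_integrable[OF b]
  show "(\<lambda>n. \<integral>t. indicator {0<..u n} t * b t \<partial>lebesgue_on {0..T})
      \<longlonglongrightarrow> (\<integral>t. indicator {0<..s} t * b t \<partial>lebesgue_on {0..T})"
  proof (rule integral_dominated_convergence[where w = "\<lambda>t. \<bar>b t\<bar>"])
    have "AE t in lebesgue_on {0..T}. t \<noteq> s" by (rule AE_lebesgue_on_neq) simp
    then show "AE t in lebesgue_on {0..T}. (\<lambda>n. indicator {0<..u n} t * b t) \<longlonglongrightarrow> indicator {0<..s} t * b t"
    proof eventually_elim
      case (elim t)
      have "\<forall>\<^sub>F n in sequentially. indicat_real {0<..u n} t = indicator {0<..s} t"
      proof (cases "t < s")
        case True
        then have "\<forall>\<^sub>F n in sequentially. t < u n" using order_tendstoD(1)[OF u] by blast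
        then show ?thesis by eventually_elim (use True in \<open>auto simp: indicator_def\<close>)
      next
        case False
        then have "\<forall>\<^sub>F n in sequentially. u n < t" using order_tendstoD(2)[OF u] elim by auto
        then show ?thesis by eventually_elim (use False elim in \<open>auto simp: indicator_def\<close>)
      qed
      then have "(\<lambda>n. indicat_real {0<..u n} t) \<longlonglongrightarrow> indicator {0<..s} t" by (rule tendsto_eventually)
      then show ?case by (intro tendsto_mult tendsto_const)
    qed
    show "(\<lambda>t. indicator {0<..s} t * b t) \<in> borel_measurable (lebesgue_on {0..T})" by measurable
    show "(\<lambda>t. indicator {0<..u n} t * b t) \<in> borel_measurable (lebesgue_on {0..T})" for n by measurable
    show "AE t in lebesgue_on {0..T}. norm (indicator {0<..u n} t * b t) \<le> \<bar>b t\<bar>" for n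
      by (auto simp: indicator_def)
  qed (use b in simp)
qed

text \<open>Turns an averaging estimate on shrinking windows into a limit; \<open>bound\<close> has
  the form that \<open>smooth_step_integral_close\<close> delivers.\<close>

lemma tendsto_of_shrinking_bound:
  fixes a :: "real \<Rightarrow> real"
  assumes "continuous_on {0..T} a" "0 \<le> r" "r < T" and \<epsilon>: "\<epsilon> \<longlonglongrightarrow> (0::real)"
    and bound: "\<And>n e. (\<And>t. t \<in> {r..r + \<epsilon> n} \<Longrightarrow> \<bar>a t - a r\<bar> \<le> e) \<Longrightarrow> \<bar>I n - a r\<bar> \<le> e"
  shows "I \<longlonglongrightarrow> a r"
proof (rule LIMSEQ_I)
  fix e :: real assume "e > 0"
  then obtain d where d: "d > 0" "\<And>t. t \<in> {0..T} \<Longrightarrow> \<bar>t - r\<bar> < d \<Longrightarrow> \<bar>a t - a r\<bar> < e / 2"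
    using assms(1-3) unfolding continuous_on_iff dist_real_def by (metis atLeastAtMost_iff half_gt_zero less_imp_le)
  \<comment> \<open>The term \<open>T - r\<close> keeps the window inside \<open>{0..T}\<close>,
    where the continuity of \<open>a\<close> is available.\<close>
  define d' where "d' = min d (T - r)"
  have "d' > 0" using d assms by (simp add: d'_def)
  then obtain N where N: "\<And>n. n \<ge> N \<Longrightarrow> \<bar>\<epsilon> n\<bar> < d'" using LIMSEQ_D[OF \<epsilon>] by auto
  have "norm (I n - a r) < e" if "n \<ge> N" for n
  proof -
    have "\<bar>a t - a r\<bar> \<le> e / 2" if "t \<in> {r..r + \<epsilon> n}" for t
      using N[OF \<open>n \<ge> N\<close>] that assms(2) by (intro less_imp_le d(2)) (auto simp: d'_def)
    then have "\<bar>I n - a r\<bar> \<le> e / 2" by (rule bound)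
    then show ?thesis using \<open>e > 0\<close> by simp
  qed
  then show "\<exists>N. \<forall>n\<ge>N. norm (I n - a r) < e" by blast
qed

lemma weak_derivative_increment:
  fixes a b :: "real \<Rightarrow> real"
  assumes a: "continuous_on {0..T} a" and b: "integrable (lebesgue_on {0..T}) b"
    and weak: "\<And>\<phi> \<phi>'. \<phi> \<in> test_functions {0<..<T} \<Longrightarrow> (\<And>t. (\<phi> has_real_derivative \<phi>' t) (at t)) \<Longrightarrow>
        (\<integral>t. \<phi>' t * a t \<partial>lebesgue_on {0..T}) = - (\<integral>t. \<phi> t * b t \<partial>lebesgue_on {0..T})"
    and rs: "0 < r" "r < s" "s < T"
  shows "a s - a r = (\<integral>t. indicator {r<..s} t * b t \<partial>lebesgue_on {0..T})"
proof -
  \<comment> \<open>The summand 2 makes \<open>s + \<epsilon> n < T\<close> strict already for n =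
    0, where 1 would give equality.\<close>
  define \<epsilon> where "\<epsilon> n = (T - s) / (real n + 2)" for n
  have \<epsilon>: "0 < \<epsilon> n" "s + \<epsilon> n < T" for n
  proof -
    show "0 < \<epsilon> n" using rs by (simp add: \<epsilon>_def)
    have "\<epsilon> n \<le> (T - s) / 2" using rs unfolding \<epsilon>_def by (intro divide_left_mono) auto
    then show "s + \<epsilon> n < T" using rs by (simp add: field_simps)
  qed
  have \<epsilon>0: "\<epsilon> \<longlonglongrightarrow> 0" unfolding \<epsilon>_def by real_asymp
  have "\<forall>n. \<exists>S \<beta>. smooth_step p (\<epsilon> n) S \<beta>" for p
    using smooth_step_exists \<epsilon>(1) by blast
  then have "\<exists>S \<beta>. \<forall>n. smooth_step p (\<epsilon> n) (S n) (\<beta> n)" for p by metis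
  then obtain S \<beta> S' \<beta>' where S: "\<And>n. smooth_step r (\<epsilon> n) (S n) (\<beta> n)"
    and S': "\<And>n. smooth_step s (\<epsilon> n) (S' n) (\<beta>' n)" by metis
  \<comment> \<open>Testing with the smoothed indicator produces averages of \<open>a\<close> near
    \<open>r\<close> and near \<open>s\<close> on one side and a smoothed integral of
    \<open>b\<close> on the other.\<close>
  have eq: "(\<integral>t. \<beta> n t * a t \<partial>lebesgue_on {0..T}) - (\<integral>t. \<beta>' n t * a t \<partial>lebesgue_on {0..T})
      = - (\<integral>t. (S n t - S' n t) * b t \<partial>lebesgue_on {0..T})" for n
  proof -
    have "(\<integral>t. (\<beta> n t - \<beta>' n t) * a t \<partial>lebesgue_on {0..T}) = - (\<integral>t. (S n t - S' n t) * b t \<partial>lebesgue_on {0..T})"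
    proof (rule weak)
      show "(\<lambda>t. S n t - S' n t) \<in> test_functions {0<..<T}"
        using smooth_step_diff_test_function[OF S S'] rs \<epsilon> by blast
      show "((\<lambda>t. S n t - S' n t) has_real_derivative \<beta> n t - \<beta>' n t) (at t)" for t
        using S[of n] S'[of n] by (intro DERIV_diff) (auto simp: smooth_step_def)
    qed
    moreover have "continuous_on {0..T} (\<beta> n)" "continuous_on {0..T} (\<beta>' n)"
      using S[of n] S'[of n] by (auto simp: smooth_step_def intro: continuous_on_subset)
    then have "integrable (lebesgue_on {0..T}) (\<lambda>t. \<beta> n t * a t)"
      "integrable (lebesgue_on {0..T}) (\<lambda>t. \<beta>' n t * a t)"
      using a by (auto intro!: continuous_imp_integrable_real continuous_intros)
    ultimately show ?thesis by (simp add: left_diff_distrib)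
  qed
  have lim1: "(\<lambda>n. \<integral>t. \<beta> n t * a t \<partial>lebesgue_on {0..T}) \<longlonglongrightarrow> a r"
  proof (rule tendsto_of_shrinking_bound[OF a _ _ \<epsilon>0])
    fix n e assume "\<And>t. t \<in> {r..r + \<epsilon> n} \<Longrightarrow> \<bar>a t - a r\<bar> \<le> e"
    then show "\<bar>(\<integral>t. \<beta> n t * a t \<partial>lebesgue_on {0..T}) - a r\<bar> \<le> e"
      using rs \<epsilon>[of n] by (intro smooth_step_integral_close[OF S[of n] _ _ _ a]) auto
  qed (use rs in auto)
  have lim2: "(\<lambda>n. \<integral>t. \<beta>' n t * a t \<partial>lebesgue_on {0..T}) \<longlonglongrightarrow> a s"
  proof (rule tendsto_of_shrinking_bound[OF a _ _ \<epsilon>0])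
    fix n e assume "\<And>t. t \<in> {s..s + \<epsilon> n} \<Longrightarrow> \<bar>a t - a s\<bar> \<le> e"
    then show "\<bar>(\<integral>t. \<beta>' n t * a t \<partial>lebesgue_on {0..T}) - a s\<bar> \<le> e"
      using rs \<epsilon>[of n] by (intro smooth_step_integral_close[OF S'[of n] _ _ _ a]) auto
  qed (use rs in auto)
  have lim3: "(\<lambda>n. \<integral>t. (S n t - S' n t) * b t \<partial>lebesgue_on {0..T})
      \<longlonglongrightarrow> (\<integral>t. indicator {r<..s} t * b t \<partial>lebesgue_on {0..T})"
  proof (rule integral_dominated_convergence[where w = "\<lambda>t. \<bar>b t\<bar>"])
    note [measurable] = borel_measurable_integrable[OF b]
    show "(\<lambda>t. indicator {r<..s} t * b t) \<in> borel_measurable (lebesgue_on {0..T})" by measurable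
    have "continuous_on {0..T} (\<lambda>t. S n t - S' n t)" for n
      using S[of n] S'[of n] unfolding smooth_step_def
      by (intro continuous_on_diff continuous_at_imp_continuous_on) (auto intro: DERIV_isCont)
    then have [measurable]: "(\<lambda>t. S n t - S' n t) \<in> borel_measurable (lebesgue_on {0..T})" for n
      by (rule continuous_imp_measurable_on_sets_lebesgue) simp
    show "(\<lambda>t. (S n t - S' n t) * b t) \<in> borel_measurable (lebesgue_on {0..T})" for n by measurable
    show "AE t in lebesgue_on {0..T}. norm ((S n t - S' n t) * b t) \<le> \<bar>b t\<bar>" for n
    proof (rule AE_I2)
      fix t
      have "\<bar>S n t - S' n t\<bar> \<le> 1"
        using smooth_step_bounds[OF S[of n], of t] smooth_step_bounds[OF S'[of n], of t] by linarith
      then show "norm ((S n t - S' n t) * b t) \<le> \<bar>b t\<bar>"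
        by (simp add: abs_mult mult_left_le_one_le)
    qed
    have "(\<lambda>n. S n t - S' n t) \<longlonglongrightarrow> indicator {r<..s} t" for t
    proof -
      have step: "(\<lambda>n. W n t) \<longlonglongrightarrow> (if p < t then 1 else 0)"
        if W: "\<And>n. smooth_step p (\<epsilon> n) (W n) (\<gamma> n)" for p W \<gamma>
      proof (cases "p < t")
        case True
        then have "\<forall>\<^sub>F n in sequentially. \<epsilon> n < t - p" using order_tendstoD(2)[OF \<epsilon>0] by simp
        then have "\<forall>\<^sub>F n in sequentially. W n t = 1"
          by eventually_elim (use W in \<open>auto simp: smooth_step_def\<close>)
        then show ?thesis using True by (simp add: tendsto_eventually)
      next
        case False
        then show ?thesis using W by (simp add: smooth_step_def)
      qed
      have "(\<lambda>n. S n t - S' n t) \<longlonglongrightarrow> (if r < t then 1 else 0) - (if s < t then 1 else 0)"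
        by (intro tendsto_diff step[OF S] step[OF S'])
      also have "(if r < t then 1 else 0) - (if s < t then 1 else 0) = indicat_real {r<..s} t"
        using rs by (auto simp: indicator_def)
      finally show ?thesis .
    qed
    then show "AE t in lebesgue_on {0..T}. (\<lambda>n. (S n t - S' n t) * b t) \<longlonglongrightarrow> indicator {r<..s} t * b t"
      by (intro AE_I2 tendsto_mult tendsto_const)
  qed (use b in simp)
  have "a r - a s = - (\<integral>t. indicator {r<..s} t * b t \<partial>lebesgue_on {0..T})"
    by (rule LIMSEQ_unique[OF tendsto_diff[OF lim1 lim2]]) (simp only: eq tendsto_minus[OF lim3])
  then show ?thesis by simp
qed

text \<open>Test functions live strictly inside (0, T), so increments are known first for interior
  times. Hence \<open>a - P\<close> is constant on the open interval, and continuity extends this to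
  both endpoints; the endpoint 0 is where the initial value enters.\<close>

lemma weak_derivative_FTC:
  fixes a b :: "real \<Rightarrow> real"
  assumes a: "continuous_on {0..T} a" and b: "integrable (lebesgue_on {0..T}) b"
    and weak: "\<And>\<phi> \<phi>'. \<phi> \<in> test_functions {0<..<T} \<Longrightarrow> (\<And>t. (\<phi> has_real_derivative \<phi>' t) (at t)) \<Longrightarrow>
        (\<integral>t. \<phi>' t * a t \<partial>lebesgue_on {0..T}) = - (\<integral>t. \<phi> t * b t \<partial>lebesgue_on {0..T})"
    and rs: "0 \<le> r" "r \<le> s" "s \<le> T" and T: "0 < T"
  shows "a s - a r = (\<integral>t. indicator {r<..s} t * b t \<partial>lebesgue_on {0..T})"
proof -
  define P where "P s = (\<integral>t. indicator {0<..s} t * b t \<partial>lebesgue_on {0..T})" for s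
  have split: "P s - P r = (\<integral>t. indicator {r<..s} t * b t \<partial>lebesgue_on {0..T})" if "0 \<le> r" "r \<le> s" for r s
  proof -
    have "indicat_real {r<..s} t = indicator {0<..s} t - indicator {0<..r} t" for t
      using that by (auto simp: indicator_def)
    then show ?thesis
      using integrable_indicator_mult[OF b, of "{0<..s}"] integrable_indicator_mult[OF b, of "{0<..r}"]
      by (simp add: P_def left_diff_distrib)
  qed
  have inc: "a y - P y = a x - P x" if "0 < x" "x < y" "y < T" for x y
    using weak_derivative_increment[OF a b weak that] split[of x y] that by simp
  have const: "a s - P s = a (T / 2) - P (T / 2)" if "s \<in> {0..T}" for s
  proof (rule continuous_constant_on_closure[of "{0<..<T}" "\<lambda>s. a s - P s"])
    have "continuous_on {0..T} (\<lambda>s. a s - P s)"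
      unfolding P_def using a continuous_on_indefinite_integral[OF b] by (rule continuous_on_diff)
    then show "continuous_on (closure {0<..<T}) (\<lambda>s. a s - P s)" using T by simp
    show "s \<in> closure {0<..<T}" using T that by simp
    show "a x - P x = a (T / 2) - P (T / 2)" if "x \<in> {0<..<T}" for x
    proof -
      consider "x < T / 2" | "x = T / 2" | "x > T / 2" by linarith
      then show ?thesis
        by cases (use inc[of x "T / 2"] inc[of "T / 2" x] that T in auto)
    qed
  qed
  show ?thesis using const[of r] const[of s] rs split[of r s] by simp
qed

section \<open>Functions of time with values in \<open>L\<^sup>2\<close>\<close>

locale time_cylinder = bounded_open \<Omega> for \<Omega> :: "'a::euclidean_space set" +
  fixes T :: real
  assumes T_pos: "0 < T"
begin

abbreviation "Mt \<equiv> lebesgue_on {0..T}"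

sublocale time: finite_measure Mt
  by (rule finite_measure_lebesgue_on) simp

sublocale Q: pair_sigma_finite Mt "lebesgue_on \<Omega>" ..

text \<open>Projections in place of a pattern-matching lambda, so that the fact can serve as a
  measurability rule for compound terms.\<close>

lemma Q_measurable_iff:
  "Q_measurable T \<Omega> y \<longleftrightarrow> (\<lambda>p. y (fst p) (snd p)) \<in> borel_measurable (Mt \<Otimes>\<^sub>M lebesgue_on \<Omega>)"
  by (simp add: Q_measurable_def Q_measure_def case_prod_beta')

lemma Q_measurable_const:
  assumes "v \<in> borel_measurable (lebesgue_on \<Omega>)"
  shows "Q_measurable T \<Omega> (\<lambda>_. v)"
  unfolding Q_measurable_iff using assms by measurable

lemma Q_measurable_diff:
  fixes y z :: "real \<Rightarrow> 'a \<Rightarrow> 'b::euclidean_space"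
  assumes "Q_measurable T \<Omega> y" "Q_measurable T \<Omega> z"
  shows "Q_measurable T \<Omega> (\<lambda>t. y t - z t)"
  using assms unfolding Q_measurable_iff by (simp add: fun_diff_def)

lemma Q_measurable_scaleR:
  fixes y :: "real \<Rightarrow> 'a \<Rightarrow> 'b::euclidean_space"
  assumes "k \<in> borel_measurable Mt" "Q_measurable T \<Omega> y"
  shows "Q_measurable T \<Omega> (\<lambda>t x. k t *\<^sub>R y t x)"
  using assms unfolding Q_measurable_iff by measurable

lemma Q_measurable_inner_integral:
  fixes y z :: "real \<Rightarrow> 'a \<Rightarrow> real"
  assumes "Q_measurable T \<Omega> y" "Q_measurable T \<Omega> z"
  shows "(\<lambda>t. \<integral>x. y t x * z t x \<partial>lebesgue_on \<Omega>) \<in> borel_measurable Mt"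
proof -
  note [measurable] = assms[unfolded Q_measurable_iff]
  have "(\<lambda>(t, x). y t x * z t x) \<in> borel_measurable (Mt \<Otimes>\<^sub>M lebesgue_on \<Omega>)"
    unfolding case_prod_beta' by measurable
  then show ?thesis by (rule borel_measurable_lebesgue_integral)
qed

lemma Q_measurable_L2_norm:
  fixes y :: "real \<Rightarrow> 'a \<Rightarrow> 'b::euclidean_space"
  assumes "Q_measurable T \<Omega> y"
  shows "(\<lambda>t. L2_norm \<Omega> (y t)) \<in> borel_measurable Mt"
proof -
  note [measurable] = assms[unfolded Q_measurable_iff]
  have "(\<lambda>(t, x). (norm (y t x))\<^sup>2) \<in> borel_measurable (Mt \<Otimes>\<^sub>M lebesgue_on \<Omega>)"
    unfolding case_prod_beta' by measurable
  then have [measurable]: "(\<lambda>t. \<integral>x. (norm (y t x))\<^sup>2 \<partial>lebesgue_on \<Omega>) \<in> borel_measurable Mt"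
    by (rule borel_measurable_lebesgue_integral)
  show ?thesis unfolding L2_norm_def by measurable
qed

lemma L2_L2_D:
  assumes "y \<in> L2_L2 T \<Omega>"
  shows "Q_measurable T \<Omega> y" "AE t in Mt. y t \<in> L2_space \<Omega>" "integrable Mt (\<lambda>t. (L2_norm \<Omega> (y t))\<^sup>2)"
    "integrable Mt (\<lambda>t. L2_norm \<Omega> (y t))"
proof -
  show meas: "Q_measurable T \<Omega> y" and int: "integrable Mt (\<lambda>t. (L2_norm \<Omega> (y t))\<^sup>2)"
    using assms by (auto simp: L2_L2_def)
  show "AE t in Mt. y t \<in> L2_space \<Omega>"
    using assms by (auto simp: L2_L2_def strongly_measurable_def simple_approx_def)
  have "integrable Mt (\<lambda>t. 1 + (L2_norm \<Omega> (y t))\<^sup>2)" using int by auto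
  then show "integrable Mt (\<lambda>t. L2_norm \<Omega> (y t))"
  proof (rule Bochner_Integration.integrable_bound)
    have "a \<le> 1 + a\<^sup>2" for a :: real using zero_le_power2[of "a - 1 / 2"]
      by (simp add: power2_eq_square algebra_simps)
    then show "AE t in Mt. norm (L2_norm \<Omega> (y t)) \<le> norm (1 + (L2_norm \<Omega> (y t))\<^sup>2)"
      by (auto intro!: AE_I2)
  qed (rule Q_measurable_L2_norm[OF meas])
qed

lemma integrable_inner_integral:
  fixes f g :: "real \<Rightarrow> 'a \<Rightarrow> real"
  assumes f: "Q_measurable T \<Omega> f" "AE t in Mt. f t \<in> L2_space \<Omega>" "integrable Mt (\<lambda>t. L2_norm \<Omega> (f t))"
    and g: "Q_measurable T \<Omega> g" "AE t in Mt. g t \<in> L2_space \<Omega>" "AE t in Mt. L2_norm \<Omega> (g t) \<le> B"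
  shows "integrable Mt (\<lambda>t. \<integral>x. f t x * g t x \<partial>lebesgue_on \<Omega>)"
proof (rule Bochner_Integration.integrable_bound)
  show "integrable Mt (\<lambda>t. L2_norm \<Omega> (f t) * B)" using f(3) by simp
  show "AE t in Mt. norm (\<integral>x. f t x * g t x \<partial>lebesgue_on \<Omega>) \<le> norm (L2_norm \<Omega> (f t) * B)"
    using f(2) g(2,3)
  proof eventually_elim
    case (elim t)
    have "\<bar>\<integral>x. f t x * g t x \<partial>lebesgue_on \<Omega>\<bar> \<le> L2_norm \<Omega> (f t) * L2_norm \<Omega> (g t)"
      using elim by (intro L2_Cauchy_Schwarz)
    also have "\<dots> \<le> L2_norm \<Omega> (f t) * \<bar>B\<bar>" using elim by (intro mult_left_mono) auto
    finally show ?case by (simp add: abs_mult)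
  qed
qed (rule Q_measurable_inner_integral[OF f(1) g(1)])

lemma L2_space_sum:
  fixes f :: "'i \<Rightarrow> 'a \<Rightarrow> real"
  assumes "finite I" "\<And>i. i \<in> I \<Longrightarrow> f i \<in> L2_space \<Omega>"
  shows "(\<lambda>x. \<Sum>i\<in>I. f i x) \<in> L2_space \<Omega>"
  using assms by (induction I) (auto intro!: L2_space_add)

text \<open>The function \<open>I\<close> is the Bochner integral of the simple function
  \<open>s\<close>. It is a finite sum, so pairing with \<open>v\<close> commutes with it by
  linearity.\<close>

lemma simple_function_inner_integral:
  fixes s :: "real \<Rightarrow> 'a \<Rightarrow> real"
  assumes s: "simple_function Mt s" "s ` {0..T} \<subseteq> L2_space \<Omega>" and v: "v \<in> L2_space \<Omega>"
  defines "I \<equiv> \<lambda>x. \<Sum>u\<in>s ` {0..T}. measure lebesgue {t \<in> {0..T}. s t = u} * u x"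
  shows "integrable Mt (\<lambda>t. \<integral>x. s t x * v x \<partial>lebesgue_on \<Omega>)"
    "(\<integral>t. (\<integral>x. s t x * v x \<partial>lebesgue_on \<Omega>) \<partial>Mt) = (\<integral>x. I x * v x \<partial>lebesgue_on \<Omega>)"
    "I \<in> L2_space \<Omega>"
proof -
  let ?R = "s ` {0..T}" and ?E = "\<lambda>u. {t \<in> {0..T}. s t = u}" and ?ip = "\<lambda>u. \<integral>x. u x * v x \<partial>lebesgue_on \<Omega>"
  have fin: "finite ?R" using simple_functionD(1)[OF s(1)] by simp
  have E: "?E u \<in> sets Mt" for u
    using simple_functionD(2)[OF s(1), of "{u}"] by (simp add: vimage_def Int_def conj_commute)
  \<comment> \<open>Only the summand for the value \<open>u = s t\<close> survives.\<close>
  have expand: "?ip (s t) = (\<Sum>u\<in>?R. ?ip u * indicator (?E u) t)" if "t \<in> space Mt" for t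
  proof -
    have "(\<Sum>u\<in>?R. ?ip u * indicator (?E u) t) = (\<Sum>u\<in>{s t}. ?ip u * indicator (?E u) t)"
      using that fin by (intro sum.mono_neutral_right) (auto simp: indicator_def)
    also have "\<dots> = ?ip (s t)"
    proof -
      have "indicator (?E (s t)) t = (1::real)" using that by (intro indicator_simps(1)) simp
      then show ?thesis by (simp only: sum.insert sum.empty finite.emptyI empty_iff simp_thms mult_1_right add_0_right)
    qed
    finally show ?thesis by (rule sym)
  qed
  have int: "integrable Mt (\<lambda>t. ?ip u * indicator (?E u) t)" for u
    using E by (intro integrable_mult_right integrable_real_indicator) (simp_all add: less_top[symmetric])
  have "integrable Mt (\<lambda>t. \<Sum>u\<in>?R. ?ip u * indicator (?E u) t)"
    by (intro Bochner_Integration.integrable_sum int)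
  then show "integrable Mt (\<lambda>t. ?ip (s t))"
    using expand by (subst Bochner_Integration.integrable_cong[OF refl]) auto
  have "(\<integral>t. ?ip (s t) \<partial>Mt) = (\<integral>t. (\<Sum>u\<in>?R. ?ip u * indicator (?E u) t) \<partial>Mt)"
    using expand by (intro Bochner_Integration.integral_cong) auto
  also have "\<dots> = (\<Sum>u\<in>?R. ?ip u * measure Mt (?E u))"
  proof (subst Bochner_Integration.integral_sum[OF int], rule sum.cong[OF refl])
    fix u
    have "?E u \<inter> space Mt = ?E u" by auto
    then show "(\<integral>t. ?ip u * indicator (?E u) t \<partial>Mt) = ?ip u * measure Mt (?E u)"
      by (simp only: integral_mult_right_zero Bochner_Integration.integral_indicator)
  qed
  also have "\<dots> = (\<Sum>u\<in>?R. \<integral>x. measure lebesgue (?E u) * u x * v x \<partial>lebesgue_on \<Omega>)"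
  proof (rule sum.cong[OF refl])
    fix u
    have "measure Mt (?E u) = measure lebesgue (?E u)" by (rule measure_restrict_space) auto
    then show "?ip u * measure Mt (?E u) = (\<integral>x. measure lebesgue (?E u) * u x * v x \<partial>lebesgue_on \<Omega>)"
      by (simp add: mult.assoc mult.commute[of _ "measure lebesgue _"])
  qed
  also have "\<dots> = (\<integral>x. (\<Sum>u\<in>?R. measure lebesgue (?E u) * u x * v x) \<partial>lebesgue_on \<Omega>)"
  proof (rule Bochner_Integration.integral_sum[symmetric])
    fix u assume "u \<in> ?R"
    then have "integrable (lebesgue_on \<Omega>) (\<lambda>x. measure lebesgue (?E u) * (u x * v x))"
      using L2_integrable_mult[OF _ v] s(2) by (intro integrable_mult_right) auto
    then show "integrable (lebesgue_on \<Omega>) (\<lambda>x. measure lebesgue (?E u) * u x * v x)"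
      by (simp add: mult.assoc)
  qed
  also have "\<dots> = (\<integral>x. I x * v x \<partial>lebesgue_on \<Omega>)"
    by (simp add: I_def sum_distrib_right)
  finally show "(\<integral>t. ?ip (s t) \<partial>Mt) = (\<integral>x. I x * v x \<partial>lebesgue_on \<Omega>)" .
  show "I \<in> L2_space \<Omega>"
    unfolding I_def
  proof (rule L2_space_sum[OF fin])
    show "(\<lambda>x. measure lebesgue (?E u) * u x) \<in> L2_space \<Omega>" if "u \<in> ?R" for u
      using L2_space_scaleR[of u \<Omega> "measure lebesgue (?E u)"] s(2) that by auto
  qed
qed

text \<open>A bounded linear functional commutes with the Bochner integral: pairing with
  \<open>v\<close> is continuous for the L^2 norm, so it passes through both limits in
  \<open>has_time_integral\<close>. Identities between functions thus become identities between real
  integrals.\<close>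

lemma has_time_integral_inner:
  assumes I: "has_time_integral T (L2_space \<Omega>) (L2_norm \<Omega>) f I" and f: "Q_measurable T \<Omega> f"
    and v: "v \<in> L2_space \<Omega>"
  shows "(\<integral>t. (\<integral>x. f t x * v x \<partial>lebesgue_on \<Omega>) \<partial>Mt) = (\<integral>x. I x * v x \<partial>lebesgue_on \<Omega>)"
proof -
  let ?ip = "\<lambda>u. \<integral>x. u x * v x \<partial>lebesgue_on \<Omega>"
  obtain s where s: "simple_approx T (L2_space \<Omega>) (L2_norm \<Omega>) f s"
    and D: "(\<lambda>n. \<integral>\<^sup>+t. ennreal (L2_norm \<Omega> (f t - s n t)) \<partial>Mt) \<longlonglongrightarrow> 0"
    and J: "(\<lambda>n. L2_norm \<Omega> (I - (\<lambda>x. \<Sum>v\<in>s n ` {0..T}. measure lebesgue {t \<in> {0..T}. s n t = v} * v x))) \<longlonglongrightarrow> 0"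
    and IL2: "I \<in> L2_space \<Omega>"
    using I by (auto simp: has_time_integral_def)
  define J where "J n = (\<lambda>x. \<Sum>v\<in>s n ` {0..T}. measure lebesgue {t \<in> {0..T}. s n t = v} * v x)" for n
  have sn: "simple_function Mt (s n)" "s n ` {0..T} \<subseteq> L2_space \<Omega>" for n
    using s by (auto simp: simple_approx_def)
  have fL2: "AE t in Mt. f t \<in> L2_space \<Omega>"
    using s by (auto simp: simple_approx_def)
  note sint = simple_function_inner_integral[OF sn v]
  have JL2: "J n \<in> L2_space \<Omega>" for n unfolding J_def by (rule sint(3))
  \<comment> \<open>Adding 1 permits division by \<open>K\<close> even when \<open>v\<close> has
    norm 0.\<close>
  define K where "K = L2_norm \<Omega> v + 1"
  have K: "K > 0" "L2_norm \<Omega> v \<le> K" by (simp_all add: K_def add_nonneg_pos)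
  define G where "G n t = (?ip (f t) - ?ip (s n t)) / K" for n t
  have fmeas: "(\<lambda>t. ?ip (f t)) \<in> borel_measurable Mt"
    using Q_measurable_inner_integral[OF f Q_measurable_const[OF L2_space_measurable[OF v]]] .
  then have Gmeas: "G n \<in> borel_measurable Mt" for n
    using borel_measurable_integrable[OF sint(1)] unfolding G_def by auto
  have Gbound: "(\<integral>\<^sup>+t. ennreal (norm (G n t)) \<partial>Mt) \<le> (\<integral>\<^sup>+t. ennreal (L2_norm \<Omega> (f t - s n t)) \<partial>Mt)" for n
  proof (rule nn_integral_mono_AE)
    show "AE t in Mt. ennreal (norm (G n t)) \<le> ennreal (L2_norm \<Omega> (f t - s n t))"
      using fL2 AE_space
    proof eventually_elim
      case (elim t)
      then have st: "s n t \<in> L2_space \<Omega>" using sn(2)[of n] by auto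
      have "?ip (f t) - ?ip (s n t) = ?ip (f t - s n t)"
        using L2_integrable_mult[OF elim(1) v] L2_integrable_mult[OF st v] by (simp add: left_diff_distrib)
      then have "\<bar>?ip (f t) - ?ip (s n t)\<bar> \<le> L2_norm \<Omega> (f t - s n t) * L2_norm \<Omega> v"
        using L2_Cauchy_Schwarz[OF L2_space_diff[OF elim(1) st] v] by simp
      also have "\<dots> \<le> L2_norm \<Omega> (f t - s n t) * K" using K by (intro mult_left_mono) auto
      finally show ?case using K by (simp add: G_def divide_le_eq)
    qed
  qed
  have Glim: "(\<lambda>n. \<integral>\<^sup>+t. ennreal (norm (G n t)) \<partial>Mt) \<longlonglongrightarrow> 0"
    by (rule tendsto_sandwich[OF _ _ tendsto_const D]) (use Gbound in auto)
  \<comment> \<open>Integrals that tend to 0 are finite from some index on. A single integrable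
    \<open>G n\<close> makes the paired \<open>f\<close> integrable, and then every
    \<open>G n\<close> is.\<close>
  have "\<forall>\<^sub>F n in sequentially. (\<integral>\<^sup>+t. ennreal (norm (G n t)) \<partial>Mt) < \<infinity>"
    using order_tendstoD(2)[OF Glim, of \<infinity>] by simp
  then have Gint: "\<forall>\<^sub>F n in sequentially. integrable Mt (G n)"
    by eventually_elim (auto intro!: integrableI_bounded Gmeas)
  then obtain n where "integrable Mt (G n)" by (auto simp: eventually_sequentially)
  then have "integrable Mt (\<lambda>t. K * G n t + ?ip (s n t))" using sint(1) by auto
  then have fint: "integrable Mt (\<lambda>t. ?ip (f t))" using K by (simp add: G_def)
  have Gint: "integrable Mt (G n)" for n
    unfolding G_def using fint sint(1) by auto
  have "(\<lambda>n. ennreal \<bar>\<integral>t. G n t \<partial>Mt\<bar>) \<longlonglongrightarrow> ennreal 0"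
    unfolding ennreal_0 by (rule tendsto_sandwich[OF _ _ tendsto_const Glim])
      (use integral_norm_bound_ennreal[OF Gint] in auto)
  then have "(\<lambda>n. \<bar>\<integral>t. G n t \<partial>Mt\<bar>) \<longlonglongrightarrow> 0"
    by (subst (asm) tendsto_ennreal_iff) auto
  then have "(\<lambda>n. K * (\<integral>t. G n t \<partial>Mt)) \<longlonglongrightarrow> K * 0"
    by (intro tendsto_mult tendsto_const) (simp add: tendsto_rabs_zero_iff)
  moreover have "K * (\<integral>t. G n t \<partial>Mt) = (\<integral>t. ?ip (f t) \<partial>Mt) - ?ip (J n)" for n
  proof -
    have "K * (\<integral>t. G n t \<partial>Mt) = (\<integral>t. ?ip (f t) \<partial>Mt) - (\<integral>t. ?ip (s n t) \<partial>Mt)"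
      using K fint sint(1) by (simp add: G_def)
    then show ?thesis by (simp only: sint(2) J_def)
  qed
  ultimately have lim1: "(\<lambda>n. (\<integral>t. ?ip (f t) \<partial>Mt) - ?ip (J n)) \<longlonglongrightarrow> 0" by simp
  have "(\<lambda>n. ?ip I - ?ip (J n)) \<longlonglongrightarrow> 0"
  proof (rule tendsto_rabs_zero_cancel, rule tendsto_sandwich[OF _ _ tendsto_const])
    show "(\<lambda>n. L2_norm \<Omega> (I - J n) * L2_norm \<Omega> v) \<longlonglongrightarrow> 0"
      using tendsto_mult_right[OF J[folded J_def], of "L2_norm \<Omega> v"] by simp
    have "\<bar>?ip I - ?ip (J n)\<bar> \<le> L2_norm \<Omega> (I - J n) * L2_norm \<Omega> v" for n
      using L2_Cauchy_Schwarz[OF L2_space_diff[OF IL2 JL2[of n]] v]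
        L2_integrable_mult[OF IL2 v] L2_integrable_mult[OF JL2[of n] v]
      by (simp add: left_diff_distrib)
    then show "\<forall>\<^sub>F n in sequentially. \<bar>?ip I - ?ip (J n)\<bar> \<le> L2_norm \<Omega> (I - J n) * L2_norm \<Omega> v" by simp
  qed simp
  from tendsto_diff[OF lim1 this]
  have "(\<lambda>n. (\<integral>t. ?ip (f t) \<partial>Mt) - ?ip I) \<longlonglongrightarrow> 0" by simp
  then show ?thesis by (simp add: LIMSEQ_const_iff)
qed

section \<open>Curves that are continuous in L^2 and their time derivatives\<close>

lemma tendsto_within_null_comparison:
  fixes f :: "real \<Rightarrow> real"
  assumes "\<And>s. s \<in> S \<Longrightarrow> \<bar>f s\<bar> \<le> g s" "(g \<longlongrightarrow> 0) (at t within S)"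
  shows "(f \<longlongrightarrow> 0) (at t within S)"
  by (rule Lim_null_comparison[OF _ assms(2)]) (auto simp: eventually_at_filter assms(1))

lemma C_L2_D:
  assumes "y \<in> C_L2 T \<Omega>" "t \<in> {0..T}"
  shows "y t \<in> L2_space \<Omega>" "((\<lambda>s. L2_norm \<Omega> (y s - y t)) \<longlongrightarrow> 0) (at t within {0..T})"
  using assms by (auto simp: C_L2_def)

lemma L2_inner_diff_le:
  fixes u w v :: "'a \<Rightarrow> real"
  assumes u: "u \<in> L2_space \<Omega>" and w: "w \<in> L2_space \<Omega>" and v: "v \<in> L2_space \<Omega>"
  shows "\<bar>(\<integral>x. u x * v x \<partial>lebesgue_on \<Omega>) - (\<integral>x. w x * v x \<partial>lebesgue_on \<Omega>)\<bar> \<le> L2_norm \<Omega> (u - w) * L2_norm \<Omega> v"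
proof -
  have "(\<integral>x. u x * v x \<partial>lebesgue_on \<Omega>) - (\<integral>x. w x * v x \<partial>lebesgue_on \<Omega>) = (\<integral>x. (u - w) x * v x \<partial>lebesgue_on \<Omega>)"
    using L2_integrable_mult[OF u v] L2_integrable_mult[OF w v] by (simp add: left_diff_distrib)
  then show ?thesis using L2_Cauchy_Schwarz[OF L2_space_diff[OF u w] v] by (simp only:)
qed

lemma C_L2_inner_continuous:
  assumes y: "y \<in> C_L2 T \<Omega>" and v: "v \<in> L2_space \<Omega>"
  shows "continuous_on {0..T} (\<lambda>t. \<integral>x. y t x * v x \<partial>lebesgue_on \<Omega>)"
  unfolding continuous_on
proof
  fix t assume t: "t \<in> {0..T}"
  note yt = C_L2_D[OF y t]
  have "((\<lambda>s. (\<integral>x. y s x * v x \<partial>lebesgue_on \<Omega>) - (\<integral>x. y t x * v x \<partial>lebesgue_on \<Omega>)) \<longlongrightarrow> 0) (at t within {0..T})"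
    by (rule tendsto_within_null_comparison[OF L2_inner_diff_le[OF C_L2_D(1)[OF y] yt(1) v] tendsto_mult_left_zero[OF yt(2)]])
  then show "((\<lambda>s. \<integral>x. y s x * v x \<partial>lebesgue_on \<Omega>) \<longlongrightarrow> (\<integral>x. y t x * v x \<partial>lebesgue_on \<Omega>)) (at t within {0..T})"
    by (rule LIM_zero_cancel)
qed

lemma C_L2_norm_continuous:
  assumes y: "y \<in> C_L2 T \<Omega>"
  shows "continuous_on {0..T} (\<lambda>t. L2_norm \<Omega> (y t))"
  unfolding continuous_on
proof
  fix t assume t: "t \<in> {0..T}"
  have "((\<lambda>s. L2_norm \<Omega> (y s) - L2_norm \<Omega> (y t)) \<longlongrightarrow> 0) (at t within {0..T})"
    by (rule tendsto_within_null_comparison[OF L2_norm_abs_diff_le[OF C_L2_D(1)[OF y] C_L2_D(1)[OF y t]] C_L2_D(2)[OF y t]])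
  then show "((\<lambda>s. L2_norm \<Omega> (y s)) \<longlongrightarrow> L2_norm \<Omega> (y t)) (at t within {0..T})" by (rule LIM_zero_cancel)
qed

lemma C_L2_diff:
  assumes y: "y \<in> C_L2 T \<Omega>" and z: "z \<in> C_L2 T \<Omega>"
  shows "(\<lambda>t. y t - z t) \<in> C_L2 T \<Omega>"
  unfolding C_L2_def
proof (intro CollectI ballI conjI)
  fix t assume t: "t \<in> {0..T}"
  note yt = C_L2_D[OF y t] and zt = C_L2_D[OF z t]
  show "y t - z t \<in> L2_space \<Omega>" using yt(1) zt(1) by (rule L2_space_diff)
  have lim: "((\<lambda>s. L2_norm \<Omega> (y s - y t) + L2_norm \<Omega> (z s - z t)) \<longlongrightarrow> 0) (at t within {0..T})"
    using yt(2) zt(2) by (rule tendsto_add_zero)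
  show "((\<lambda>s. L2_norm \<Omega> (y s - z s - (y t - z t))) \<longlongrightarrow> 0) (at t within {0..T})"
  proof (rule tendsto_within_null_comparison[OF _ lim])
    fix s assume s: "s \<in> {0..T}"
    have "y s - z s - (y t - z t) = (y s - y t) - (z s - z t)" by (auto simp: fun_eq_iff)
    then show "\<bar>L2_norm \<Omega> (y s - z s - (y t - z t))\<bar> \<le> L2_norm \<Omega> (y s - y t) + L2_norm \<Omega> (z s - z t)"
      using L2_norm_triangle_diff[OF L2_space_diff[OF C_L2_D(1)[OF y s] yt(1)] L2_space_diff[OF C_L2_D(1)[OF z s] zt(1)]]
      by simp
  qed
qed

text \<open>Paired with a fixed \<open>v\<close>, the vector-valued definition of the time
  derivative says that the pairing of \<open>y\<close> with \<open>v\<close> has the pairing of the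
  derivative with \<open>v\<close> as its weak derivative on (0, T).\<close>

lemma time_derivative_increment:
  assumes D: "has_time_derivative T \<Omega> y y\<^sub>t" and y: "y \<in> C_L2 T \<Omega>" and v: "v \<in> L2_space \<Omega>"
    and rs: "0 \<le> r" "r \<le> s" "s \<le> T"
  shows "(\<integral>x. y s x * v x \<partial>lebesgue_on \<Omega>) - (\<integral>x. y r x * v x \<partial>lebesgue_on \<Omega>)
      = (\<integral>t. indicator {r<..s} t * (\<integral>x. y\<^sub>t t x * v x \<partial>lebesgue_on \<Omega>) \<partial>Mt)"
    and "integrable Mt (\<lambda>t. \<integral>x. y\<^sub>t t x * v x \<partial>lebesgue_on \<Omega>)"
proof -
  have yt: "y\<^sub>t \<in> L2_L2 T \<Omega>" and yL: "y \<in> L2_L2 T \<Omega>" using D by (auto simp: has_time_derivative_def)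
  note [simp] = L2_space_measurable[OF v]
  show int: "integrable Mt (\<lambda>t. \<integral>x. y\<^sub>t t x * v x \<partial>lebesgue_on \<Omega>)"
    using L2_L2_D[OF yt] v by (intro integrable_inner_integral[where B = "L2_norm \<Omega> v"] Q_measurable_const) auto
  show "(\<integral>x. y s x * v x \<partial>lebesgue_on \<Omega>) - (\<integral>x. y r x * v x \<partial>lebesgue_on \<Omega>)
      = (\<integral>t. indicator {r<..s} t * (\<integral>x. y\<^sub>t t x * v x \<partial>lebesgue_on \<Omega>) \<partial>Mt)"
  proof (rule weak_derivative_FTC[OF C_L2_inner_continuous[OF y v] int _ rs T_pos])
    fix \<phi> \<phi>' assume \<phi>: "\<phi> \<in> test_functions {0<..<T}" and \<phi>': "\<And>t. (\<phi> has_real_derivative \<phi>' t) (at t)"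
    \<comment> \<open>One element \<open>I\<close> is the Bochner integral on both sides, so both
      paired integrals equal the pairing of \<open>I\<close> with \<open>v\<close>.\<close>
    obtain I where I: "has_time_integral T (L2_space \<Omega>) (L2_norm \<Omega>) (\<lambda>t x. \<phi>' t * y t x) I"
      "has_time_integral T (L2_space \<Omega>) (L2_norm \<Omega>) (\<lambda>t x. - \<phi> t * y\<^sub>t t x) I"
      using D \<phi> \<phi>' unfolding has_time_derivative_def by blast
    have "continuous_on UNIV \<phi>" by (rule test_function_continuous_bounded[OF \<phi>])
    then have m1: "(\<lambda>t. - \<phi> t) \<in> borel_measurable Mt"
      by (intro continuous_imp_measurable_on_sets_lebesgue continuous_on_minus) (auto intro: continuous_on_subset)
    have "continuous_on UNIV \<phi>'"
      by (rule test_function_gradient_continuous_bounded[OF \<phi>, of \<phi>']) (use \<phi>' in auto)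
    then have m2: "\<phi>' \<in> borel_measurable Mt"
      by (intro continuous_imp_measurable_on_sets_lebesgue) (auto intro: continuous_on_subset)
    have Q: "Q_measurable T \<Omega> (\<lambda>t x. \<phi>' t * y t x)" "Q_measurable T \<Omega> (\<lambda>t x. - \<phi> t * y\<^sub>t t x)"
      using Q_measurable_scaleR[OF m1 L2_L2_D(1)[OF yt]] Q_measurable_scaleR[OF m2 L2_L2_D(1)[OF yL]] by simp_all
    have "(\<integral>t. \<phi>' t * (\<integral>x. y t x * v x \<partial>lebesgue_on \<Omega>) \<partial>Mt) = (\<integral>x. I x * v x \<partial>lebesgue_on \<Omega>)"
      using has_time_integral_inner[OF I(1) Q(1) v] by (simp add: mult.assoc)
    moreover have "- (\<integral>t. \<phi> t * (\<integral>x. y\<^sub>t t x * v x \<partial>lebesgue_on \<Omega>) \<partial>Mt) = (\<integral>x. I x * v x \<partial>lebesgue_on \<Omega>)"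
      using has_time_integral_inner[OF I(2) Q(2) v] by (simp add: mult.assoc)
    ultimately show "(\<integral>t. \<phi>' t * (\<integral>x. y t x * v x \<partial>lebesgue_on \<Omega>) \<partial>Mt)
        = - (\<integral>t. \<phi> t * (\<integral>x. y\<^sub>t t x * v x \<partial>lebesgue_on \<Omega>) \<partial>Mt)" by simp
  qed
qed

end

section \<open>Gronwall and the energy identity\<close>

text \<open>\<open>H\<close> is the right-hand side of the integral inequality times the integrating
  factor exp(-b s). Its derivative is b exp(-b s) times the difference of the two sides of that
  inequality, hence at most 0.\<close>

lemma Gronwall_integral:
  fixes g :: "real \<Rightarrow> real"
  assumes g: "continuous_on {0..T} g" and b: "0 \<le> b" and s: "s \<in> {0..T}"
    and le: "\<And>s. s \<in> {0..T} \<Longrightarrow> g s \<le> a + b * integral {0..s} g"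
  shows "g s \<le> a * exp (b * s)"
proof -
  define H where "H s = exp (- (b * s)) * (a + b * integral {0..s} g)" for s
  have "H s \<le> H 0"
    proof (rule DERIV_nonpos_imp_decreasing_open[of 0 s H])
      show "0 \<le> s" using s by simp
      have "continuous_on {0..T} (\<lambda>s. integral {0..s} g)"
        by (intro indefinite_integral_continuous_1 integrable_continuous_real g)
      then show "continuous_on {0..s} H"
        unfolding H_def using s by (intro continuous_intros) (auto intro: continuous_on_subset)
      fix x assume x: "0 < x" "x < s"
      then have "((\<lambda>s. integral {0..s} g) has_real_derivative g x) (at x within {0..T})"
        using s by (intro integral_has_real_derivative g) auto
      moreover have "at x within {0..T} = at x" using x s by (intro at_within_Icc_at) auto
      ultimately have "((\<lambda>s. integral {0..s} g) has_real_derivative g x) (at x)" by simp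
      note this[derivative_intros]
      have "(H has_real_derivative exp (- (b * x)) * (b * (g x - (a + b * integral {0..x} g)))) (at x)"
        unfolding H_def by (auto intro!: derivative_eq_intros simp: algebra_simps)
      moreover have "exp (- (b * x)) * (b * (g x - (a + b * integral {0..x} g))) \<le> 0"
        using le[of x] x s b by (intro mult_nonneg_nonpos) auto
      ultimately show "\<exists>y. (H has_real_derivative y) (at x) \<and> y \<le> 0" by blast
    qed
  then have "exp (b * s) * H s \<le> exp (b * s) * a" by (simp add: H_def)
  moreover have "exp (b * s) * H s = a + b * integral {0..s} g" by (simp add: H_def exp_minus)
  ultimately show ?thesis using le[OF s] mult.commute[of a "exp (b * s)"] by linarith
qed

text \<open>Links the Lebesgue integrals cut off to \<open>{0<..s}\<close> in the energy estimate
  with the gauge integral over \<open>{0..s}\<close> in \<open>Gronwall_integral\<close>; the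
  endpoint 0 is negligible.\<close>

lemma integral_indicator_Ioc:
  fixes g :: "real \<Rightarrow> real"
  assumes g: "integrable (lebesgue_on {0..T}) g" and s: "s \<in> {0..T}"
  shows "(\<integral>t. indicator {0<..s} t * g t \<partial>lebesgue_on {0..T}) = integral {0..s} g"
proof -
  have "(\<integral>t. indicator {0<..s} t * g t \<partial>lebesgue_on {0..T}) = integral {0..T} (\<lambda>t. indicator {0<..s} t * g t)"
    using integrable_indicator_mult[OF g] by (intro lebesgue_integral_eq_integral) auto
  also have "\<dots> = integral {0..T} (\<lambda>t. if t \<in> {0<..s} then g t else 0)"
    by (intro arg_cong[where f = "integral {0..T}"]) (auto simp: indicator_def)
  also have "\<dots> = integral ({0..T} \<inter> {0<..s}) g"
    by (simp only: Henstock_Kurzweil_Integration.integral_restrict_Int Int_commute)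
  also have "{0..T} \<inter> {0<..s} = {0<..s}" using s by auto
  also have "integral {0<..s} g = integral {0..s} g"
    by (rule integral_spike_set) (rule negligible_subset[of "{0}"]; force)+
  finally show ?thesis .
qed

context time_cylinder
begin

text \<open>On [a, b] the increment of |w|^2 is (w(b) - w(a), w(a) + w(b)), which by
  \<open>inc\<close> is the integral of (w_t, w(a) + w(b)). Replacing w(a) and w(b) by w(t) costs at
  most twice the oscillation of \<open>w\<close> on [a, b] times the integral of |w_t|, and these
  errors add up to something small under subdivision.\<close>

lemma energy_identity:
  fixes w w\<^sub>t :: "real \<Rightarrow> 'a \<Rightarrow> real"
  assumes w: "w \<in> C_L2 T \<Omega>" "Q_measurable T \<Omega> w"
    and wt: "Q_measurable T \<Omega> w\<^sub>t" "AE t in Mt. w\<^sub>t t \<in> L2_space \<Omega>" "integrable Mt (\<lambda>t. L2_norm \<Omega> (w\<^sub>t t))"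
    and inc: "\<And>r s v. 0 \<le> r \<Longrightarrow> r \<le> s \<Longrightarrow> s \<le> T \<Longrightarrow> v \<in> L2_space \<Omega> \<Longrightarrow>
        (\<integral>x. w s x * v x \<partial>lebesgue_on \<Omega>) - (\<integral>x. w r x * v x \<partial>lebesgue_on \<Omega>)
        = (\<integral>t. indicator {r<..s} t * (\<integral>x. w\<^sub>t t x * v x \<partial>lebesgue_on \<Omega>) \<partial>Mt)"
    and s: "s \<in> {0..T}"
  shows "(L2_norm \<Omega> (w s))\<^sup>2 - (L2_norm \<Omega> (w 0))\<^sup>2
      = 2 * (\<integral>t. indicator {0<..s} t * (\<integral>x. w\<^sub>t t x * w t x \<partial>lebesgue_on \<Omega>) \<partial>Mt)"
    and "integrable Mt (\<lambda>t. \<integral>x. w\<^sub>t t x * w t x \<partial>lebesgue_on \<Omega>)"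
proof -
  let ?ip = "\<lambda>u v. \<integral>x. u x * v x \<partial>lebesgue_on \<Omega>"
  let ?N = "L2_norm \<Omega>"
  have sq: "(?N u)\<^sup>2 = ?ip u u" for u by (simp add: L2_norm_power2) (simp add: power2_eq_square)
  define p where "p t = ?ip (w\<^sub>t t) (w t)" for t
  note wL2 = C_L2_D(1)[OF w(1)]
  have "compact ((\<lambda>t. ?N (w t)) ` {0..T})"
    by (intro compact_continuous_image C_L2_norm_continuous w(1)) simp
  then obtain B where B: "\<And>t. t \<in> {0..T} \<Longrightarrow> ?N (w t) \<le> B"
    using compact_imp_bounded bounded_real by (metis abs_le_D1 imageI)
  show int: "integrable Mt (\<lambda>t. ?ip (w\<^sub>t t) (w t))"
    by (rule integrable_inner_integral[OF wt w(2), where B = B]) (use wL2 B in auto)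
  then have pint: "integrable Mt p" unfolding p_def .
  have vint: "integrable Mt (\<lambda>t. ?ip (w\<^sub>t t) v)" if "v \<in> L2_space \<Omega>" for v
    using that by (intro integrable_inner_integral[OF wt, where B = "?N v"] Q_measurable_const)
      (auto intro: L2_space_measurable)
  \<comment> \<open>\<open>\<Phi>\<close> is the defect of the identity, to be shown constant in
    time. Increments of \<open>P\<close>, the accumulated norm of the time derivative, control its
    increments and add up over adjacent intervals.\<close>
  define P where "P s = (\<integral>t. indicator {0<..s} t * ?N (w\<^sub>t t) \<partial>Mt)" for s
  define \<Phi> where "\<Phi> s = (?N (w s))\<^sup>2 - 2 * (\<integral>t. indicator {0<..s} t * p t \<partial>Mt)" for s
  have split: "(\<integral>t. indicator {0<..b} t * h t \<partial>Mt) - (\<integral>t. indicator {0<..a} t * h t \<partial>Mt)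
      = (\<integral>t. indicator {a<..b} t * h t \<partial>Mt)" if "0 \<le> a" "a \<le> b" "integrable Mt h" for a b and h :: "real \<Rightarrow> real"
  proof -
    have "indicat_real {a<..b} t = indicator {0<..b} t - indicator {0<..a} t" for t
      using that(1,2) by (auto simp: indicator_def)
    then show ?thesis
      using integrable_indicator_mult[OF that(3), of "{0<..b}"] integrable_indicator_mult[OF that(3), of "{0<..a}"]
      by (simp add: left_diff_distrib)
  qed
  have close: "\<bar>\<Phi> b - \<Phi> a\<bar> \<le> 2 * e * (P b - P a)"
    if ab: "0 \<le> a" "a \<le> b" "b \<le> T" and osc: "\<And>t. t \<in> {a..b} \<Longrightarrow> ?N (w a - w t) \<le> e"
      "\<And>t. t \<in> {a..b} \<Longrightarrow> ?N (w b - w t) \<le> e" for a b e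
  proof -
    have aT: "a \<in> {0..T}" and bT: "b \<in> {0..T}" using ab by auto
    note wa = wL2[OF aT] and wb = wL2[OF bT]
    let ?d = "\<lambda>t. (?ip (w\<^sub>t t) (w a) - p t) + (?ip (w\<^sub>t t) (w b) - p t)"
    have dint: "integrable Mt ?d" using vint[OF wa] vint[OF wb] pint by auto
    \<comment> \<open>The product is split so that each increment is paired with a fixed element,
      \<open>w a\<close> or \<open>w b\<close>, as \<open>inc\<close> requires.\<close>
    have "(?N (w b))\<^sup>2 - (?N (w a))\<^sup>2 = (?ip (w b) (w a) - ?ip (w a) (w a)) + (?ip (w b) (w b) - ?ip (w a) (w b))"
      by (simp add: sq mult.commute)
    also have "\<dots> = (\<integral>t. indicator {a<..b} t * ?ip (w\<^sub>t t) (w a) \<partial>Mt) + (\<integral>t. indicator {a<..b} t * ?ip (w\<^sub>t t) (w b) \<partial>Mt)"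
      using inc[OF ab wa] inc[OF ab wb] by simp
    finally have sq_diff: "(?N (w b))\<^sup>2 - (?N (w a))\<^sup>2
      = (\<integral>t. indicator {a<..b} t * ?ip (w\<^sub>t t) (w a) \<partial>Mt) + (\<integral>t. indicator {a<..b} t * ?ip (w\<^sub>t t) (w b) \<partial>Mt)" .
    have "(\<integral>t. indicator {a<..b} t * ?d t \<partial>Mt)
        = (\<integral>t. indicator {a<..b} t * ?ip (w\<^sub>t t) (w a) + indicator {a<..b} t * ?ip (w\<^sub>t t) (w b)
            - 2 * (indicator {a<..b} t * p t) \<partial>Mt)"
      by (intro Bochner_Integration.integral_cong refl) (simp add: algebra_simps)
    also have "\<dots> = (\<integral>t. indicator {a<..b} t * ?ip (w\<^sub>t t) (w a) \<partial>Mt)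
        + (\<integral>t. indicator {a<..b} t * ?ip (w\<^sub>t t) (w b) \<partial>Mt) - 2 * (\<integral>t. indicator {a<..b} t * p t \<partial>Mt)"
      using integrable_indicator_mult[OF vint[OF wa], of "{a<..b}"]
        integrable_indicator_mult[OF vint[OF wb], of "{a<..b}"] integrable_indicator_mult[OF pint, of "{a<..b}"]
      by simp
    also have "\<dots> = \<Phi> b - \<Phi> a"
      using split[OF ab(1,2) pint] sq_diff unfolding \<Phi>_def by linarith
    finally have "\<bar>\<Phi> b - \<Phi> a\<bar> = \<bar>\<integral>t. indicator {a<..b} t * ?d t \<partial>Mt\<bar>" by (simp only:)
    also have "\<dots> \<le> (\<integral>t. \<bar>indicator {a<..b} t * ?d t\<bar> \<partial>Mt)" by (rule integral_abs_bound)
    also have "\<dots> \<le> (\<integral>t. 2 * e * (indicator {a<..b} t * ?N (w\<^sub>t t)) \<partial>Mt)"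
    proof (rule integral_mono_AE)
      show "integrable Mt (\<lambda>t. \<bar>indicator {a<..b} t * ?d t\<bar>)"
        using integrable_indicator_mult[OF dint, of "{a<..b}"] by (intro integrable_abs) simp
      show "integrable Mt (\<lambda>t. 2 * e * (indicator {a<..b} t * ?N (w\<^sub>t t)))"
        using integrable_indicator_mult[OF wt(3), of "{a<..b}"] by (intro integrable_mult_right) simp
      show "AE t in Mt. \<bar>indicator {a<..b} t * ?d t\<bar> \<le> 2 * e * (indicator {a<..b} t * ?N (w\<^sub>t t))"
        using wt(2)
      proof eventually_elim
        case (elim t)
        show ?case
        proof (cases "t \<in> {a<..b}")
          case True
          then have t: "t \<in> {a..b}" "t \<in> {0..T}" using ab by auto
          have "\<bar>?ip (w\<^sub>t t) (w c) - p t\<bar> \<le> e * ?N (w\<^sub>t t)" if "c \<in> {0..T}" "?N (w c - w t) \<le> e" for c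
          proof -
            have "\<bar>?ip (w\<^sub>t t) (w c) - p t\<bar> \<le> ?N (w c - w t) * ?N (w\<^sub>t t)"
              using L2_inner_diff_le[OF wL2[OF that(1)] wL2[OF t(2)] elim] by (simp add: p_def mult.commute)
            also have "\<dots> \<le> e * ?N (w\<^sub>t t)" using that by (intro mult_right_mono) auto
            finally show ?thesis .
          qed
          from this[OF aT osc(1)[OF t(1)]] this[OF bT osc(2)[OF t(1)]]
          show ?thesis using True by simp
        qed simp
      qed
    qed
    also have "\<dots> = 2 * e * (P b - P a)"
      using split[OF ab(1,2) wt(3)] by (simp add: P_def)
    finally show ?thesis .
  qed
  \<comment> \<open>\<open>w\<close> takes values in a seminormed function space rather than in a metric type; Bolzano's
    interval induction stands in for its uniform continuity.\<close>
  have le: "\<bar>\<Phi> s - \<Phi> 0\<bar> \<le> e * (P s - P 0)" if "e > 0" for e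
  proof -
    have "0 \<le> (0::real) \<and> s \<le> T \<longrightarrow> \<bar>\<Phi> s - \<Phi> 0\<bar> \<le> e * (P s - P 0)"
    \<comment> \<open>The guard \<open>0 \<le> a \<and> b \<le> T\<close> belongs to the predicate
      because the induction also asks about short intervals that reach beyond
      \<open>{0..T}\<close>.\<close>
    proof (rule Bolzano[of 0 s "\<lambda>a b. 0 \<le> a \<and> b \<le> T \<longrightarrow> \<bar>\<Phi> b - \<Phi> a\<bar> \<le> e * (P b - P a)"])
      show "0 \<le> s" using s by simp
      fix a b c assume "0 \<le> a \<and> b \<le> T \<longrightarrow> \<bar>\<Phi> b - \<Phi> a\<bar> \<le> e * (P b - P a)"
        "0 \<le> b \<and> c \<le> T \<longrightarrow> \<bar>\<Phi> c - \<Phi> b\<bar> \<le> e * (P c - P b)" "a \<le> b" "b \<le> c"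
      then show "0 \<le> a \<and> c \<le> T \<longrightarrow> \<bar>\<Phi> c - \<Phi> a\<bar> \<le> e * (P c - P a)"
        by (auto simp: right_diff_distrib)
    next
      fix x assume "0 \<le> x" "x \<le> s"
      then have x: "x \<in> {0..T}" using s by auto
      have "\<forall>\<^sub>F t in at x within {0..T}. ?N (w t - w x) < e / 4"
        using order_tendstoD(2)[OF C_L2_D(2)[OF w(1) x], of "e / 4"] \<open>e > 0\<close> by simp
      then obtain d where d: "d > 0" "\<And>t. t \<in> {0..T} \<Longrightarrow> t \<noteq> x \<Longrightarrow> \<bar>t - x\<bar> < d \<Longrightarrow> ?N (w t - w x) < e / 4"
        unfolding eventually_at by (auto simp: dist_real_def)
      have near: "?N (w t - w x) \<le> e / 4" if "t \<in> {0..T}" "\<bar>t - x\<bar> < d" for t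
        using d(2)[OF that(1) _ that(2)] \<open>e > 0\<close> by (cases "t = x") (auto simp: L2_norm_def)
      have "\<bar>\<Phi> b - \<Phi> a\<bar> \<le> e * (P b - P a)" if "a \<le> x" "x \<le> b" "b - a < d" "0 \<le> a" "b \<le> T" for a b
      proof -
        \<comment> \<open>Two distances to \<open>w x\<close> of at most e/4 give oscillation e/2,
          and the factor 2 in \<open>close\<close> restores e.\<close>
        have osc: "?N (w c - w t) \<le> e / 2" if "c \<in> {a..b}" "t \<in> {a..b}" for c t
        proof -
          have T: "c \<in> {0..T}" "t \<in> {0..T}" and dist: "\<bar>c - x\<bar> < d" "\<bar>t - x\<bar> < d"
            using that \<open>a \<le> x\<close> \<open>x \<le> b\<close> \<open>b - a < d\<close> \<open>0 \<le> a\<close> \<open>b \<le> T\<close> by auto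
          have "w c - w t = (w c - w x) - (w t - w x)" by (auto simp: fun_eq_iff)
          then show ?thesis
            using L2_norm_triangle_diff[OF L2_space_diff[OF wL2[OF T(1)] wL2[OF x]] L2_space_diff[OF wL2[OF T(2)] wL2[OF x]]]
              near[OF T(1) dist(1)] near[OF T(2) dist(2)] by simp
        qed
        have "\<bar>\<Phi> b - \<Phi> a\<bar> \<le> 2 * (e / 2) * (P b - P a)"
          using that by (intro close osc) auto
        then show ?thesis by simp
      qed
      then show "\<exists>d>0. \<forall>a b. a \<le> x \<and> x \<le> b \<and> b - a < d \<longrightarrow> 0 \<le> a \<and> b \<le> T \<longrightarrow> \<bar>\<Phi> b - \<Phi> a\<bar> \<le> e * (P b - P a)"
        using d(1) by blast
    qed
    then show ?thesis using s by simp
  qed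
  have "\<Phi> s = \<Phi> 0"
  proof (rule ccontr)
    assume "\<Phi> s \<noteq> \<Phi> 0"
    \<comment> \<open>With e = D / (2 K) the bound would make the positive defect \<open>D\<close>
      at most half of itself; the summand 1 keeps \<open>K\<close> positive.\<close>
    define D K where "D = \<bar>\<Phi> s - \<Phi> 0\<bar>" and "K = \<bar>P s - P 0\<bar> + 1"
    have D: "D > 0" using \<open>\<Phi> s \<noteq> \<Phi> 0\<close> by (simp add: D_def)
    have K: "K > 0" by (simp add: K_def)
    have "D \<le> D / (2 * K) * (P s - P 0)" unfolding D_def[symmetric] using le[of "D / (2 * K)"] D K by (simp add: D_def)
    also have "\<dots> \<le> D / (2 * K) * K" using D K by (intro mult_left_mono) (auto simp: K_def)
    also have "\<dots> = D / 2" using K by simp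
    finally show False using D by simp
  qed
  then show "(?N (w s))\<^sup>2 - (?N (w 0))\<^sup>2 = 2 * (\<integral>t. indicator {0<..s} t * ?ip (w\<^sub>t t) (w t) \<partial>Mt)"
    by (simp add: \<Phi>_def p_def)
qed

end

section \<open>Measurability and integrability on the cylinder\<close>

text \<open>Completeness of Lebesgue measure: the limit is measurable once it is set to 0 on the
  exceptional null set \<open>N\<close>, and changes on a null set preserve Lebesgue
  measurability.\<close>

lemma borel_measurable_AE_limit:
  fixes f :: "'a::euclidean_space \<Rightarrow> real"
  assumes S: "S \<in> sets lebesgue" and g: "\<And>n. g n \<in> borel_measurable (lebesgue_on S)"
    and lim: "AE t in lebesgue_on S. (\<lambda>n. g n t) \<longlonglongrightarrow> f t"
  shows "f \<in> borel_measurable (lebesgue_on S)"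
proof -
  define N where "N = {t. \<not> (t \<in> S \<longrightarrow> (\<lambda>n. g n t) \<longlonglongrightarrow> f t)}"
  have "AE t in lebesgue. t \<in> S \<longrightarrow> (\<lambda>n. g n t) \<longlonglongrightarrow> f t"
    using lim S by (subst (asm) AE_restrict_space_iff) simp_all
  then have N: "N \<in> null_sets lebesgue" "{t \<in> S. \<not> (\<lambda>n. g n t) \<longlonglongrightarrow> f t} \<subseteq> N"
    unfolding completion.AE_iff_null_sets N_def by auto
  define h where "h t = (if t \<in> S then if t \<in> N then 0 else f t else 0)" for t
  have meas: "(\<lambda>t. if t \<in> S then g n t else 0) \<in> borel_measurable lebesgue" for n
    using g S by (simp add: borel_measurable_if)
  have "N \<in> sets lebesgue" using N by auto
  have "h \<in> borel_measurable lebesgue"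
  proof (rule borel_measurable_LIMSEQ_real)
    show "(\<lambda>t. if t \<in> N then 0 else if t \<in> S then g n t else 0) \<in> borel_measurable lebesgue" for n
      by (rule measurable_If_set[OF _ meas]) (use \<open>N \<in> sets lebesgue\<close> in auto)
    show "(\<lambda>n. if t \<in> N then 0 else if t \<in> S then g n t else 0) \<longlonglongrightarrow> h t" for t
      using N(2) by (auto simp: h_def)
  qed
  moreover have "AE t in lebesgue. h t = (if t \<in> S then f t else 0)"
    using AE_not_in[OF N(1)] by eventually_elim (simp add: h_def)
  ultimately have "(\<lambda>t. if t \<in> S then f t else 0) \<in> borel_measurable lebesgue"
    by (rule borel_measurable_AE)
  then show ?thesis using S by (simp add: borel_measurable_if)
qed

lemma simple_approxD:
  assumes "simple_approx T X N f s"
  shows "simple_function (lebesgue_on {0..T}) (s n)" "t \<in> {0..T} \<Longrightarrow> s n t \<in> X"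
    "AE t in lebesgue_on {0..T}. f t \<in> X \<and> (\<lambda>n. N (f t - s n t)) \<longlonglongrightarrow> 0"
  using assms by (auto simp only: simple_approx_def)

lemma LIMSEQ_null_comparison:
  fixes f :: "nat \<Rightarrow> real"
  assumes "g \<longlonglongrightarrow> 0" "\<And>n. \<bar>f n\<bar> \<le> g n"
  shows "f \<longlonglongrightarrow> 0"
  by (rule Lim_null_comparison[OF _ assms(1)]) (simp add: assms(2))

lemma strongly_measurable_diff:
  fixes f g :: "real \<Rightarrow> 'a \<Rightarrow> real"
  assumes f: "strongly_measurable T X N f" and g: "strongly_measurable T X N g"
    and X: "\<And>u v. u \<in> X \<Longrightarrow> v \<in> X \<Longrightarrow> u - v \<in> X"
    and N: "\<And>u v. u \<in> X \<Longrightarrow> v \<in> X \<Longrightarrow> N (u - v) \<le> N u + N v" "\<And>u. 0 \<le> N u"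
  shows "strongly_measurable T X N (\<lambda>t. f t - g t)"
proof -
  obtain r s where r: "simple_approx T X N f r" and s: "simple_approx T X N g s"
    using f g by (auto simp: strongly_measurable_def)
  have "simple_approx T X N (\<lambda>t. f t - g t) (\<lambda>n t. r n t - s n t)"
    unfolding simple_approx_def
  proof (intro conjI allI)
    show "simple_function (lebesgue_on {0..T}) (\<lambda>t. r n t - s n t)" for n
      using simple_approxD(1)[OF r] simple_approxD(1)[OF s] by (rule simple_function_compose2)
    show "(\<lambda>t. r n t - s n t) ` {0..T} \<subseteq> X" for n
      by (intro image_subsetI X simple_approxD(2)[OF r] simple_approxD(2)[OF s])
    from simple_approxD(3)[OF r] simple_approxD(3)[OF s]
    show "AE t in lebesgue_on {0..T}. f t - g t \<in> X \<and> (\<lambda>n. N (f t - g t - (r n t - s n t))) \<longlonglongrightarrow> 0"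
      using AE_space
    proof eventually_elim
      case (elim t)
      then have "t \<in> {0..T}" by simp
      note t = simple_approxD(2)[OF r this] simple_approxD(2)[OF s this]
      have "(\<lambda>n. N (f t - r n t) + N (g t - s n t)) \<longlonglongrightarrow> 0"
        using elim by (intro tendsto_add_zero) simp_all
      moreover have "\<bar>N (f t - g t - (r n t - s n t))\<bar> \<le> N (f t - r n t) + N (g t - s n t)" for n
      proof -
        have "f t - g t - (r n t - s n t) = (f t - r n t) - (g t - s n t)" by (auto simp: fun_eq_iff)
        then show ?thesis
          using N(1)[OF X[OF conjunct1[OF elim(1)] t(1)] X[OF conjunct1[OF elim(2)] t(2)]] N(2) by simp
      qed
      ultimately have "(\<lambda>n. N (f t - g t - (r n t - s n t))) \<longlonglongrightarrow> 0"
        by (rule LIMSEQ_null_comparison)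
      then show ?case using X[OF conjunct1[OF elim(1)] conjunct1[OF elim(2)]] by (rule conjI[rotated])
    qed
  qed
  then show ?thesis by (auto simp: strongly_measurable_def)
qed

text \<open>Serves to make a cut-off in time an admissible test function. Multiplication by an
  indicator keeps the approximants simple, and outside \<open>A\<close> everything is the zero
  function.\<close>

lemma strongly_measurable_indicator:
  fixes f :: "real \<Rightarrow> 'a \<Rightarrow> real"
  assumes f: "strongly_measurable T X N f" and A: "A \<in> sets borel"
    and X: "(\<lambda>x. 0) \<in> X" "N (\<lambda>x. 0) = 0"
  shows "strongly_measurable T X N (\<lambda>t x. indicator A t * f t x)"
proof -
  obtain s where s: "simple_approx T X N f s"
    using f by (auto simp: strongly_measurable_def)
  have mult: "(\<lambda>x. indicat_real A t * u x) = (if t \<in> A then u else (\<lambda>x. 0))" for t and u :: "'a \<Rightarrow> real"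
    by (auto simp: indicator_def)
  have sA: "simple_function (lebesgue_on {0..T}) (indicat_real A)"
  proof -
    have "A \<inter> {0..T} \<in> sets (lebesgue_on {0..T})"
      unfolding sets_restrict_space using A
      by (intro image_eqI[of _ _ A]) (simp_all add: Int_commute sets_completionI_sets)
    then have "simple_function (lebesgue_on {0..T}) (indicat_real (A \<inter> {0..T}))"
      by (rule simple_function_indicator)
    then show ?thesis by (subst simple_function_cong[of _ _ "indicat_real (A \<inter> {0..T})"]) (auto simp: indicator_def)
  qed
  have "simple_approx T X N (\<lambda>t x. indicator A t * f t x) (\<lambda>n t x. indicator A t * s n t x)"
    unfolding simple_approx_def
  proof (intro conjI allI)
    show "simple_function (lebesgue_on {0..T}) (\<lambda>t x. indicator A t * s n t x)" for n
      by (rule simple_function_compose2[where h = "\<lambda>k u x. k * u x", OF sA simple_approxD(1)[OF s]])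
    show "(\<lambda>t x. indicator A t * s n t x) ` {0..T} \<subseteq> X" for n
      using simple_approxD(2)[OF s] X(1) unfolding mult by (intro image_subsetI) simp
    from simple_approxD(3)[OF s] show "AE t in lebesgue_on {0..T}. (\<lambda>x. indicator A t * f t x) \<in> X \<and>
        (\<lambda>n. N ((\<lambda>x. indicator A t * f t x) - (\<lambda>x. indicator A t * s n t x))) \<longlonglongrightarrow> 0"
      by eventually_elim (use X in \<open>auto simp: mult fun_diff_def\<close>)
  qed
  then show ?thesis by (auto simp: strongly_measurable_def)
qed

context time_cylinder
begin

text \<open>A supremum over an uncountable family gives no measurability directly. Along simple
  functions there is nothing to prove, and \<open>H1_dual_norm_abs_diff\<close> passes measurability
  to the limit.\<close>

lemma H1_dual_norm_measurable:
  assumes "strongly_measurable T (L2_space \<Omega>) (L2_norm \<Omega>) u"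
  shows "(\<lambda>t. H1_dual_norm \<Omega> (u t)) \<in> borel_measurable Mt"
proof -
  obtain s where s: "simple_approx T (L2_space \<Omega>) (L2_norm \<Omega>) u s"
    using assms by (auto simp: strongly_measurable_def)
  show ?thesis
  proof (rule borel_measurable_AE_limit)
    show "(\<lambda>t. H1_dual_norm \<Omega> (s n t)) \<in> borel_measurable Mt" for n
      by (rule borel_measurable_simple_function[OF simple_function_compose1[OF simple_approxD(1)[OF s]]])
    from simple_approxD(3)[OF s] show "AE t in Mt. (\<lambda>n. H1_dual_norm \<Omega> (s n t)) \<longlonglongrightarrow> H1_dual_norm \<Omega> (u t)"
      using AE_space
    proof eventually_elim
      case (elim t)
      then have "t \<in> {0..T}" by simp
      then have "\<bar>H1_dual_norm \<Omega> (s n t) - H1_dual_norm \<Omega> (u t)\<bar> \<le> L2_norm \<Omega> (u t - s n t)" for n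
        using H1_dual_norm_abs_diff[OF conjunct1[OF elim(1)] simple_approxD(2)[OF s]]
        by (simp add: abs_minus_commute)
      then have "(\<lambda>n. H1_dual_norm \<Omega> (s n t) - H1_dual_norm \<Omega> (u t)) \<longlonglongrightarrow> 0"
        by (rule LIMSEQ_null_comparison[OF conjunct2[OF elim(1)]])
      then show ?case by (rule LIM_zero_cancel)
    qed
  qed simp
qed

section \<open>Fubini for square-integrable fields on the cylinder\<close>

lemma integrable_Q_norm_power2:
  fixes f :: "real \<Rightarrow> 'a \<Rightarrow> 'b::euclidean_space"
  assumes f: "Q_measurable T \<Omega> f" "AE t in Mt. f t \<in> L2_space \<Omega>" "integrable Mt (\<lambda>t. (L2_norm \<Omega> (f t))\<^sup>2)"
  shows "integrable (Mt \<Otimes>\<^sub>M lebesgue_on \<Omega>) (\<lambda>p. (norm (f (fst p) (snd p)))\<^sup>2)"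
proof (rule Q.Fubini_integrable)
  note [measurable] = f(1)[unfolded Q_measurable_iff]
  show "(\<lambda>p. (norm (f (fst p) (snd p)))\<^sup>2) \<in> borel_measurable (Mt \<Otimes>\<^sub>M lebesgue_on \<Omega>)" by measurable
  show "integrable Mt (\<lambda>t. \<integral>x. norm ((norm (f (fst (t, x)) (snd (t, x))))\<^sup>2) \<partial>lebesgue_on \<Omega>)"
    using f(3) by (simp add: L2_norm_power2)
  show "AE t in Mt. integrable (lebesgue_on \<Omega>) (\<lambda>x. (norm (f (fst (t, x)) (snd (t, x))))\<^sup>2)"
    using f(2) by eventually_elim (simp add: L2_space_integrable)
qed

lemma integrable_Q_inner:
  fixes f g :: "real \<Rightarrow> 'a \<Rightarrow> 'b::euclidean_space"
  assumes f: "Q_measurable T \<Omega> f" "AE t in Mt. f t \<in> L2_space \<Omega>" "integrable Mt (\<lambda>t. (L2_norm \<Omega> (f t))\<^sup>2)"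
    and g: "Q_measurable T \<Omega> g" "AE t in Mt. g t \<in> L2_space \<Omega>" "integrable Mt (\<lambda>t. (L2_norm \<Omega> (g t))\<^sup>2)"
  shows "integrable (Q_measure T \<Omega>) (\<lambda>(t, x). f t x \<bullet> g t x)"
    "(\<integral>(t, x). f t x \<bullet> g t x \<partial>Q_measure T \<Omega>) = (\<integral>t. (\<integral>x. f t x \<bullet> g t x \<partial>lebesgue_on \<Omega>) \<partial>Mt)"
proof -
  note [measurable] = f(1)[unfolded Q_measurable_iff] g(1)[unfolded Q_measurable_iff]
  have "integrable (Mt \<Otimes>\<^sub>M lebesgue_on \<Omega>) (\<lambda>p. f (fst p) (snd p) \<bullet> g (fst p) (snd p))"
  proof (rule Bochner_Integration.integrable_bound)
    show "integrable (Mt \<Otimes>\<^sub>M lebesgue_on \<Omega>) (\<lambda>p. (norm (f (fst p) (snd p)))\<^sup>2 + (norm (g (fst p) (snd p)))\<^sup>2)"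
      by (intro Bochner_Integration.integrable_add integrable_Q_norm_power2 f g)
    have "\<bar>a \<bullet> b\<bar> \<le> (norm a)\<^sup>2 + (norm b)\<^sup>2" for a b :: 'b
      using Cauchy_Schwarz_ineq2[of a b] sum_squares_bound[of "norm a" "norm b"]
        mult_nonneg_nonneg[OF norm_ge_zero[of a] norm_ge_zero[of b]] by linarith
    then show "AE p in Mt \<Otimes>\<^sub>M lebesgue_on \<Omega>. norm (f (fst p) (snd p) \<bullet> g (fst p) (snd p))
        \<le> norm ((norm (f (fst p) (snd p)))\<^sup>2 + (norm (g (fst p) (snd p)))\<^sup>2)"
      by (intro AE_I2) simp
  qed measurable
  then have int: "integrable (Mt \<Otimes>\<^sub>M lebesgue_on \<Omega>) (\<lambda>(t, x). f t x \<bullet> g t x)"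
    by (simp add: case_prod_beta')
  then show "integrable (Q_measure T \<Omega>) (\<lambda>(t, x). f t x \<bullet> g t x)" by (simp add: Q_measure_def)
  show "(\<integral>(t, x). f t x \<bullet> g t x \<partial>Q_measure T \<Omega>) = (\<integral>t. (\<integral>x. f t x \<bullet> g t x \<partial>lebesgue_on \<Omega>) \<partial>Mt)"
    using Q.integral_fst[OF int] by (simp add: Q_measure_def)
qed

lemma Linf_H1_gradient:
  assumes y: "y \<in> Linf_H1 T \<Omega>" and G: "has_space_gradient T \<Omega> y G"
  shows "AE t in Mt. G t \<in> L2_space \<Omega>" "\<exists>K. AE t in Mt. L2_norm \<Omega> (G t) \<le> K"
    "integrable Mt (\<lambda>t. (L2_norm \<Omega> (G t))\<^sup>2)"
proof -
  have grad: "AE t in Mt. has_weak_gradient \<Omega> (y t) (G t)" and meas: "Q_measurable T \<Omega> G"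
    using G by (auto simp: has_space_gradient_def)
  then show "AE t in Mt. G t \<in> L2_space \<Omega>" by (auto simp: has_weak_gradient_def)
  obtain K where K: "AE t in Mt. H1_norm \<Omega> (y t) \<le> K" using y by (auto simp: Linf_H1_def)
  have bound: "AE t in Mt. L2_norm \<Omega> (G t) \<le> K"
    using grad K
  proof eventually_elim
    case (elim t)
    have "(L2_norm \<Omega> (G t))\<^sup>2 \<le> (H1_norm \<Omega> (y t))\<^sup>2" using H1_norm_power2[OF elim(1)] by simp
    then have "L2_norm \<Omega> (G t) \<le> H1_norm \<Omega> (y t)" by (rule power2_le_imp_le) simp
    then show ?case using elim by simp
  qed
  then show "\<exists>K. AE t in Mt. L2_norm \<Omega> (G t) \<le> K" by blast
  note [measurable] = Q_measurable_L2_norm[OF meas]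
  show "integrable Mt (\<lambda>t. (L2_norm \<Omega> (G t))\<^sup>2)"
  proof (rule time.integrable_const_bound)
    show "AE t in Mt. norm ((L2_norm \<Omega> (G t))\<^sup>2) \<le> K\<^sup>2"
      using bound by eventually_elim (simp add: power_mono)
  qed measurable
qed

lemma L2_space_of_norm_bound:
  fixes f g :: "'a \<Rightarrow> 'b::euclidean_space"
  assumes "g \<in> L2_space \<Omega>" "f \<in> borel_measurable (lebesgue_on \<Omega>)" "\<And>x. norm (f x) \<le> k * norm (g x)"
  shows "f \<in> L2_space \<Omega>" "(L2_norm \<Omega> f)\<^sup>2 \<le> k\<^sup>2 * (L2_norm \<Omega> g)\<^sup>2"
proof -
  have le: "(norm (f x))\<^sup>2 \<le> k\<^sup>2 * (norm (g x))\<^sup>2" for x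
    using power_mono[OF assms(3)[of x], of 2] by (simp add: power_mult_distrib)
  have int: "integrable (lebesgue_on \<Omega>) (\<lambda>x. k\<^sup>2 * (norm (g x))\<^sup>2)"
    using L2_space_integrable[OF assms(1)] by simp
  then have "integrable (lebesgue_on \<Omega>) (\<lambda>x. (norm (f x))\<^sup>2)"
    by (rule Bochner_Integration.integrable_bound) (use assms(2) le in auto)
  then show "f \<in> L2_space \<Omega>" using assms(2) by (intro L2_spaceI)
  then show "(L2_norm \<Omega> f)\<^sup>2 \<le> k\<^sup>2 * (L2_norm \<Omega> g)\<^sup>2"
    using integral_mono[OF L2_space_integrable int le] by (simp add: L2_norm_power2)
qed

text \<open>Collects what Fubini asks for, also for vector-valued fields such as gradients, for
  which \<open>L2_L2\<close> is not defined.\<close>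

definition Q_L2 :: "(real \<Rightarrow> 'a \<Rightarrow> 'b::euclidean_space) set" where
  "Q_L2 = {y. Q_measurable T \<Omega> y \<and> (AE t in Mt. y t \<in> L2_space \<Omega>) \<and> integrable Mt (\<lambda>t. (L2_norm \<Omega> (y t))\<^sup>2)}"

lemma Q_L2_D:
  assumes "y \<in> Q_L2"
  shows "Q_measurable T \<Omega> y" "AE t in Mt. y t \<in> L2_space \<Omega>" "integrable Mt (\<lambda>t. (L2_norm \<Omega> (y t))\<^sup>2)"
  using assms by (simp_all add: Q_L2_def)

lemma L2_L2_imp_Q_L2: "y \<in> L2_L2 T \<Omega> \<Longrightarrow> y \<in> Q_L2"
  using L2_L2_D[of y] by (simp add: Q_L2_def)

lemma Q_L2_diff:
  assumes y: "y \<in> Q_L2" and z: "z \<in> Q_L2"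
  shows "(\<lambda>t. y t - z t) \<in> Q_L2"
proof -
  note yD = Q_L2_D[OF y] and zD = Q_L2_D[OF z]
  have meas: "Q_measurable T \<Omega> (\<lambda>t. y t - z t)" using yD(1) zD(1) by (rule Q_measurable_diff)
  have L2: "AE t in Mt. y t - z t \<in> L2_space \<Omega>"
    using yD(2) zD(2) by eventually_elim (rule L2_space_diff)
  have "integrable Mt (\<lambda>t. (L2_norm \<Omega> (y t - z t))\<^sup>2)"
  proof (rule Bochner_Integration.integrable_bound)
    show "integrable Mt (\<lambda>t. 2 * (L2_norm \<Omega> (y t))\<^sup>2 + 2 * (L2_norm \<Omega> (z t))\<^sup>2)"
      using yD(3) zD(3) by simp
    show "(\<lambda>t. (L2_norm \<Omega> (y t - z t))\<^sup>2) \<in> borel_measurable Mt"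
      using Q_measurable_L2_norm[OF meas] by simp
    show "AE t in Mt. norm ((L2_norm \<Omega> (y t - z t))\<^sup>2) \<le> norm (2 * (L2_norm \<Omega> (y t))\<^sup>2 + 2 * (L2_norm \<Omega> (z t))\<^sup>2)"
      using yD(2) zD(2)
    proof eventually_elim
      case (elim t)
      have "(L2_norm \<Omega> (y t - z t))\<^sup>2 \<le> (L2_norm \<Omega> (y t) + L2_norm \<Omega> (z t))\<^sup>2"
        using elim by (intro power_mono L2_norm_triangle_diff) auto
      also have "\<dots> \<le> 2 * (L2_norm \<Omega> (y t))\<^sup>2 + 2 * (L2_norm \<Omega> (z t))\<^sup>2"
        using norm_add_power2_le[of "L2_norm \<Omega> (y t)" "L2_norm \<Omega> (z t)"] by simp
      finally show ?case by simp
    qed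
  qed
  then show ?thesis using meas L2 by (simp add: Q_L2_def)
qed

lemma Q_L2_indicator:
  assumes y: "y \<in> Q_L2" and A: "A \<in> sets borel"
  shows "(\<lambda>t x. indicat_real A t *\<^sub>R y t x) \<in> Q_L2"
proof -
  have "(\<lambda>t. (L2_norm \<Omega> (\<lambda>x. indicat_real A t *\<^sub>R y t x))\<^sup>2) = (\<lambda>t. indicator A t * (L2_norm \<Omega> (y t))\<^sup>2)"
    by (auto simp: L2_norm_scaleR indicator_def)
  then show ?thesis
    using Q_L2_D[OF y] A integrable_indicator_mult[of "{0..T}" "\<lambda>t. (L2_norm \<Omega> (y t))\<^sup>2" A]
    by (auto simp: Q_L2_def intro!: Q_measurable_scaleR indicator_measurable_lebesgue_on
        elim!: eventually_mono L2_space_scaleR)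
qed

lemma Q_L2_inner:
  fixes f g :: "real \<Rightarrow> 'a \<Rightarrow> 'b::euclidean_space"
  assumes "f \<in> Q_L2" "g \<in> Q_L2"
  shows "integrable (Q_measure T \<Omega>) (\<lambda>p. f (fst p) (snd p) \<bullet> g (fst p) (snd p))"
    "(\<integral>p. f (fst p) (snd p) \<bullet> g (fst p) (snd p) \<partial>Q_measure T \<Omega>) = (\<integral>t. (\<integral>x. f t x \<bullet> g t x \<partial>lebesgue_on \<Omega>) \<partial>Mt)"
  using integrable_Q_inner[OF Q_L2_D[OF assms(1)] Q_L2_D[OF assms(2)]] by (simp_all only: case_prod_beta')

text \<open>Meant for \<open>F = A'\<close>: linear growth keeps the flux A'(\<nabla>y)
  square-integrable on the cylinder.\<close>

lemma Q_L2_compose: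
  fixes G :: "real \<Rightarrow> 'a \<Rightarrow> 'b::euclidean_space" and F :: "'b \<Rightarrow> 'b"
  assumes G: "G \<in> Q_L2" and F: "continuous_on UNIV F" "\<And>p. norm (F p) \<le> k * norm p"
  shows "(\<lambda>t x. F (G t x)) \<in> Q_L2"
proof -
  note GD = Q_L2_D[OF G]
  have [measurable]: "F \<in> borel_measurable borel" using F(1) by (rule borel_measurable_continuous_onI)
  note [measurable] = GD(1)[unfolded Q_measurable_iff]
  have meas: "Q_measurable T \<Omega> (\<lambda>t x. F (G t x))" unfolding Q_measurable_iff by measurable
  have both: "AE t in Mt. (\<lambda>x. F (G t x)) \<in> L2_space \<Omega> \<and> (L2_norm \<Omega> (\<lambda>x. F (G t x)))\<^sup>2 \<le> k\<^sup>2 * (L2_norm \<Omega> (G t))\<^sup>2"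
    using GD(2)
  proof eventually_elim
    case (elim t)
    note [measurable] = L2_space_measurable[OF elim]
    have "(\<lambda>x. F (G t x)) \<in> borel_measurable (lebesgue_on \<Omega>)" by measurable
    then show ?case using L2_space_of_norm_bound[OF elim _ F(2)] by blast
  qed
  then have "AE t in Mt. norm ((L2_norm \<Omega> (\<lambda>x. F (G t x)))\<^sup>2) \<le> norm (k\<^sup>2 * (L2_norm \<Omega> (G t))\<^sup>2)"
    by eventually_elim simp
  moreover have "(\<lambda>t. (L2_norm \<Omega> (\<lambda>x. F (G t x)))\<^sup>2) \<in> borel_measurable Mt"
    using Q_measurable_L2_norm[OF meas] by simp
  moreover have "integrable Mt (\<lambda>t. k\<^sup>2 * (L2_norm \<Omega> (G t))\<^sup>2)" using GD(3) by simp
  ultimately have "integrable Mt (\<lambda>t. (L2_norm \<Omega> (\<lambda>x. F (G t x)))\<^sup>2)"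
    by (blast intro: Bochner_Integration.integrable_bound)
  moreover have "AE t in Mt. (\<lambda>x. F (G t x)) \<in> L2_space \<Omega>" using both by eventually_elim simp
  ultimately show ?thesis using meas by (simp add: Q_L2_def)
qed

lemma Linf_H1_gradient_Q_L2:
  assumes "y \<in> Linf_H1 T \<Omega>" "has_space_gradient T \<Omega> y G"
  shows "G \<in> Q_L2"
  using Linf_H1_gradient[OF assms] assms(2) by (simp add: Q_L2_def has_space_gradient_def)

text \<open>Ensures that the time integral of the squared dual norm is a genuine value and not the
  default 0 of a non-integrable function.\<close>

lemma integrable_H1_dual_norm_power2:
  assumes u: "u\<^sub>1 \<in> L2_L2 T \<Omega>" "u\<^sub>2 \<in> L2_L2 T \<Omega>"
  shows "integrable Mt (\<lambda>t. (H1_dual_norm \<Omega> (u\<^sub>1 t - u\<^sub>2 t))\<^sup>2)"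
proof (rule Bochner_Integration.integrable_bound)
  note D = Q_L2_D[OF Q_L2_diff[OF u[THEN L2_L2_imp_Q_L2]]]
  show "integrable Mt (\<lambda>t. (L2_norm \<Omega> (u\<^sub>1 t - u\<^sub>2 t))\<^sup>2)" by (rule D)
  have "strongly_measurable T (L2_space \<Omega>) (L2_norm \<Omega>) (\<lambda>t. u\<^sub>1 t - u\<^sub>2 t)"
    using u by (intro strongly_measurable_diff L2_space_diff L2_norm_triangle_diff) (auto simp: L2_L2_def)
  then show "(\<lambda>t. (H1_dual_norm \<Omega> (u\<^sub>1 t - u\<^sub>2 t))\<^sup>2) \<in> borel_measurable Mt"
    using H1_dual_norm_measurable by simp
  show "AE t in Mt. norm ((H1_dual_norm \<Omega> (u\<^sub>1 t - u\<^sub>2 t))\<^sup>2) \<le> norm ((L2_norm \<Omega> (u\<^sub>1 t - u\<^sub>2 t))\<^sup>2)"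
    using D(2) by eventually_elim (simp add: power_mono H1_dual_norm_le H1_dual_norm_nonneg)
qed

lemma H1_norm_power2_gradient:
  assumes "has_space_gradient T \<Omega> y G"
  shows "AE t in Mt. y t \<in> H1_space \<Omega> \<and> (H1_norm \<Omega> (y t))\<^sup>2 = (L2_norm \<Omega> (y t))\<^sup>2 + (L2_norm \<Omega> (G t))\<^sup>2"
proof -
  have "AE t in Mt. has_weak_gradient \<Omega> (y t) (G t)" using assms by (simp add: has_space_gradient_def)
  then show ?thesis by eventually_elim (auto simp: H1_norm_power2 H1_space_def)
qed

lemma has_space_gradient_diff:
  assumes "has_space_gradient T \<Omega> y G" "has_space_gradient T \<Omega> z H"
  shows "has_space_gradient T \<Omega> (\<lambda>t. y t - z t) (\<lambda>t. G t - H t)"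
proof -
  have "AE t in Mt. has_weak_gradient \<Omega> (y t) (G t)" "AE t in Mt. has_weak_gradient \<Omega> (z t) (H t)"
    using assms by (simp_all add: has_space_gradient_def)
  then have "AE t in Mt. has_weak_gradient \<Omega> (y t - z t) (G t - H t)"
    by eventually_elim (rule has_weak_gradient_diff)
  then show ?thesis using assms Q_measurable_diff[of G H] by (simp add: has_space_gradient_def)
qed

lemma has_space_gradient_indicator:
  assumes "has_space_gradient T \<Omega> y G" "A \<in> sets borel"
  shows "has_space_gradient T \<Omega> (\<lambda>t x. indicator A t * y t x) (\<lambda>t x. indicat_real A t *\<^sub>R G t x)"
proof -
  have "AE t in Mt. has_weak_gradient \<Omega> (y t) (G t)" using assms by (simp add: has_space_gradient_def)
  then have "AE t in Mt. has_weak_gradient \<Omega> (\<lambda>x. indicator A t * y t x) (\<lambda>x. indicat_real A t *\<^sub>R G t x)"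
    by eventually_elim (rule has_weak_gradient_scale)
  then show ?thesis
    using assms Q_measurable_scaleR[OF indicator_measurable_lebesgue_on[OF assms(2)], of G]
    by (simp add: has_space_gradient_def)
qed

text \<open>The gradient chosen inside \<open>H1_norm\<close> may depend on t in an uncontrolled
  way. Measurability in time is therefore taken from the jointly measurable representative
  \<open>G\<close>, whose norm is the same for almost every t.\<close>

lemma L2_H1_of_gradient:
  assumes y: "y \<in> Q_L2" "strongly_measurable T (H1_space \<Omega>) (H1_norm \<Omega>) y"
    and G: "G \<in> Q_L2" "has_space_gradient T \<Omega> y G"
  shows "y \<in> L2_H1 T \<Omega>" "integrable Mt (\<lambda>t. (H1_norm \<Omega> (y t))\<^sup>2)"
proof -
  define k where "k t = (L2_norm \<Omega> (y t))\<^sup>2 + (L2_norm \<Omega> (G t))\<^sup>2" for t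
  have k: "integrable Mt k" unfolding k_def using Q_L2_D(3)[OF y(1)] Q_L2_D(3)[OF G(1)] by simp
  have eq: "AE t in Mt. k t = (H1_norm \<Omega> (y t))\<^sup>2"
    using H1_norm_power2_gradient[OF G(2)] by eventually_elim (simp add: k_def)
  \<comment> \<open>A constant sequence turns the almost everywhere equality with \<open>k\<close>
    into measurability.\<close>
  have "(\<lambda>t. (H1_norm \<Omega> (y t))\<^sup>2) \<in> borel_measurable Mt"
    by (rule borel_measurable_AE_limit[where g = "\<lambda>_. k"])
      (use k eq in \<open>auto elim!: eventually_mono intro: borel_measurable_integrable\<close>)
  then show int: "integrable Mt (\<lambda>t. (H1_norm \<Omega> (y t))\<^sup>2)"
    using integrable_cong_AE_imp[OF k _ eq] by blast
  then show "y \<in> L2_H1 T \<Omega>" using y Q_L2_D(1)[OF y(1)] by (simp add: L2_H1_def)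
qed

lemma C_L2_imp_Q_L2:
  assumes "y \<in> C_L2 T \<Omega>" "Q_measurable T \<Omega> y"
  shows "y \<in> Q_L2"
proof -
  have "integrable Mt (\<lambda>t. (L2_norm \<Omega> (y t))\<^sup>2)"
    by (intro continuous_imp_integrable_real continuous_on_power C_L2_norm_continuous assms(1))
  then show ?thesis using assms C_L2_D(1)[OF assms(1)] by (auto simp: Q_L2_def)
qed

section \<open>The difference of two weak solutions\<close>

lemma weak_solution_Linf_H1: "weak_solution T \<Omega> A' \<psi>' y\<^sub>0 u y \<Longrightarrow> y \<in> Linf_H1 T \<Omega>"
  and weak_solution_C_L2: "weak_solution T \<Omega> A' \<psi>' y\<^sub>0 u y \<Longrightarrow> y \<in> C_L2 T \<Omega>"
  by (simp_all add: weak_solution_def)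

lemma weak_solutionE:
  assumes "weak_solution T \<Omega> A' \<psi>' y\<^sub>0 u y"
  obtains y\<^sub>t G where "has_time_derivative T \<Omega> y y\<^sub>t" "has_space_gradient T \<Omega> y G"
    "\<And>\<eta> H. \<eta> \<in> L2_H1 T \<Omega> \<Longrightarrow> has_space_gradient T \<Omega> \<eta> H \<Longrightarrow>
      integrable (Q_measure T \<Omega>) (\<lambda>p. \<psi>' (y (fst p) (snd p)) * \<eta> (fst p) (snd p))"
    "\<And>\<eta> H. \<eta> \<in> L2_H1 T \<Omega> \<Longrightarrow> has_space_gradient T \<Omega> \<eta> H \<Longrightarrow>
      (\<integral>p. y\<^sub>t (fst p) (snd p) * \<eta> (fst p) (snd p) + A' (G (fst p) (snd p)) \<bullet> H (fst p) (snd p)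
          + \<psi>' (y (fst p) (snd p)) * \<eta> (fst p) (snd p) \<partial>Q_measure T \<Omega>)
      = (\<integral>p. u (fst p) (snd p) * \<eta> (fst p) (snd p) \<partial>Q_measure T \<Omega>)"
proof -
  from assms obtain y\<^sub>t G where yt: "has_time_derivative T \<Omega> y y\<^sub>t" "has_space_gradient T \<Omega> y G"
    and eq: "\<forall>\<eta>\<in>L2_H1 T \<Omega>. \<forall>H. has_space_gradient T \<Omega> \<eta> H \<longrightarrow>
           integrable (Q_measure T \<Omega>) (\<lambda>(t, x). \<psi>' (y t x) * \<eta> t x) \<and>
           (\<integral>(t, x). y\<^sub>t t x * \<eta> t x + A' (G t x) \<bullet> H t x + \<psi>' (y t x) * \<eta> t x \<partial>Q_measure T \<Omega>)
             = (\<integral>(t, x). u t x * \<eta> t x \<partial>Q_measure T \<Omega>)"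
    unfolding weak_solution_def by blast
  show thesis
    by (rule that[OF yt]) (use eq[unfolded case_prod_beta'] in blast)+
qed

text \<open>The pairing with the difference of the controls is left unestimated on the right, so
  that the dual norm can enter afterwards. The field \<open>W\<close> represents the gradient of
  \<open>w\<close> in both the energy term and the H^1 norm.\<close>

lemma weak_solution_difference:
  assumes sol: "weak_solution T \<Omega> A' \<psi>' y\<^sub>0 u\<^sub>1 y\<^sub>1" "weak_solution T \<Omega> A' \<psi>' z\<^sub>0 u\<^sub>2 y\<^sub>2"
    and u: "u\<^sub>1 \<in> L2_L2 T \<Omega>" "u\<^sub>2 \<in> L2_L2 T \<Omega>"
    and A': "continuous_on UNIV A'" "\<And>p. norm (A' p) \<le> k * norm p"
      "\<And>p q. C\<^sub>A * (norm (p - q))\<^sup>2 \<le> (A' p - A' q) \<bullet> (p - q)"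
    and \<psi>': "\<And>a b. - C\<^sub>\<psi> * (a - b)\<^sup>2 \<le> (\<psi>' a - \<psi>' b) * (a - b)"
  defines "w \<equiv> \<lambda>t. y\<^sub>1 t - y\<^sub>2 t"
  obtains W where "has_space_gradient T \<Omega> w W" "W \<in> Q_L2" "integrable Mt (\<lambda>t. (H1_norm \<Omega> (w t))\<^sup>2)"
    "integrable Mt (\<lambda>t. \<integral>x. (u\<^sub>1 t x - u\<^sub>2 t x) * w t x \<partial>lebesgue_on \<Omega>)"
    "\<And>s. s \<in> {0..T} \<Longrightarrow> ((L2_norm \<Omega> (w s))\<^sup>2 - (L2_norm \<Omega> (w 0))\<^sup>2) / 2
        + C\<^sub>A * (\<integral>t. indicator {0<..s} t * (L2_norm \<Omega> (W t))\<^sup>2 \<partial>Mt)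
        - C\<^sub>\<psi> * (\<integral>t. indicator {0<..s} t * (L2_norm \<Omega> (w t))\<^sup>2 \<partial>Mt)
      \<le> (\<integral>t. indicator {0<..s} t * (\<integral>x. (u\<^sub>1 t x - u\<^sub>2 t x) * w t x \<partial>lebesgue_on \<Omega>) \<partial>Mt)"
proof -
  obtain v\<^sub>1 G\<^sub>1 where D1: "has_time_derivative T \<Omega> y\<^sub>1 v\<^sub>1" "has_space_gradient T \<Omega> y\<^sub>1 G\<^sub>1"
    and int1: "\<And>\<eta> H. \<eta> \<in> L2_H1 T \<Omega> \<Longrightarrow> has_space_gradient T \<Omega> \<eta> H \<Longrightarrow>
      integrable (Q_measure T \<Omega>) (\<lambda>p. \<psi>' (y\<^sub>1 (fst p) (snd p)) * \<eta> (fst p) (snd p))"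
    and eq1: "\<And>\<eta> H. \<eta> \<in> L2_H1 T \<Omega> \<Longrightarrow> has_space_gradient T \<Omega> \<eta> H \<Longrightarrow>
      (\<integral>p. v\<^sub>1 (fst p) (snd p) * \<eta> (fst p) (snd p) + A' (G\<^sub>1 (fst p) (snd p)) \<bullet> H (fst p) (snd p)
          + \<psi>' (y\<^sub>1 (fst p) (snd p)) * \<eta> (fst p) (snd p) \<partial>Q_measure T \<Omega>)
      = (\<integral>p. u\<^sub>1 (fst p) (snd p) * \<eta> (fst p) (snd p) \<partial>Q_measure T \<Omega>)"
    by (rule weak_solutionE[OF sol(1)]) (use that in blast)
  obtain v\<^sub>2 G\<^sub>2 where D2: "has_time_derivative T \<Omega> y\<^sub>2 v\<^sub>2" "has_space_gradient T \<Omega> y\<^sub>2 G\<^sub>2"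
    and int2: "\<And>\<eta> H. \<eta> \<in> L2_H1 T \<Omega> \<Longrightarrow> has_space_gradient T \<Omega> \<eta> H \<Longrightarrow>
      integrable (Q_measure T \<Omega>) (\<lambda>p. \<psi>' (y\<^sub>2 (fst p) (snd p)) * \<eta> (fst p) (snd p))"
    and eq2: "\<And>\<eta> H. \<eta> \<in> L2_H1 T \<Omega> \<Longrightarrow> has_space_gradient T \<Omega> \<eta> H \<Longrightarrow>
      (\<integral>p. v\<^sub>2 (fst p) (snd p) * \<eta> (fst p) (snd p) + A' (G\<^sub>2 (fst p) (snd p)) \<bullet> H (fst p) (snd p)
          + \<psi>' (y\<^sub>2 (fst p) (snd p)) * \<eta> (fst p) (snd p) \<partial>Q_measure T \<Omega>)
      = (\<integral>p. u\<^sub>2 (fst p) (snd p) * \<eta> (fst p) (snd p) \<partial>Q_measure T \<Omega>)"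
    by (rule weak_solutionE[OF sol(2)]) (use that in blast)
  define W where "W t = G\<^sub>1 t - G\<^sub>2 t" for t
  define v where "v t = v\<^sub>1 t - v\<^sub>2 t" for t
  define u where "u t = u\<^sub>1 t - u\<^sub>2 t" for t
  have vL: "v\<^sub>1 \<in> L2_L2 T \<Omega>" "v\<^sub>2 \<in> L2_L2 T \<Omega>" using D1 D2 by (auto simp: has_time_derivative_def)
  note L1 = weak_solution_Linf_H1[OF sol(1)] and L2 = weak_solution_Linf_H1[OF sol(2)]
  have GQ: "G\<^sub>1 \<in> Q_L2" "G\<^sub>2 \<in> Q_L2"
    using Linf_H1_gradient_Q_L2 L1 L2 D1(2) D2(2) by blast+
  have wC: "w \<in> C_L2 T \<Omega>"
    unfolding w_def using weak_solution_C_L2[OF sol(1)] weak_solution_C_L2[OF sol(2)] by (rule C_L2_diff)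
  have wmeas: "Q_measurable T \<Omega> w"
    unfolding w_def using L1 L2 by (intro Q_measurable_diff) (auto simp: Linf_H1_def)
  have wQ: "w \<in> Q_L2" using wC wmeas by (rule C_L2_imp_Q_L2)
  have WQ: "W \<in> Q_L2" unfolding W_def using GQ by (rule Q_L2_diff)
  have vQ: "v \<in> Q_L2" unfolding v_def using vL[THEN L2_L2_imp_Q_L2] by (rule Q_L2_diff)
  have uQ: "u \<in> Q_L2" unfolding u_def using u[THEN L2_L2_imp_Q_L2] by (rule Q_L2_diff)
  have gradW: "has_space_gradient T \<Omega> w W"
    unfolding w_def W_def using D1(2) D2(2) by (rule has_space_gradient_diff)
  have wsm: "strongly_measurable T (H1_space \<Omega>) (H1_norm \<Omega>) w"
    unfolding w_def using L1 L2
    by (intro strongly_measurable_diff H1_space_diff H1_norm_diff_le H1_norm_nonneg) (auto simp: Linf_H1_def)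
  have vint: "integrable Mt (\<lambda>t. L2_norm \<Omega> (v t))"
  proof (rule Bochner_Integration.integrable_bound)
    show "integrable Mt (\<lambda>t. 1 + (L2_norm \<Omega> (v t))\<^sup>2)" using Q_L2_D(3)[OF vQ] by simp
    have "a \<le> 1 + a\<^sup>2" for a :: real using zero_le_power2[of "a - 1 / 2"]
      by (simp add: power2_eq_square algebra_simps)
    then show "AE t in Mt. norm (L2_norm \<Omega> (v t)) \<le> norm (1 + (L2_norm \<Omega> (v t))\<^sup>2)"
      by (intro AE_I2) simp
  qed (rule Q_measurable_L2_norm[OF Q_L2_D(1)[OF vQ]])
  \<comment> \<open>Subtracts the increment formulas of the two solutions. Splitting the space
    integral of \<open>v t x * z x\<close> needs \<open>v\<^sub>1 t\<close> and
    \<open>v\<^sub>2 t\<close> in L^2, which holds for almost every t.\<close>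
  have inc: "(\<integral>x. w s x * z x \<partial>lebesgue_on \<Omega>) - (\<integral>x. w r x * z x \<partial>lebesgue_on \<Omega>)
      = (\<integral>t. indicator {r<..s} t * (\<integral>x. v t x * z x \<partial>lebesgue_on \<Omega>) \<partial>Mt)"
    if rs: "0 \<le> r" "r \<le> s" "s \<le> T" and z: "z \<in> L2_space \<Omega>" for r s z
  proof -
    note i1 = time_derivative_increment[OF D1(1) weak_solution_C_L2[OF sol(1)] z rs]
    note i2 = time_derivative_increment[OF D2(1) weak_solution_C_L2[OF sol(2)] z rs]
    have w: "(\<integral>x. w c x * z x \<partial>lebesgue_on \<Omega>)
        = (\<integral>x. y\<^sub>1 c x * z x \<partial>lebesgue_on \<Omega>) - (\<integral>x. y\<^sub>2 c x * z x \<partial>lebesgue_on \<Omega>)" if "c \<in> {0..T}" for c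
      using L2_integrable_mult[OF C_L2_D(1)[OF weak_solution_C_L2[OF sol(1)] that] z]
        L2_integrable_mult[OF C_L2_D(1)[OF weak_solution_C_L2[OF sol(2)] that] z]
      by (simp add: w_def left_diff_distrib)
    have "AE t in Mt. indicator {r<..s} t * (\<integral>x. v t x * z x \<partial>lebesgue_on \<Omega>)
        = indicator {r<..s} t * (\<integral>x. v\<^sub>1 t x * z x \<partial>lebesgue_on \<Omega>)
          - indicator {r<..s} t * (\<integral>x. v\<^sub>2 t x * z x \<partial>lebesgue_on \<Omega>)"
      using L2_L2_D(2)[OF vL(1)] L2_L2_D(2)[OF vL(2)]
    proof eventually_elim
      case (elim t)
      show ?case
        using L2_integrable_mult[OF elim(1) z] L2_integrable_mult[OF elim(2) z]
        by (simp add: v_def left_diff_distrib right_diff_distrib)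
    qed
    moreover have ii: "integrable Mt (\<lambda>t. indicator {r<..s} t * (\<integral>x. v\<^sub>1 t x * z x \<partial>lebesgue_on \<Omega>))"
      "integrable Mt (\<lambda>t. indicator {r<..s} t * (\<integral>x. v\<^sub>2 t x * z x \<partial>lebesgue_on \<Omega>))"
      using i1(2) i2(2) by (auto intro: integrable_indicator_mult)
    moreover have "(\<lambda>t. indicator {r<..s} t * (\<integral>x. v t x * z x \<partial>lebesgue_on \<Omega>)) \<in> borel_measurable Mt"
      using Q_measurable_inner_integral[OF Q_L2_D(1)[OF vQ] Q_measurable_const[OF L2_space_measurable[OF z]]]
      by (intro borel_measurable_times indicator_measurable_lebesgue_on) auto
    ultimately have "(\<integral>t. indicator {r<..s} t * (\<integral>x. v t x * z x \<partial>lebesgue_on \<Omega>) \<partial>Mt)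
        = (\<integral>t. indicator {r<..s} t * (\<integral>x. v\<^sub>1 t x * z x \<partial>lebesgue_on \<Omega>)
          - indicator {r<..s} t * (\<integral>x. v\<^sub>2 t x * z x \<partial>lebesgue_on \<Omega>) \<partial>Mt)"
      by (intro integral_cong_AE borel_measurable_diff borel_measurable_integrable[OF ii(1)]
          borel_measurable_integrable[OF ii(2)])
    also have "\<dots> = (\<integral>t. indicator {r<..s} t * (\<integral>x. v\<^sub>1 t x * z x \<partial>lebesgue_on \<Omega>) \<partial>Mt)
          - (\<integral>t. indicator {r<..s} t * (\<integral>x. v\<^sub>2 t x * z x \<partial>lebesgue_on \<Omega>) \<partial>Mt)"
      using ii by (rule Bochner_Integration.integral_diff)
    finally show ?thesis using i1(1) i2(1) w[of s] w[of r] rs by simp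
  qed
  note energy = energy_identity[OF wC wmeas Q_L2_D(1,2)[OF vQ] vint inc]
  have uw: "integrable Mt (\<lambda>t. \<integral>x. u t x * w t x \<partial>lebesgue_on \<Omega>)"
  proof -
    have "integrable (Mt \<Otimes>\<^sub>M lebesgue_on \<Omega>) (\<lambda>(t, x). u t x * w t x)"
      using Q_L2_inner(1)[OF uQ wQ] by (simp add: Q_measure_def case_prod_beta')
    then show ?thesis by (rule Q.integrable_fst)
  qed
  show thesis
  proof (rule that[OF gradW WQ])
    show "integrable Mt (\<lambda>t. (H1_norm \<Omega> (w t))\<^sup>2)"
      by (rule L2_H1_of_gradient(2)[OF wQ wsm WQ gradW])
    show "integrable Mt (\<lambda>t. \<integral>x. (u\<^sub>1 t x - u\<^sub>2 t x) * w t x \<partial>lebesgue_on \<Omega>)"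
      using uw by (simp add: u_def)
    fix s assume s: "s \<in> {0..T}"
    let ?I = "indicat_real {0<..s}"
    \<comment> \<open>The test space asks for no regularity in time, so the discontinuous cut-off of
      \<open>w\<close> to (0, s] is admissible.\<close>
    define \<eta> where "\<eta> t x = ?I t * w t x" for t x
    define H where "H t x = ?I t *\<^sub>R W t x" for t x
    have \<eta>Q: "\<eta> \<in> Q_L2" using Q_L2_indicator[OF wQ, of "{0<..s}"] by (simp add: \<eta>_def[abs_def])
    have HQ: "H \<in> Q_L2" using Q_L2_indicator[OF WQ, of "{0<..s}"] by (simp add: H_def[abs_def])
    have gradH: "has_space_gradient T \<Omega> \<eta> H"
      using has_space_gradient_indicator[OF gradW, of "{0<..s}"] by (simp add: \<eta>_def[abs_def] H_def[abs_def])
    have "strongly_measurable T (H1_space \<Omega>) (H1_norm \<Omega>) \<eta>"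
      using strongly_measurable_indicator[OF wsm _ zero_H1_space H1_norm_zero, of "{0<..s}"]
      by (simp add: \<eta>_def[abs_def])
    then have \<eta>H1: "\<eta> \<in> L2_H1 T \<Omega>" by (rule L2_H1_of_gradient(1)[OF \<eta>Q _ HQ gradH])
    let ?M = "Q_measure T \<Omega>"
    let ?at = "\<lambda>f p. f (fst p) (snd p)"
    note i\<psi> = int1[OF \<eta>H1 gradH] int2[OF \<eta>H1 gradH]
    have iA: "integrable ?M (\<lambda>p. A' (?at G\<^sub>1 p) \<bullet> ?at H p)" "integrable ?M (\<lambda>p. A' (?at G\<^sub>2 p) \<bullet> ?at H p)"
      using Q_L2_inner(1)[OF Q_L2_compose[OF GQ(1) A'(1,2)] HQ] Q_L2_inner(1)[OF Q_L2_compose[OF GQ(2) A'(1,2)] HQ]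
      by simp_all
    have iv: "integrable ?M (\<lambda>p. ?at v\<^sub>1 p * ?at \<eta> p)" "integrable ?M (\<lambda>p. ?at v\<^sub>2 p * ?at \<eta> p)"
      using Q_L2_inner(1)[OF L2_L2_imp_Q_L2[OF vL(1)] \<eta>Q] Q_L2_inner(1)[OF L2_L2_imp_Q_L2[OF vL(2)] \<eta>Q] by simp_all
    have iu: "integrable ?M (\<lambda>p. ?at u\<^sub>1 p * ?at \<eta> p)" "integrable ?M (\<lambda>p. ?at u\<^sub>2 p * ?at \<eta> p)"
      using Q_L2_inner(1)[OF L2_L2_imp_Q_L2[OF u(1)] \<eta>Q] Q_L2_inner(1)[OF L2_L2_imp_Q_L2[OF u(2)] \<eta>Q] by simp_all
    have iH: "integrable ?M (\<lambda>p. ?at H p \<bullet> ?at H p)" by (rule Q_L2_inner(1)[OF HQ HQ])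
    have i\<eta>: "integrable ?M (\<lambda>p. ?at \<eta> p * ?at \<eta> p)" using Q_L2_inner(1)[OF \<eta>Q \<eta>Q] by simp
    have iv\<eta>: "integrable ?M (\<lambda>p. ?at v p * ?at \<eta> p)" using Q_L2_inner(1)[OF vQ \<eta>Q] by simp
    define F\<^sub>1 where "F\<^sub>1 p = ?at v\<^sub>1 p * ?at \<eta> p + A' (?at G\<^sub>1 p) \<bullet> ?at H p + \<psi>' (?at y\<^sub>1 p) * ?at \<eta> p" for p
    define F\<^sub>2 where "F\<^sub>2 p = ?at v\<^sub>2 p * ?at \<eta> p + A' (?at G\<^sub>2 p) \<bullet> ?at H p + \<psi>' (?at y\<^sub>2 p) * ?at \<eta> p" for p
    \<comment> \<open>The difference of the integrands with the flux and the potential terms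
      replaced by their lower bounds; only products of square-integrable functions remain.\<close>
    define L where "L p = ?at v p * ?at \<eta> p + C\<^sub>A * (?at H p \<bullet> ?at H p) - C\<^sub>\<psi> * (?at \<eta> p * ?at \<eta> p)" for p
    have iF: "integrable ?M F\<^sub>1" "integrable ?M F\<^sub>2"
      unfolding F\<^sub>1_def F\<^sub>2_def by (intro Bochner_Integration.integrable_add i\<psi> iA iv)+
    have iL: "integrable ?M L"
      unfolding L_def
      by (intro Bochner_Integration.integrable_add Bochner_Integration.integrable_diff integrable_mult_right iv\<eta> iH i\<eta>)
    have pull: "(\<integral>x. z t x * \<eta> t x \<partial>lebesgue_on \<Omega>) = ?I t * (\<integral>x. z t x * w t x \<partial>lebesgue_on \<Omega>)" for z t
    proof -
      have "z t x * \<eta> t x = ?I t * (z t x * w t x)" for x by (simp add: \<eta>_def)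
      then show ?thesis by (simp only: integral_mult_right_zero)
    qed
    \<comment> \<open>On (0, s] the cut-off is 1 and the two monotonicity inequalities apply
      pointwise; elsewhere both sides vanish. The individual \<psi>' terms never have to be
      integrated without \<eta>.\<close>
    have pointwise: "L p \<le> F\<^sub>1 p - F\<^sub>2 p" for p
    proof -
      obtain t x where p: "p = (t, x)" by (cases p)
      show ?thesis
      proof (cases "t \<in> {0<..s}")
        case True
        then have I: "?I t = 1" by simp
        have "C\<^sub>A * (W t x \<bullet> W t x) \<le> (A' (G\<^sub>1 t x) - A' (G\<^sub>2 t x)) \<bullet> W t x"
          using A'(3)[of "G\<^sub>1 t x" "G\<^sub>2 t x"] by (simp add: W_def power2_norm_eq_inner)
        moreover have "- C\<^sub>\<psi> * (w t x)\<^sup>2 \<le> (\<psi>' (y\<^sub>1 t x) - \<psi>' (y\<^sub>2 t x)) * w t x"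
          using \<psi>'[of "y\<^sub>1 t x" "y\<^sub>2 t x"] by (simp add: w_def)
        ultimately show ?thesis
          unfolding L_def F\<^sub>1_def F\<^sub>2_def p fst_conv snd_conv \<eta>_def H_def I v_def fun_diff_def
          by (simp add: power2_eq_square algebra_simps)
      next
        case False
        then show ?thesis by (simp add: L_def F\<^sub>1_def F\<^sub>2_def p \<eta>_def H_def)
      qed
    qed
    have "(\<integral>p. L p \<partial>?M) \<le> (\<integral>p. F\<^sub>1 p - F\<^sub>2 p \<partial>?M)"
      using iL iF pointwise by (intro integral_mono Bochner_Integration.integrable_diff)
    also have "\<dots> = (\<integral>p. F\<^sub>1 p \<partial>?M) - (\<integral>p. F\<^sub>2 p \<partial>?M)" using iF by (rule Bochner_Integration.integral_diff)
    also have "\<dots> = (\<integral>p. ?at u\<^sub>1 p * ?at \<eta> p \<partial>?M) - (\<integral>p. ?at u\<^sub>2 p * ?at \<eta> p \<partial>?M)"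
      unfolding F\<^sub>1_def F\<^sub>2_def using eq1[OF \<eta>H1 gradH] eq2[OF \<eta>H1 gradH] by (simp only:)
    also have "\<dots> = (\<integral>p. ?at u p * ?at \<eta> p \<partial>?M)"
      using iu by (simp add: u_def left_diff_distrib)
    also have "\<dots> = (\<integral>t. (\<integral>x. u t x * \<eta> t x \<partial>lebesgue_on \<Omega>) \<partial>Mt)"
      using Q_L2_inner(2)[OF uQ \<eta>Q] by simp
    also have "\<dots> = (\<integral>t. ?I t * (\<integral>x. (u\<^sub>1 t x - u\<^sub>2 t x) * w t x \<partial>lebesgue_on \<Omega>) \<partial>Mt)"
      by (simp add: pull) (simp add: u_def)
    finally have le: "(\<integral>p. L p \<partial>?M) \<le> (\<integral>t. ?I t * (\<integral>x. (u\<^sub>1 t x - u\<^sub>2 t x) * w t x \<partial>lebesgue_on \<Omega>) \<partial>Mt)" .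
    \<comment> \<open>Quadratic terms carry the cut-off twice.\<close>
    have Isq: "?I t * ?I t = ?I t" for t by (simp add: indicator_def)
    have "(\<integral>p. ?at v p * ?at \<eta> p \<partial>?M) = (\<integral>t. ?I t * (\<integral>x. v t x * w t x \<partial>lebesgue_on \<Omega>) \<partial>Mt)"
      using Q_L2_inner(2)[OF vQ \<eta>Q] by (simp add: pull)
    moreover have "(\<integral>p. ?at H p \<bullet> ?at H p \<partial>?M) = (\<integral>t. ?I t * (L2_norm \<Omega> (W t))\<^sup>2 \<partial>Mt)"
    proof -
      have "(\<integral>x. H t x \<bullet> H t x \<partial>lebesgue_on \<Omega>) = ?I t * (L2_norm \<Omega> (W t))\<^sup>2" for t
        by (simp add: H_def L2_norm_power2 power2_norm_eq_inner Isq flip: mult.assoc)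
      then show ?thesis using Q_L2_inner(2)[OF HQ HQ] by (simp only:)
    qed
    moreover have "(\<integral>p. ?at \<eta> p * ?at \<eta> p \<partial>?M) = (\<integral>t. ?I t * (L2_norm \<Omega> (w t))\<^sup>2 \<partial>Mt)"
    proof -
      have "(\<integral>x. \<eta> t x \<bullet> \<eta> t x \<partial>lebesgue_on \<Omega>) = ?I t * (L2_norm \<Omega> (w t))\<^sup>2" for t
      proof -
        have "\<eta> t x \<bullet> \<eta> t x = ?I t * (norm (w t x))\<^sup>2" for x
          by (simp add: \<eta>_def indicator_def power2_eq_square)
        then show ?thesis by (simp only: L2_norm_power2 integral_mult_right_zero)
      qed
      then show ?thesis using Q_L2_inner(2)[OF \<eta>Q \<eta>Q] by (simp only: inner_real_def)
    qed
    moreover have "(\<integral>p. L p \<partial>?M) = (\<integral>p. ?at v p * ?at \<eta> p \<partial>?M) + C\<^sub>A * (\<integral>p. ?at H p \<bullet> ?at H p \<partial>?M)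
        - C\<^sub>\<psi> * (\<integral>p. ?at \<eta> p * ?at \<eta> p \<partial>?M)"
      unfolding L_def using iv\<eta> iH i\<eta> by simp
    moreover have "(L2_norm \<Omega> (w s))\<^sup>2 - (L2_norm \<Omega> (w 0))\<^sup>2 = 2 * (\<integral>t. ?I t * (\<integral>x. v t x * w t x \<partial>lebesgue_on \<Omega>) \<partial>Mt)"
      by (rule energy(1)[OF _ _ _ _ s])
    ultimately show "((L2_norm \<Omega> (w s))\<^sup>2 - (L2_norm \<Omega> (w 0))\<^sup>2) / 2
        + C\<^sub>A * (\<integral>t. ?I t * (L2_norm \<Omega> (W t))\<^sup>2 \<partial>Mt) - C\<^sub>\<psi> * (\<integral>t. ?I t * (L2_norm \<Omega> (w t))\<^sup>2 \<partial>Mt)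
      \<le> (\<integral>t. ?I t * (\<integral>x. (u\<^sub>1 t x - u\<^sub>2 t x) * w t x \<partial>lebesgue_on \<Omega>) \<partial>Mt)"
      using le by simp
  qed
qed

section \<open>From the energy inequality to the Lipschitz estimate\<close>

lemma integral_indicator_full:
  fixes h :: "real \<Rightarrow> real"
  assumes "integrable Mt h"
  shows "(\<integral>t. indicator {0<..T} t * h t \<partial>Mt) = (\<integral>t. h t \<partial>Mt)"
proof (rule integral_cong_AE)
  have "AE t in Mt. t \<noteq> 0" by (rule AE_lebesgue_on_neq) simp
  then show "AE t in Mt. indicator {0<..T} t * h t = h t"
    using AE_space by eventually_elim (auto simp: indicator_def)
  show "(\<lambda>t. indicator {0<..T} t * h t) \<in> borel_measurable Mt"
    using integrable_indicator_mult[OF assms, of "{0<..T}"] by auto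
qed (use assms in auto)

lemma integral_indicator_le:
  fixes h :: "real \<Rightarrow> real"
  assumes h: "integrable Mt h" "\<And>t. 0 \<le> h t" and A: "A \<in> sets borel"
  shows "(\<integral>t. indicator A t * h t \<partial>Mt) \<le> (\<integral>t. h t \<partial>Mt)"
  by (rule integral_mono) (use h integrable_indicator_mult[OF h(1) A] in \<open>auto simp: indicator_def\<close>)

text \<open>Young's inequality is weighted so that the gradient part of \<open>C\<^sub>A / 2\<close>
  times the squared H^1 norm takes exactly half of the coercive term. The L^2 part joins the
  \<open>C\<^sub>\<psi>\<close> term, and multiplication by 2 gives the factor
  \<open>2 * C\<^sub>\<psi> + C\<^sub>A\<close>.\<close>

lemma weak_solution_energy_estimate:
  assumes sol: "weak_solution T \<Omega> A' \<psi>' y\<^sub>0 u\<^sub>1 y\<^sub>1" "weak_solution T \<Omega> A' \<psi>' z\<^sub>0 u\<^sub>2 y\<^sub>2"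
    and u: "u\<^sub>1 \<in> L2_L2 T \<Omega>" "u\<^sub>2 \<in> L2_L2 T \<Omega>"
    and A': "continuous_on UNIV A'" "\<And>p. norm (A' p) \<le> k * norm p"
      "\<And>p q. C\<^sub>A * (norm (p - q))\<^sup>2 \<le> (A' p - A' q) \<bullet> (p - q)"
    and \<psi>': "\<And>a b. - C\<^sub>\<psi> * (a - b)\<^sup>2 \<le> (\<psi>' a - \<psi>' b) * (a - b)"
    and C\<^sub>A: "0 < C\<^sub>A"
  defines "w \<equiv> \<lambda>t. y\<^sub>1 t - y\<^sub>2 t"
    and "D \<equiv> \<lambda>t. (H1_dual_norm \<Omega> (u\<^sub>1 t - u\<^sub>2 t))\<^sup>2"
  obtains W where "has_space_gradient T \<Omega> w W" "W \<in> Q_L2"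
    "integrable Mt (\<lambda>t. (H1_norm \<Omega> (w t))\<^sup>2)" "integrable Mt D"
    "\<And>s. s \<in> {0..T} \<Longrightarrow> (L2_norm \<Omega> (w s))\<^sup>2 + C\<^sub>A * (\<integral>t. indicator {0<..s} t * (L2_norm \<Omega> (W t))\<^sup>2 \<partial>Mt)
      \<le> (L2_norm \<Omega> (w 0))\<^sup>2 + (\<integral>t. D t \<partial>Mt) / C\<^sub>A
        + (2 * C\<^sub>\<psi> + C\<^sub>A) * (\<integral>t. indicator {0<..s} t * (L2_norm \<Omega> (w t))\<^sup>2 \<partial>Mt)"
proof -
  obtain W where gradW: "has_space_gradient T \<Omega> w W" and WQ: "W \<in> Q_L2"
    and H1int: "integrable Mt (\<lambda>t. (H1_norm \<Omega> (w t))\<^sup>2)"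
    and uw: "integrable Mt (\<lambda>t. \<integral>x. (u\<^sub>1 t x - u\<^sub>2 t x) * w t x \<partial>lebesgue_on \<Omega>)"
    and energy: "\<And>s. s \<in> {0..T} \<Longrightarrow> ((L2_norm \<Omega> (w s))\<^sup>2 - (L2_norm \<Omega> (w 0))\<^sup>2) / 2
        + C\<^sub>A * (\<integral>t. indicator {0<..s} t * (L2_norm \<Omega> (W t))\<^sup>2 \<partial>Mt)
        - C\<^sub>\<psi> * (\<integral>t. indicator {0<..s} t * (L2_norm \<Omega> (w t))\<^sup>2 \<partial>Mt)
      \<le> (\<integral>t. indicator {0<..s} t * (\<integral>x. (u\<^sub>1 t x - u\<^sub>2 t x) * w t x \<partial>lebesgue_on \<Omega>) \<partial>Mt)"
    unfolding w_def by (rule weak_solution_difference[OF sol u A' \<psi>']) (use that in blast)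
  have Dint: "integrable Mt D" unfolding D_def by (rule integrable_H1_dual_norm_power2[OF u])
  have wQ: "w \<in> Q_L2"
    unfolding w_def
    using weak_solution_C_L2[OF sol(1)] weak_solution_C_L2[OF sol(2)] weak_solution_Linf_H1[OF sol(1)] weak_solution_Linf_H1[OF sol(2)]
    by (intro Q_L2_diff C_L2_imp_Q_L2) (auto simp: Linf_H1_def)
  have uL2: "AE t in Mt. u\<^sub>1 t - u\<^sub>2 t \<in> L2_space \<Omega>"
    by (rule Q_L2_D(2)[OF Q_L2_diff[OF u[THEN L2_L2_imp_Q_L2]]])
  define g where "g t = (L2_norm \<Omega> (w t))\<^sup>2" for t
  define h where "h t = (L2_norm \<Omega> (W t))\<^sup>2" for t
  have gint: "integrable Mt g" unfolding g_def using Q_L2_D(3)[OF wQ] .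
  have hint: "integrable Mt h" unfolding h_def using Q_L2_D(3)[OF WQ] .
  have "g s + C\<^sub>A * (\<integral>t. indicator {0<..s} t * h t \<partial>Mt)
      \<le> g 0 + (\<integral>t. D t \<partial>Mt) / C\<^sub>A + (2 * C\<^sub>\<psi> + C\<^sub>A) * (\<integral>t. indicator {0<..s} t * g t \<partial>Mt)"
    if s: "s \<in> {0..T}" for s
  proof -
    let ?I = "indicat_real {0<..s}"
    let ?up = "\<lambda>t. \<integral>x. (u\<^sub>1 t x - u\<^sub>2 t x) * w t x \<partial>lebesgue_on \<Omega>"
    note ind = integrable_indicator_mult[of "{0..T}" _ "{0<..s}"]
    have ints: "integrable Mt (\<lambda>t. ?I t * D t)" "integrable Mt (\<lambda>t. ?I t * g t)" "integrable Mt (\<lambda>t. ?I t * h t)"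
      "integrable Mt (\<lambda>t. ?I t * ?up t)"
      using ind[OF Dint] ind[OF gint] ind[OF hint] ind[OF uw] by simp_all
    have "(\<integral>t. ?I t * ?up t \<partial>Mt)
        \<le> (\<integral>t. (?I t * D t) / (2 * C\<^sub>A) + C\<^sub>A / 2 * (?I t * g t) + C\<^sub>A / 2 * (?I t * h t) \<partial>Mt)"
    proof (rule integral_mono_AE)
      show "integrable Mt (\<lambda>t. (?I t * D t) / (2 * C\<^sub>A) + C\<^sub>A / 2 * (?I t * g t) + C\<^sub>A / 2 * (?I t * h t))"
        using ints by (intro Bochner_Integration.integrable_add integrable_mult_right integrable_divide)
      show "AE t in Mt. ?I t * ?up t \<le> (?I t * D t) / (2 * C\<^sub>A) + C\<^sub>A / 2 * (?I t * g t) + C\<^sub>A / 2 * (?I t * h t)"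
        using uL2 H1_norm_power2_gradient[OF gradW]
      proof eventually_elim
        case (elim t)
        define d n where "d = H1_dual_norm \<Omega> (u\<^sub>1 t - u\<^sub>2 t)" and "n = H1_norm \<Omega> (w t)"
        have "?up t \<le> d * n"
          using H1_dual_norm_bound[OF elim(1), of "w t"] elim(2) by (simp add: d_def n_def)
        \<comment> \<open>Young's inequality, from the square of \<open>d - C\<^sub>A * n\<close>
          divided by \<open>2 * C\<^sub>A\<close>.\<close>
        also have "\<dots> \<le> d\<^sup>2 / (2 * C\<^sub>A) + C\<^sub>A / 2 * n\<^sup>2"
          using zero_le_power2[of "d - C\<^sub>A * n"] C\<^sub>A by (simp add: power2_eq_square field_simps)
        also have "\<dots> = D t / (2 * C\<^sub>A) + C\<^sub>A / 2 * g t + C\<^sub>A / 2 * h t"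
          using elim(2) by (simp add: D_def d_def n_def g_def h_def distrib_left)
        finally show ?case by (cases "t \<in> {0<..s}") simp_all
      qed
    qed (rule ints)
    also have "\<dots> = (\<integral>t. ?I t * D t \<partial>Mt) / (2 * C\<^sub>A) + (C\<^sub>A * (\<integral>t. ?I t * g t \<partial>Mt)) / 2
        + (C\<^sub>A * (\<integral>t. ?I t * h t \<partial>Mt)) / 2"
      using ints by simp
    finally have up: "(\<integral>t. ?I t * ?up t \<partial>Mt)
        \<le> (\<integral>t. ?I t * D t \<partial>Mt) / (2 * C\<^sub>A) + (C\<^sub>A * (\<integral>t. ?I t * g t \<partial>Mt)) / 2
          + (C\<^sub>A * (\<integral>t. ?I t * h t \<partial>Mt)) / 2" .
    have "(\<integral>t. ?I t * D t \<partial>Mt) / (2 * C\<^sub>A) \<le> (\<integral>t. D t \<partial>Mt) / (2 * C\<^sub>A)"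
      using C\<^sub>A by (intro divide_right_mono integral_indicator_le Dint) (auto simp: D_def)
    also have "\<dots> = (\<integral>t. D t \<partial>Mt) / C\<^sub>A / 2" by simp
    finally have D_le: "(\<integral>t. ?I t * D t \<partial>Mt) / (2 * C\<^sub>A) \<le> (\<integral>t. D t \<partial>Mt) / C\<^sub>A / 2" .
    \<comment> \<open>The final arithmetic with the integrals as plain variables:
      \<open>e\<^sub>1\<close> is the gradient term, \<open>e\<^sub>2\<close> and
      \<open>e\<^sub>3\<close> are the L^2 terms with factors \<open>C\<^sub>A\<close> and
      \<open>C\<^sub>\<psi>\<close>, \<open>e\<^sub>4\<close> and \<open>e\<^sub>5\<close> come from
      the forcing. Half of \<open>e\<^sub>1\<close> is absorbed, then everything is doubled.\<close>
    have rearrange: "p + e\<^sub>1 \<le> q + e\<^sub>5 + (2 * e\<^sub>3 + e\<^sub>2)"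
      if "e\<^sub>4 \<le> e\<^sub>5 / 2" "(p - q) / 2 + e\<^sub>1 - e\<^sub>3 \<le> X" "X \<le> e\<^sub>4 + e\<^sub>2 / 2 + e\<^sub>1 / 2"
      for p q X e\<^sub>1 e\<^sub>2 e\<^sub>3 e\<^sub>4 e\<^sub>5 :: real
      using that by argo
    show ?thesis
      using D_le energy[OF s, folded g_def h_def] up unfolding distrib_right mult.assoc by (rule rearrange)
  qed
  then show thesis
    using that[OF gradW WQ H1int Dint] by (simp only: g_def h_def)
qed

text \<open>With the data collected in \<open>a\<close>, Gronwall at rate \<open>b\<close> bounds
  |w|^2 by a M, so its time integral is at most a T M. Put back into the energy estimate at time T,
  this bounds the integral of the squared gradient norm by a (1 + b T M) / C_A. The first factor of
  the constant adds the resulting square roots; the second comes from estimating sqrt a by the data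
  norms.\<close>

lemma weak_solution_Lipschitz:
  assumes sol: "weak_solution T \<Omega> A' \<psi>' y\<^sub>1\<^sub>0 u\<^sub>1 y\<^sub>1" "weak_solution T \<Omega> A' \<psi>' y\<^sub>2\<^sub>0 u\<^sub>2 y\<^sub>2"
    and init: "y\<^sub>1\<^sub>0 \<in> L2_space \<Omega>" "y\<^sub>2\<^sub>0 \<in> L2_space \<Omega>"
    and u: "u\<^sub>1 \<in> L2_L2 T \<Omega>" "u\<^sub>2 \<in> L2_L2 T \<Omega>"
    and A': "continuous_on UNIV A'" "\<And>p. norm (A' p) \<le> k * norm p"
      "\<And>p q. C\<^sub>A * (norm (p - q))\<^sup>2 \<le> (A' p - A' q) \<bullet> (p - q)"
    and \<psi>': "\<And>a b. - C\<^sub>\<psi> * (a - b)\<^sup>2 \<le> (\<psi>' a - \<psi>' b) * (a - b)"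
    and C\<^sub>A: "0 < C\<^sub>A" and C\<^sub>\<psi>: "0 \<le> C\<^sub>\<psi>"
  defines "b \<equiv> 2 * C\<^sub>\<psi> + C\<^sub>A"
  defines "M \<equiv> exp (b * T)"
  shows "C_L2_norm T \<Omega> (\<lambda>t. y\<^sub>1 t - y\<^sub>2 t) + L2_time_norm T (H1_norm \<Omega>) (\<lambda>t. y\<^sub>1 t - y\<^sub>2 t)
    \<le> (sqrt M + sqrt (T * M + (1 + b * (T * M)) / C\<^sub>A)) * (1 + 1 / sqrt C\<^sub>A)
        * (L2_norm \<Omega> (y\<^sub>1\<^sub>0 - y\<^sub>2\<^sub>0) + L2_time_norm T (H1_dual_norm \<Omega>) (\<lambda>t. u\<^sub>1 t - u\<^sub>2 t))"
proof -
  define w where "w t = y\<^sub>1 t - y\<^sub>2 t" for t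
  define D where "D t = (H1_dual_norm \<Omega> (u\<^sub>1 t - u\<^sub>2 t))\<^sup>2" for t
  obtain W where gradW: "has_space_gradient T \<Omega> w W" and WQ: "W \<in> Q_L2"
    and H1int: "integrable Mt (\<lambda>t. (H1_norm \<Omega> (w t))\<^sup>2)" and Dint: "integrable Mt D"
    and energy: "\<And>s. s \<in> {0..T} \<Longrightarrow> (L2_norm \<Omega> (w s))\<^sup>2 + C\<^sub>A * (\<integral>t. indicator {0<..s} t * (L2_norm \<Omega> (W t))\<^sup>2 \<partial>Mt)
      \<le> (L2_norm \<Omega> (w 0))\<^sup>2 + (\<integral>t. D t \<partial>Mt) / C\<^sub>A
        + b * (\<integral>t. indicator {0<..s} t * (L2_norm \<Omega> (w t))\<^sup>2 \<partial>Mt)"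
    unfolding w_def[abs_def] D_def[abs_def] b_def
    by (rule weak_solution_energy_estimate[OF sol u A' \<psi>' C\<^sub>A]) (use that in blast)
  define g where "g t = (L2_norm \<Omega> (w t))\<^sup>2" for t
  define h where "h t = (L2_norm \<Omega> (W t))\<^sup>2" for t
  define a where "a = g 0 + (\<integral>t. D t \<partial>Mt) / C\<^sub>A"
  have wC: "w \<in> C_L2 T \<Omega>"
    unfolding w_def[abs_def] using weak_solution_C_L2[OF sol(1)] weak_solution_C_L2[OF sol(2)] by (rule C_L2_diff)
  have gcont: "continuous_on {0..T} g"
    unfolding g_def[abs_def] by (intro continuous_on_power C_L2_norm_continuous wC)
  then have gint: "integrable Mt g" by (rule continuous_imp_integrable_real)
  have hint: "integrable Mt h" unfolding h_def using Q_L2_D(3)[OF WQ] .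
  have nonneg: "0 \<le> D t" "0 \<le> g t" "0 \<le> h t" for t by (simp_all add: D_def g_def h_def)
  have b: "b \<ge> 0" using C\<^sub>A C\<^sub>\<psi> by (simp add: b_def)
  have a: "a \<ge> 0"
    unfolding a_def using nonneg C\<^sub>A by (intro add_nonneg_nonneg divide_nonneg_pos integral_nonneg_AE) auto
  have M: "M \<ge> 1" using b T_pos by (simp add: M_def)
  have est: "g s + C\<^sub>A * (\<integral>t. indicator {0<..s} t * h t \<partial>Mt) \<le> a + b * (\<integral>t. indicator {0<..s} t * g t \<partial>Mt)"
    if "s \<in> {0..T}" for s
    using energy[OF that] by (simp add: g_def h_def a_def)
  have g_le: "g s \<le> a * M" if s: "s \<in> {0..T}" for s
  proof -
    have "g s \<le> a * exp (b * s)"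
    proof (rule Gronwall_integral[OF gcont b s])
      fix s assume s: "s \<in> {0..T}"
      \<comment> \<open>Gronwall is applied after dropping the gradient term.\<close>
      have "0 \<le> C\<^sub>A * (\<integral>t. indicator {0<..s} t * h t \<partial>Mt)"
        using nonneg C\<^sub>A by (intro mult_nonneg_nonneg integral_nonneg_AE AE_I2) auto
      then show "g s \<le> a + b * integral {0..s} g"
        using est[OF s] unfolding integral_indicator_Ioc[OF gint s] by linarith
    qed
    also have "\<dots> \<le> a * M" unfolding M_def using s a b by (intro mult_left_mono) (auto intro: mult_left_mono)
    finally show ?thesis .
  qed
  have "(\<integral>t. g t \<partial>Mt) \<le> (\<integral>t. a * M \<partial>Mt)"
    using gint g_le by (intro integral_mono) auto
  also have "\<dots> = T * (a * M)"
    using T_pos by (simp add: measure_restrict_space)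
  finally have g_int_le: "(\<integral>t. g t \<partial>Mt) \<le> T * (a * M)" .
  \<comment> \<open>Now the gradient term is kept, at s = T, and \<open>g T\<close> is
    dropped.\<close>
  have "C\<^sub>A * (\<integral>t. h t \<partial>Mt) \<le> a + b * (\<integral>t. g t \<partial>Mt)"
    using est[of T] T_pos nonneg(2)[of T] by (simp add: integral_indicator_full[OF gint] integral_indicator_full[OF hint])
  also have "\<dots> \<le> a + b * (T * (a * M))" using g_int_le b by (intro add_left_mono mult_left_mono)
  finally have h_int_le: "(\<integral>t. h t \<partial>Mt) \<le> a * ((1 + b * (T * M)) / C\<^sub>A)"
    using C\<^sub>A by (simp add: field_simps)
  have "(\<integral>t. (H1_norm \<Omega> (w t))\<^sup>2 \<partial>Mt) = (\<integral>t. g t + h t \<partial>Mt)"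
  proof (rule integral_cong_AE)
    show "AE t in Mt. (H1_norm \<Omega> (w t))\<^sup>2 = g t + h t"
      using H1_norm_power2_gradient[OF gradW] by eventually_elim (simp add: g_def h_def)
  qed (use H1int gint hint in auto)
  also have "\<dots> \<le> a * (T * M + (1 + b * (T * M)) / C\<^sub>A)"
    using g_int_le h_int_le gint hint by (simp add: algebra_simps)
  finally have "L2_time_norm T (H1_norm \<Omega>) w \<le> sqrt (a * (T * M + (1 + b * (T * M)) / C\<^sub>A))"
    unfolding L2_time_norm_def by (rule real_sqrt_le_mono)
  then have time: "L2_time_norm T (H1_norm \<Omega>) w \<le> sqrt a * sqrt (T * M + (1 + b * (T * M)) / C\<^sub>A)"
    by (simp add: real_sqrt_mult)
  have space: "C_L2_norm T \<Omega> w \<le> sqrt a * sqrt M"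
    unfolding C_L2_norm_def
  proof (rule cSUP_least)
    fix t assume "t \<in> {0..T}"
    then have "(L2_norm \<Omega> (w t))\<^sup>2 \<le> a * M" using g_le by (simp add: g_def)
    then have "L2_norm \<Omega> (w t) \<le> sqrt (a * M)" by (rule real_le_rsqrt)
    then show "L2_norm \<Omega> (w t) \<le> sqrt a * sqrt M" by (simp add: real_sqrt_mult)
  qed (use T_pos in auto)
  define N U where "N = L2_norm \<Omega> (y\<^sub>1\<^sub>0 - y\<^sub>2\<^sub>0)" and "U = L2_time_norm T (H1_dual_norm \<Omega>) (\<lambda>t. u\<^sub>1 t - u\<^sub>2 t)"
  have NU: "0 \<le> N" "0 \<le> U" by (auto simp: N_def U_def L2_time_norm_def intro!: integral_nonneg_AE)
  have "AE x in lebesgue_on \<Omega>. y\<^sub>1 0 x = y\<^sub>1\<^sub>0 x" "AE x in lebesgue_on \<Omega>. y\<^sub>2 0 x = y\<^sub>2\<^sub>0 x"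
    using sol by (simp_all add: weak_solution_def)
  \<comment> \<open>The initial condition fixes \<open>w 0\<close> up to a null set, which the L^2
    norm does not see.\<close>
  then have "AE x in lebesgue_on \<Omega>. w 0 x = (y\<^sub>1\<^sub>0 - y\<^sub>2\<^sub>0) x"
    by eventually_elim (simp add: w_def)
  then have "L2_norm \<Omega> (w 0) = N"
    unfolding N_def using C_L2_D(1)[OF wC, of 0] T_pos L2_space_diff[OF init] by (intro L2_norm_cong_AE) auto
  moreover have "(\<integral>t. D t \<partial>Mt) = U\<^sup>2"
    unfolding U_def L2_time_norm_def D_def by (simp add: integral_nonneg_AE)
  ultimately have "sqrt a = sqrt (N\<^sup>2 + U\<^sup>2 / C\<^sub>A)" by (simp add: a_def g_def)
  also have "\<dots> \<le> sqrt (N\<^sup>2) + sqrt (U\<^sup>2 / C\<^sub>A)" using C\<^sub>A by (intro sqrt_add_le_add_sqrt) auto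
  also have "\<dots> = N + 1 / sqrt C\<^sub>A * U" using NU by (simp add: real_sqrt_divide)
  also have "\<dots> \<le> (1 + 1 / sqrt C\<^sub>A) * (N + U)" using NU C\<^sub>A by (simp add: distrib_left distrib_right)
  finally have "sqrt a \<le> (1 + 1 / sqrt C\<^sub>A) * (N + U)" .
  moreover have "0 \<le> sqrt M + sqrt (T * M + (1 + b * (T * M)) / C\<^sub>A)"
    using M b T_pos C\<^sub>A by (intro add_nonneg_nonneg) auto
  ultimately have "(sqrt M + sqrt (T * M + (1 + b * (T * M)) / C\<^sub>A)) * sqrt a
      \<le> (sqrt M + sqrt (T * M + (1 + b * (T * M)) / C\<^sub>A)) * ((1 + 1 / sqrt C\<^sub>A) * (N + U))"
    by (rule mult_left_mono)
  moreover have "C_L2_norm T \<Omega> w + L2_time_norm T (H1_norm \<Omega>) w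
      \<le> (sqrt M + sqrt (T * M + (1 + b * (T * M)) / C\<^sub>A)) * sqrt a"
    using add_mono[OF space time] by (simp only: distrib_right mult.commute[of "sqrt a"])
  ultimately have "C_L2_norm T \<Omega> w + L2_time_norm T (H1_norm \<Omega>) w
      \<le> (sqrt M + sqrt (T * M + (1 + b * (T * M)) / C\<^sub>A)) * ((1 + 1 / sqrt C\<^sub>A) * (N + U))"
    by (rule order_trans[rotated])
  then show ?thesis by (simp only: w_def[abs_def] N_def U_def mult.assoc)
qed

end

text \<open>The function f + C id is nondecreasing. The conclusion contains no derivative of
  \<open>f\<close>, so it survives pointwise limits; it is applied to the derivatives of the
  approximating potentials.\<close>

lemma derivative_diff_lower_bound:
  fixes f f' :: "real \<Rightarrow> real"
  assumes "\<And>s. (f has_real_derivative f' s) (at s)" "\<And>s. - C \<le> f' s"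
  shows "- C * (a - b)\<^sup>2 \<le> (f a - f b) * (a - b)"
proof -
  have mono: "f x + C * x \<le> f y + C * y" if "x \<le> y" for x y
  proof (rule DERIV_nonneg_imp_nondecreasing[OF that])
    fix s
    have "((\<lambda>s. f s + C * s) has_real_derivative f' s + C) (at s)"
      by (auto intro!: derivative_eq_intros assms(1))
    then show "\<exists>y. ((\<lambda>s. f s + C * s) has_real_derivative y) (at s) \<and> 0 \<le> y"
      using assms(2)[of s] by (intro exI[of _ "f' s + C"]) auto
  qed
  have "0 \<le> (f a + C * a - (f b + C * b)) * (a - b)"
    using mono[of a b] mono[of b a] by (cases "a \<le> b") (auto intro: mult_nonpos_nonpos mult_nonneg_nonneg)
  then show ?thesis by (simp add: power2_eq_square algebra_simps)
qed

theorem theorem2p7: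
  fixes T :: real
    and A :: "real ^ 'd \<Rightarrow> real" and A' :: "real ^ 'd \<Rightarrow> real ^ 'd" and C\<^sub>A Cbar\<^sub>A :: real
    and \<psi> \<psi>' :: "real \<Rightarrow> real" and c C\<^sub>\<psi> :: real and Cn :: "nat \<Rightarrow> real"
    and f f' f'' :: "nat \<Rightarrow> real \<Rightarrow> real"
  assumes T: "0 < T"
    and A_C1: "\<And>p. GDERIV A p :> A' p" "continuous_on UNIV A'"
    and A_const: "C\<^sub>A > 0" "Cbar\<^sub>A > 0"
    and A_mono: "\<And>p q. (A' p - A' q) \<bullet> (p - q) \<ge> C\<^sub>A * (norm (p - q))\<^sup>2"
    and A_growth: "\<And>p. norm (A' p) \<le> Cbar\<^sub>A * norm p"
    and psi_C1: "\<And>s. (\<psi> has_real_derivative \<psi>' s) (at s)" "continuous_on UNIV \<psi>'"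
    and psi_bdd: "bdd_below (range \<psi>)"
    and f_const: "c \<ge> 0" "C\<^sub>\<psi> \<ge> 0" "\<And>n. Cn n \<ge> 0"
    and f_C2: "\<And>n s. (f n has_real_derivative f' n s) (at s)"
      "\<And>n s. (f' n has_real_derivative f'' n s) (at s)"
      "\<And>n. continuous_on UNIV (f'' n)"
    and f_conv: "\<And>K. compact K \<Longrightarrow> uniform_limit K f \<psi> sequentially"
      "\<And>K. compact K \<Longrightarrow> uniform_limit K f' \<psi>' sequentially"
    and f_bounds: "\<And>n s. - c \<le> f n s" "\<And>n s. f n s \<le> c * (\<psi> s + 1)"
    and f''_bounds: "\<And>n s. f'' n s \<ge> - C\<^sub>\<psi>" "\<And>n s. \<bar>f'' n s\<bar> \<le> Cn n"
  shows "\<exists>C. \<forall>\<Omega> :: (real ^ 'd) set. bounded_lipschitz_domain \<Omega> \<longrightarrow>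
    (\<forall>y\<^sub>1\<^sub>0 y\<^sub>2\<^sub>0 u\<^sub>1 u\<^sub>2 y\<^sub>1 y\<^sub>2.
       y\<^sub>1\<^sub>0 \<in> H1_space \<Omega> \<and> integrable (lebesgue_on \<Omega>) (\<lambda>x. \<psi> (y\<^sub>1\<^sub>0 x)) \<and> u\<^sub>1 \<in> L2_L2 T \<Omega> \<and>
       y\<^sub>2\<^sub>0 \<in> H1_space \<Omega> \<and> integrable (lebesgue_on \<Omega>) (\<lambda>x. \<psi> (y\<^sub>2\<^sub>0 x)) \<and> u\<^sub>2 \<in> L2_L2 T \<Omega> \<and>
       weak_solution T \<Omega> A' \<psi>' y\<^sub>1\<^sub>0 u\<^sub>1 y\<^sub>1 \<and> weak_solution T \<Omega> A' \<psi>' y\<^sub>2\<^sub>0 u\<^sub>2 y\<^sub>2 \<longrightarrow>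
       C_L2_norm T \<Omega> (\<lambda>t. y\<^sub>1 t - y\<^sub>2 t) + L2_time_norm T (H1_norm \<Omega>) (\<lambda>t. y\<^sub>1 t - y\<^sub>2 t)
         \<le> C * (L2_norm \<Omega> (y\<^sub>1\<^sub>0 - y\<^sub>2\<^sub>0)
                 + L2_time_norm T (H1_dual_norm \<Omega>) (\<lambda>t. u\<^sub>1 t - u\<^sub>2 t)))"
proof -
  \<comment> \<open>The constant is built from T, \<open>C\<^sub>A\<close> and
    \<open>C\<^sub>\<psi>\<close> before \<Omega> is introduced, and so is uniform in the
    domain.\<close>
  define b where "b = 2 * C\<^sub>\<psi> + C\<^sub>A"
  define M where "M = exp (b * T)"
  define C where "C = (sqrt M + sqrt (T * M + (1 + b * (T * M)) / C\<^sub>A)) * (1 + 1 / sqrt C\<^sub>A)"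
  have psi_semimono: "- C\<^sub>\<psi> * (a - b)\<^sup>2 \<le> (\<psi>' a - \<psi>' b) * (a - b)" for a b
  proof (rule LIMSEQ_le_const)
    \<comment> \<open>Local uniform convergence of the derivatives, used on the compact set
      \<open>{s}\<close>.\<close>
    have lim: "(\<lambda>n. f' n s) \<longlonglongrightarrow> \<psi>' s" for s
      using f_conv(2)[of "{s}"] by (rule tendsto_uniform_limitI) auto
    show "(\<lambda>n. (f' n a - f' n b) * (a - b)) \<longlonglongrightarrow> (\<psi>' a - \<psi>' b) * (a - b)"
      by (intro tendsto_intros lim)
    \<comment> \<open>The inequality holds for every n with the same \<open>C\<^sub>\<psi>\<close>,
      whereas the bounds \<open>Cn n\<close> may grow with n.\<close>
    show "\<exists>N. \<forall>n\<ge>N. - C\<^sub>\<psi> * (a - b)\<^sup>2 \<le> (f' n a - f' n b) * (a - b)"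
      using derivative_diff_lower_bound[OF f_C2(2) f''_bounds(1)] by blast
  qed
  show ?thesis
  proof (rule exI[of _ C], intro allI impI, elim conjE)
    fix \<Omega> :: "(real ^ 'd) set" and y\<^sub>1\<^sub>0 y\<^sub>2\<^sub>0 u\<^sub>1 u\<^sub>2 y\<^sub>1 y\<^sub>2
    assume \<Omega>: "bounded_lipschitz_domain \<Omega>" and init: "y\<^sub>1\<^sub>0 \<in> H1_space \<Omega>" "y\<^sub>2\<^sub>0 \<in> H1_space \<Omega>"
      and u: "u\<^sub>1 \<in> L2_L2 T \<Omega>" "u\<^sub>2 \<in> L2_L2 T \<Omega>"
      and sol: "weak_solution T \<Omega> A' \<psi>' y\<^sub>1\<^sub>0 u\<^sub>1 y\<^sub>1" "weak_solution T \<Omega> A' \<psi>' y\<^sub>2\<^sub>0 u\<^sub>2 y\<^sub>2"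
    interpret time_cylinder \<Omega> T
      using \<Omega> T by unfold_locales (auto simp: bounded_lipschitz_domain_def)
    show "C_L2_norm T \<Omega> (\<lambda>t. y\<^sub>1 t - y\<^sub>2 t) + L2_time_norm T (H1_norm \<Omega>) (\<lambda>t. y\<^sub>1 t - y\<^sub>2 t)
        \<le> C * (L2_norm \<Omega> (y\<^sub>1\<^sub>0 - y\<^sub>2\<^sub>0) + L2_time_norm T (H1_dual_norm \<Omega>) (\<lambda>t. u\<^sub>1 t - u\<^sub>2 t))"
      unfolding C_def M_def b_def
      by (rule weak_solution_Lipschitz[OF sol H1_space_L2[OF init(1)] H1_space_L2[OF init(2)] u
            A_C1(2) A_growth A_mono psi_semimono A_const(1) f_const(2)])
  qed
qed

end
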